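(* Consider the linear regression model and the posterior distributions $\Pi(\cdot\mid\mathcal D)$ of $\bm\theta$ and of $\sigma^2$ described in the context, with $0<R\le\infty$, where $\mathrm{tr}(\Sigma)\to\infty$ as $n\to\infty$. Suppose that: (i) $\|\Sigma\|_{\mathrm{op}}$ is bounded in $n$, and there are non-negative sequences $\rho_n=o(1)$ and $\ell_n=o(1)$ such that for every sufficiently large $n$, $\mathbb P\big(\|\hat\Sigma-\Sigma\|_{\mathrm{op}}/\|\Sigma\|_{\mathrm{op}}\le\rho_n\big)\ge1-\ell_n$; moreover $\rho_n=o(\lambda_{L_\kappa+1})$; (ii) $R$ satisfies $\|\bm\theta^*\|_\Sigma<R/2$, and $\|\bm\theta^*\|_2<\infty$ (bounded in $n$). Let $\{\varepsilon_n\}_{n\in\mathbb N}$ be any sequence of positive reals such that for any $\delta>0$ and $M>0$ there exists $\overline n\in\mathbb N$ such that for every $n\ge\overline n$ all of the following hold: $$\varepsilon_n<\delta,\qquad n\varepsilon_n^2>M,\qquad \frac n{\lambda_{L_\kappa}}>r_{L_\kappa}(\Sigma)R_{L_\kappa}(\Sigma),\qquad \varepsilon_n^2>4\|\bm\theta^*\|_2^2\sum_{i=L_\kappa+1}^p\lambda_i,\qquad \max\{V_n(\varepsilon_n),B_n\}\le\varepsilon_n^2.$$ Then, as $n\to\infty$, for some constant $C>0$, $$\Pi\big(\{\bm\theta:\|\bm\theta-\bm\theta^*\|_\Sigma>C\varepsilon_n\}\mid\mathcal D\big)\to0\quad\text{in }P^*\text{-probability}.$$ Additionally, for the posterior distribution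 of $\sigma^2$, for some constant $C>0$, $$\Pi\big(\{\sigma^2:|\sigma^2-(\sigma^* )^2|>C\varepsilon_n\}\mid\mathcal D\big)\to0\quad\text{in }P^*\text{-probability}.$$
   Context: Model. For each (even) $n$ one observes i.i.d. pairs $\mathcal D=\{(y_i,\bm x_i)\}_{i=1}^n$ in $\mathbb R\times\mathbb R^p$ with $y_i=\bm x_i^\top\bm\theta^*+\varepsilon_i$, where $\bm\theta^*\in\mathbb R^p$, the $\varepsilon_i\sim N(0,(\sigma^* )^2)$ are i.i.d. and independent of the covariates, and $(\sigma^* )^2>0$. The law of the data is denoted $P^*$. The $\bm x_i$ have mean zero and a non-atomic distribution. $\Sigma=E[\bm x_i\bm x_i^\top]$ has eigenvalues $\lambda_1\ge\dots\ge\lambda_p\ge0$. The dimension $p=p_n>n/2$ increases with $n$, and $\Sigma$, $\bm\theta^*$ and the law of $\bm x_i$ may depend on $n$. For a symmetric matrix $A$, $\|\bm v\|_A=\sqrt{\bm v^\top A\bm v}$; $\|\cdot\|_{\mathrm{op}}$ is the Euclidean operator norm. $\sum_{i>k}$ means $\sum_{i=k+1}^p$. Data split. $\mathcal D_1$ is the first $n/2$ observations, $\mathcal D_2$ the last $n/2$. $\hat\Sigma=\frac2n\sum_{i\le n/2}(\bm x_i-\bar{\bm x})(\bm x_i-\bar{\bm x})^\top$ with $\bar{\bm x}=\frac2n\sum_{i\le n/2}\bm x_i$. Its eigenvalues are $\hat\lambda_1\ge\dots\ge\hat\lambda_p\ge0$ with orthonormal eigenvectors $\hat{\bm v}_1,\dots,\hat{\bm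 v}_p$. Put $\tilde\Sigma_{1:k}=\mathrm{diag}(\hat\lambda_1,\dots,\hat\lambda_k)$ and $T_{\mathcal D_1,k}(\bm\beta)=\sum_{i=1}^k\beta_i\hat{\bm v}_i$, a bijection from $\mathbb R^k$ onto $S_{\mathcal D_1,k}=\mathrm{span}\{\hat{\bm v}_1,\dots,\hat{\bm v}_k\}$ (the prior below implicitly requires $\hat\lambda_k>0$ for the $k$ used). Prior. - Given $k$, the coefficient vector $\bm\beta_{1:k}\in\mathbb R^k$ has density $\pi_{\mathfrak b}(\bm\beta_{1:k}\mid\mathcal D_1,k)\propto\exp\{-\bm\beta_{1:k}^\top\tilde\Sigma_{1:k}^{-1}\bm\beta_{1:k}\}\,\mathbf 1\{\|\bm\beta_{1:k}\|_{\tilde\Sigma_{1:k}}\le R\}$ with respect to Lebesgue measure, normalized to be a probability density, and $\bm\theta=T_{\mathcal D_1,k}(\bm\beta_{1:k})$. - $k$ has prior $\pi_\kappa(k)=e^{f(k)}/\sum_{k'=L_\kappa}^{U_\kappa}e^{f(k')}$ on $\{L_\kappa,\dots,U_\kappa\}$, where $f:\mathbb N\to\mathbb R$ and $1\le L_\kappa\le U_\kappa<n/2$ are integers that may depend on $n$, with $L_\kappa\to\infty$. - $\sigma^2>0$ has the inverse-Gaussian density $\pi_{\varsigma^2}(\sigma^2)=\sqrt{\xi/(2\pi\sigma^6)}\exp\{-\xi(\sigma^2-\eta)^2/(2\eta^2\sigma^2)\}$ with fixed $\eta,\xi>0$. - $(k,\bm\beta_{1:k})$ and $\sigma^2$ are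 independent a priori. Posterior. $\pi(\bm\beta_{1:k},\sigma^2,k\mid\mathcal D)\propto\pi_{\mathfrak b}(\bm\beta_{1:k}\mid\mathcal D_1,k)\pi_\kappa(k)\pi_{\varsigma^2}(\sigma^2)\prod_{(y_i,\bm x_i)\in\mathcal D_2}\phi(y_i;\bm x_i^\top T_{\mathcal D_1,k}(\bm\beta_{1:k}),\sigma^2)$ on $\bigcup_{k=L_\kappa}^{U_\kappa}(\mathbb R^k\times\mathbb R_+\times\{k\})$, where $\phi(\cdot;b,c)$ is the $N(b,c)$ density. The posterior of $\bm\theta$ is $\Pi(B\mid\mathcal D)=\sum_{k=L_\kappa}^{U_\kappa}\int_{T_{\mathcal D_1,k}^{-1}(B\cap S_{\mathcal D_1,k})}\int_{\mathbb R_+}\pi(\bm\beta_{1:k},\sigma^2,k\mid\mathcal D)\,d\sigma^2\,d\bm\beta_{1:k}$ for Borel $B\subset\mathbb R^p$; the posterior of $\sigma^2$ is the corresponding marginal. Effective ranks. $r_k(\Sigma)=\sum_{i>k}\lambda_i/\lambda_{k+1}$ and $R_k(\Sigma)=(\sum_{i>k}\lambda_i)^2/\sum_{i>k}\lambda_i^2$. Effective variance and bias bounds. With $\mathcal I=\{i\in\{1,\dots,U_\kappa\}:n(\lambda_i\sum_{j>L_\kappa}\lambda_j^2)^{1/2}>(\sum_{j>L_\kappa}\lambda_j)^{3/2}\}$, for $\varepsilon>0$, $$V_n(\varepsilon)=\sum_{i\in\mathcal I}\frac1n\log\Big(\frac{n\sqrt{\lambda_i}\sqrt{\sum_{j>L_\kappa}\lambda_j^2}}{(\sum_{j>L_\kappa}\lambda_j)^{3/2}}\Big)+\frac{U_\kappa+\log(n/(2\varepsilon))}{n}+\frac{n\sum_{j>L_\kappa}\lambda_j^2}{(\sum_{j>L_\kappa}\lambda_j)^2},$$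 $$B_n=\frac1n\log\frac1{\pi_\kappa(L_\kappa)}+\frac{\|\bm\theta^*\|_2^2}{n}\sum_{i=1}^{L_\kappa}\frac1{\lambda_i}+\frac{L_\kappa\log n}{n}.$$ *)

theory Defs
  imports "HOL-Probability.Probability" "HOL-Library.Landau_Symbols"
begin

text \<open>
  Dimensions vary with the sample size, so a vector of \<open>\<real>\<^sup>p\<close> is a function on indices of which
  only the coordinates in \<open>{1..p}\<close> matter, and similarly for \<open>p \<times> p\<close> matrices. The Euclidean
  norm of \<open>v\<close> is \<open>L2_set v {1..p}\<close>.
\<close>

type_synonym rvec = "nat \<Rightarrow> real"
type_synonym rmat = "nat \<Rightarrow> nat \<Rightarrow> real"
type_synonym dataset = "nat \<Rightarrow> real \<times> rvec"

definition dotp :: "nat \<Rightarrow> rvec \<Rightarrow> rvec \<Rightarrow> real" where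
  "dotp p u v = (\<Sum>j=1..p. u j * v j)"

definition matvec :: "nat \<Rightarrow> rmat \<Rightarrow> rvec \<Rightarrow> rvec" where
  "matvec p A v = (\<lambda>i. \<Sum>j=1..p. A i j * v j)"

definition quad_form :: "nat \<Rightarrow> rmat \<Rightarrow> rvec \<Rightarrow> real" where
  "quad_form p A v = dotp p v (matvec p A v)"

definition mat_norm :: "nat \<Rightarrow> rmat \<Rightarrow> rvec \<Rightarrow> real" where
  "mat_norm p A v = sqrt (quad_form p A v)"

definition op_norm :: "nat \<Rightarrow> rmat \<Rightarrow> real" where
  "op_norm p A = (SUP u\<in>{u. L2_set u {1..p} \<le> 1}. L2_set (matvec p A u) {1..p})"

definition trace_mat :: "nat \<Rightarrow> rmat \<Rightarrow> real" where
  "trace_mat p A = (\<Sum>i=1..p. A i i)"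

definition diag_matrix :: "rvec \<Rightarrow> rmat" where
  "diag_matrix a = (\<lambda>i j. if i = j then a i else 0)"

text \<open>\<open>lam 1 \<ge> \<dots> \<ge> lam p\<close> are the eigenvalues of \<open>A\<close>, counted with multiplicity, and
  \<open>v 1, \<dots>, v p\<close> are corresponding orthonormal eigenvectors.\<close>

definition eigensystem :: "nat \<Rightarrow> rmat \<Rightarrow> rvec \<Rightarrow> (nat \<Rightarrow> rvec) \<Rightarrow> bool" where
  "eigensystem p A lam v \<longleftrightarrow>
     (\<forall>i\<in>{1..p}. \<forall>j\<in>{1..p}. dotp p (v i) (v j) = (if i = j then 1 else 0)) \<and>
     (\<forall>i\<in>{1..p}. \<forall>j\<in>{1..p}. matvec p A (v i) j = lam i * v i j) \<and>
     antimono_on {1..p} lam"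

text \<open>The sample size is even, and \<open>1 \<le> L \<le> U < n/2\<close> is only possible for \<open>n \<ge> 4\<close>.\<close>

definition sample_sizes :: "nat set" where
  "sample_sizes = {n. even n \<and> 4 \<le> n}"

definition large_n :: "nat filter" where
  "large_n = inf sequentially (principal sample_sizes)"

text \<open>Measurability is part of the definition because \<open>measure\<close> is \<open>0\<close> on non-measurable sets.\<close>

definition tendsto_in_prob ::
  "(nat \<Rightarrow> 'a measure) \<Rightarrow> (nat \<Rightarrow> 'a \<Rightarrow> real) \<Rightarrow> real \<Rightarrow> nat filter \<Rightarrow> bool" where
  "tendsto_in_prob P Z c F \<longleftrightarrow>
     (\<forall>\<^sub>F n in F. Z n \<in> borel_measurable (P n)) \<and>
     (\<forall>e>0. ((\<lambda>n. measure (P n) {w \<in> space (P n). \<bar>Z n w - c\<bar> > e}) \<longlongrightarrow> 0) F)"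

definition nonatomic :: "'a measure \<Rightarrow> bool" where
  "nonatomic M \<longleftrightarrow>
     (\<forall>A\<in>sets M. 0 < emeasure M A \<longrightarrow>
        (\<exists>B\<in>sets M. B \<subseteq> A \<and> 0 < emeasure M B \<and> emeasure M B < emeasure M A))"

definition vec_space :: "nat \<Rightarrow> rvec measure" where
  "vec_space p = Pi\<^sub>M {1..p} (\<lambda>_. borel)"

definition obs_space :: "nat \<Rightarrow> (real \<times> rvec) measure" where
  "obs_space p = borel \<Otimes>\<^sub>M vec_space p"

definition second_moment :: "rvec measure \<Rightarrow> rmat" where
  "second_moment Q = (\<lambda>i j. \<integral>x. x i * x j \<partial>Q)"

text \<open>Law of one pair \<open>(y, x)\<close> with \<open>x \<sim> Q\<close>, \<open>y = x\<^sup>T\<theta> + e\<close> and \<open>e \<sim> N(0, s\<^sup>2)\<close> independent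
  of \<open>x\<close>; \<open>data_law\<close> is the law of \<open>n\<close> i.i.d. such pairs, indexed by \<open>{1..n}\<close>.\<close>

definition obs_law :: "nat \<Rightarrow> rvec measure \<Rightarrow> rvec \<Rightarrow> real \<Rightarrow> (real \<times> rvec) measure" where
  "obs_law p Q theta s =
     distr (Q \<Otimes>\<^sub>M density lborel (\<lambda>e. ennreal (normal_density 0 s e))) (obs_space p)
       (\<lambda>(x, e). (dotp p x theta + e, x))"

definition data_law :: "nat \<Rightarrow> nat \<Rightarrow> rvec measure \<Rightarrow> rvec \<Rightarrow> real \<Rightarrow> dataset measure" where
  "data_law n p Q theta s = Pi\<^sub>M {1..n} (\<lambda>_. obs_law p Q theta s)"

definition first_half :: "nat \<Rightarrow> dataset \<Rightarrow> dataset" where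
  "first_half n d = restrict d {1..n div 2}"

definition half_space :: "nat \<Rightarrow> nat \<Rightarrow> dataset measure" where
  "half_space n p = Pi\<^sub>M {1..n div 2} (\<lambda>_. obs_space p)"

definition sample_mean :: "nat \<Rightarrow> dataset \<Rightarrow> rvec" where
  "sample_mean n d = (\<lambda>a. 2 / real n * (\<Sum>i=1..n div 2. snd (d i) a))"

definition sample_cov :: "nat \<Rightarrow> dataset \<Rightarrow> rmat" where
  "sample_cov n d = (\<lambda>a b. 2 / real n *
     (\<Sum>i=1..n div 2. (snd (d i) a - sample_mean n d a) * (snd (d i) b - sample_mean n d b)))"

text \<open>The arguments \<open>la\<close> and \<open>v\<close> below stand for the eigenvalues and eigenvectors computed from
  the first half of the data.\<close>

definition beta_kernel :: "nat \<Rightarrow> rvec \<Rightarrow> ereal \<Rightarrow> rvec \<Rightarrow> real" where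
  "beta_kernel k la R b =
     exp (- quad_form k (diag_matrix (\<lambda>i. 1 / la i)) b) *
     (if ereal (mat_norm k (diag_matrix la) b) \<le> R then 1 else 0)"

definition beta_prior :: "nat \<Rightarrow> rvec \<Rightarrow> ereal \<Rightarrow> rvec \<Rightarrow> real" where
  "beta_prior k la R b =
     beta_kernel k la R b / (\<integral>b'. beta_kernel k la R b' \<partial>(Pi\<^sub>M {1..k} (\<lambda>_. lborel)))"

definition k_prior :: "nat \<Rightarrow> nat \<Rightarrow> (nat \<Rightarrow> real) \<Rightarrow> nat \<Rightarrow> real" where
  "k_prior L U f k = exp (f k) / (\<Sum>k'=L..U. exp (f k'))"

definition inv_gauss_density :: "real \<Rightarrow> real \<Rightarrow> real \<Rightarrow> real" where
  "inv_gauss_density eta xi s2 =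
     sqrt (xi / (2 * pi * s2 ^ 3)) * exp (- (xi * (s2 - eta)\<^sup>2) / (2 * eta\<^sup>2 * s2))"

definition T_embed :: "nat \<Rightarrow> nat \<Rightarrow> (nat \<Rightarrow> rvec) \<Rightarrow> rvec \<Rightarrow> rvec" where
  "T_embed p k v b = (\<lambda>j\<in>{1..p}. \<Sum>i=1..k. b i * v i j)"

definition likelihood2 :: "nat \<Rightarrow> nat \<Rightarrow> dataset \<Rightarrow> rvec \<Rightarrow> real \<Rightarrow> real" where
  "likelihood2 n p d theta s2 =
     (\<Prod>i=n div 2 + 1..n. normal_density (dotp p (snd (d i)) theta) (sqrt s2) (fst (d i)))"

text \<open>Unnormalised posterior mass of a set \<open>B\<close> of pairs \<open>(\<theta>, \<sigma>\<^sup>2)\<close>. Since \<open>T_embed p k v\<close> only takes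
  values in the span of \<open>v 1, \<dots>, v k\<close>, the preimages of \<open>B\<close> and of its intersection with that span
  coincide.\<close>

definition post_mass ::
  "nat \<Rightarrow> nat \<Rightarrow> ereal \<Rightarrow> nat \<Rightarrow> nat \<Rightarrow> (nat \<Rightarrow> real) \<Rightarrow> real \<Rightarrow> real \<Rightarrow> rvec \<Rightarrow> (nat \<Rightarrow> rvec) \<Rightarrow>
   dataset \<Rightarrow> (rvec \<times> real) set \<Rightarrow> ennreal" where
  "post_mass n p R L U f eta xi la v d B =
     (\<Sum>k=L..U. \<integral>\<^sup>+b. (\<integral>\<^sup>+s2\<in>{0<..}.
          ennreal (beta_prior k la R b * k_prior L U f k * inv_gauss_density eta xi s2 *
                   likelihood2 n p d (T_embed p k v b) s2) *
          indicator B (T_embed p k v b, s2) \<partial>lborel) \<partial>(Pi\<^sub>M {1..k} (\<lambda>_. lborel)))"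

definition posterior ::
  "nat \<Rightarrow> nat \<Rightarrow> ereal \<Rightarrow> nat \<Rightarrow> nat \<Rightarrow> (nat \<Rightarrow> real) \<Rightarrow> real \<Rightarrow> real \<Rightarrow> rvec \<Rightarrow> (nat \<Rightarrow> rvec) \<Rightarrow>
   dataset \<Rightarrow> (rvec \<times> real) set \<Rightarrow> real" where
  "posterior n p R L U f eta xi la v d B =
     enn2real (post_mass n p R L U f eta xi la v d B / post_mass n p R L U f eta xi la v d UNIV)"

definition tail1 :: "nat \<Rightarrow> rvec \<Rightarrow> nat \<Rightarrow> real" where
  "tail1 p lam k = (\<Sum>i=k+1..p. lam i)"

definition tail2 :: "nat \<Rightarrow> rvec \<Rightarrow> nat \<Rightarrow> real" where
  "tail2 p lam k = (\<Sum>i=k+1..p. (lam i)\<^sup>2)"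

definition eff_rank_r :: "nat \<Rightarrow> rvec \<Rightarrow> nat \<Rightarrow> real" where
  "eff_rank_r p lam k = tail1 p lam k / lam (k + 1)"

definition eff_rank_R :: "nat \<Rightarrow> rvec \<Rightarrow> nat \<Rightarrow> real" where
  "eff_rank_R p lam k = (tail1 p lam k)\<^sup>2 / tail2 p lam k"

definition eff_index :: "nat \<Rightarrow> nat \<Rightarrow> nat \<Rightarrow> nat \<Rightarrow> rvec \<Rightarrow> nat set" where
  "eff_index n p L U lam =
     {i\<in>{1..U}. real n * sqrt (lam i * tail2 p lam L) > tail1 p lam L powr (3/2)}"

definition eff_variance :: "nat \<Rightarrow> nat \<Rightarrow> nat \<Rightarrow> nat \<Rightarrow> rvec \<Rightarrow> real \<Rightarrow> real" where
  "eff_variance n p L U lam eps =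
     (\<Sum>i\<in>eff_index n p L U lam.
        1 / real n * ln (real n * sqrt (lam i) * sqrt (tail2 p lam L) / tail1 p lam L powr (3/2)))
     + (real U + ln (real n / (2 * eps))) / real n
     + real n * tail2 p lam L / (tail1 p lam L)\<^sup>2"

definition eff_bias :: "nat \<Rightarrow> nat \<Rightarrow> nat \<Rightarrow> nat \<Rightarrow> (nat \<Rightarrow> real) \<Rightarrow> rvec \<Rightarrow> rvec \<Rightarrow> real" where
  "eff_bias n p L U f lam theta =
     1 / real n * ln (1 / k_prior L U f L)
     + (L2_set theta {1..p})\<^sup>2 / real n * (\<Sum>i=1..L. 1 / lam i)
     + real L * ln (real n) / real n"

end

theory Submission
  imports Defs
begin

text \<open>
  Every parameter charged by the prior lies in the span of the first \<open>U \<le> n \<epsilon>\<^sup>2\<close> sample eigenvectors, so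
  given the first half of the data the prior lives in a single linear model of dimension
  \<open>O(n \<epsilon>\<^sup>2)\<close>. Given also the covariates of the second half, the noise enters the likelihood only through
  its projection onto this model and through its norm, both of which are controlled by Gaussian
  exponential moments. For typical noise all likelihood ratios are then bounded deterministically: an
  empirical prediction error or an error of \<open>\<sigma>\<^sup>2\<close> beyond \<open>C \<epsilon>\<close> costs a factor \<open>exp (- c n \<epsilon>\<^sup>2)\<close> with \<open>c\<close>
  large, while the normalising constant loses only \<open>exp (- D n \<epsilon>\<^sup>2)\<close>, as one sees by restricting it to
  \<open>k = L\<close>, to coefficients within \<open>\<surd>\<lambda>\<^sub>i / n\<close> of those of the true parameter (with \<open>\<lambda>\<^sub>i\<close> the sample eigenvalues)
  and to variances within \<open>\<epsilon>\<close> of the true one.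

  The rate conditions force \<open>n \<lambda>\<^sup>2 \<le> 1\<close> for the population eigenvalue \<open>\<lambda>\<close> of index \<open>L + 1\<close>, and this makes
  empirical and population norms comparable. Both half-sample covariances are within \<open>\<lambda>/8\<close> of the
  population covariance (for the second half because the halves are exchangeable), so the norms are
  equivalent on the leading \<open>L\<close> sample eigenvectors. On the remaining ones the Gaussian factor of the
  prior confines the coefficients to \<open>\<Sum> \<beta>\<^sub>i\<^sup>2 / \<lambda>\<^sub>i \<le> C n \<epsilon>\<^sup>2\<close>, up to negligible posterior mass, so that they
  contribute at most \<open>O(\<lambda>\<^sup>2 n \<epsilon>\<^sup>2) = O(\<epsilon>\<^sup>2)\<close>.
\<close>

text \<open>Of the covariates only second moments and the operator-norm accuracy of a centred sample
  covariance are available, while the noise is exactly Gaussian given them. The supremum over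
  candidates is therefore taken by a Cauchy-Schwarz inequality on the span of U + 1 fixed vectors,
  the images of the sample eigenvectors and of the true parameter; the mean of the covariates, which
  separates centred from uncentred forms, is controlled by Markov's inequality.

  The unknown variance is the second obstacle, since a small candidate variance amplifies the noise.
  The log-likelihood is expanded around the empirical noise variance instead of the true one; the
  loss from a wrong variance is then an exact multiple of \<open>rate_fn\<close>, which dominates
  the amplified noise.

  Constants are fixed in one order. The cost D of the normalising constant involves only the noise
  level and the eigenvalue bound K; the thresholds for the variance, the prediction error and the
  prior form are then chosen to gain D + 1, so that a factor exp (- n eps^2) survives.\<close>

declare One_nat_def [simp del]

section \<open>Linear algebra in coordinates\<close>

text \<open>Gaussian elimination: a pivot \<open>i0\<close> of one equation is removed from the
  others, and its value is read off at the end. This dimension count is behind both the completeness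
  of an orthonormal family of p vectors and the intersection of subspaces in Weyl's
  inequality.\<close>

lemma homogeneous_system_nontrivial:
  fixes A :: "'b \<Rightarrow> 'a \<Rightarrow> real"
  assumes "finite K" "finite I" "card K < card I"
  shows "\<exists>c. (\<exists>i\<in>I. c i \<noteq> 0) \<and> (\<forall>k\<in>K. (\<Sum>i\<in>I. A k i * c i) = 0)"
  using assms
proof (induction K arbitrary: I A rule: finite_induct)
  case empty
  then have "I \<noteq> {}" by auto
  then show ?case by (intro exI[of _ "\<lambda>_. 1"]) auto
next
  case (insert k K)
  show ?case
  proof (cases "\<forall>i\<in>I. A k i = 0")
    case True
    have "card K < card I" using insert by simp
    from insert.IH[OF insert.prems(1) this, of A] True show ?thesis by (auto simp: sum.neutral)
  next
    case False
    then obtain i0 where i0: "i0 \<in> I" "A k i0 \<noteq> 0" by blast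
    define I' where "I' = I - {i0}"
    define A' where "A' = (\<lambda>l i. A l i - A l i0 * A k i / A k i0)"
    have "finite I'" "card K < card I'" using insert i0 by (auto simp: I'_def)
    from insert.IH[OF this, of A'] obtain c where
      c: "\<exists>i\<in>I'. c i \<noteq> 0" "\<forall>l\<in>K. (\<Sum>i\<in>I'. A' l i * c i) = 0" by blast
    define c' where "c' = c(i0 := - (\<Sum>i\<in>I'. A k i * c i) / A k i0)"
    have split: "(\<Sum>i\<in>I. A l i * c' i) = A l i0 * c' i0 + (\<Sum>i\<in>I'. A l i * c i)" for l
    proof -
      have "(\<Sum>i\<in>I. A l i * c' i) = A l i0 * c' i0 + (\<Sum>i\<in>I'. A l i * c' i)"
        unfolding I'_def by (rule sum.remove) (use insert.prems i0 in auto)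
      then show ?thesis by (simp add: c'_def I'_def)
    qed
    have "(\<Sum>i\<in>I. A l i * c' i) = 0" if "l \<in> K" for l
    proof -
      have "(\<Sum>i\<in>I'. A' l i * c i)
          = (\<Sum>i\<in>I'. A l i * c i) - A l i0 / A k i0 * (\<Sum>i\<in>I'. A k i * c i)"
        by (simp add: A'_def sum_subtractf sum_distrib_left algebra_simps)
      then show ?thesis using c(2) that unfolding split by (simp add: c'_def field_simps)
    qed
    moreover have "(\<Sum>i\<in>I. A k i * c' i) = 0"
      unfolding split using i0 by (simp add: c'_def)
    moreover have "\<exists>i\<in>I. c' i \<noteq> 0"
      using c(1) by (auto simp: c'_def I'_def)
    ultimately show ?thesis by blast
  qed
qed

lemma dotp_commute: "dotp p u v = dotp p v u"
  by (simp add: dotp_def mult.commute)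

lemma dotp_sum_left: "dotp p (\<lambda>j. \<Sum>i\<in>I. c i * v i j) u = (\<Sum>i\<in>I. c i * dotp p (v i) u)"
  unfolding dotp_def sum_distrib_right sum_distrib_left
  by (subst sum.swap) (simp add: mult.assoc)

lemma dotp_diff_left: "dotp p (\<lambda>j. a j - b j) u = dotp p a u - dotp p b u"
  by (simp add: dotp_def left_diff_distrib sum_subtractf)

lemma dotp_add_left: "dotp p (\<lambda>j. a j + b j) u = dotp p a u + dotp p b u"
  by (simp add: dotp_def distrib_right sum.distrib)

lemma dotp_diff_right: "dotp p u (\<lambda>j. a j - b j) = dotp p u a - dotp p u b"
  by (simp add: dotp_def right_diff_distrib sum_subtractf)

lemma dotp_add_right: "dotp p u (\<lambda>j. a j + b j) = dotp p u a + dotp p u b"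
  by (simp add: dotp_def distrib_left sum.distrib)

lemma dotp_sum_right: "dotp p u (\<lambda>j. \<Sum>i\<in>I. c i * v i j) = (\<Sum>i\<in>I. c i * dotp p u (v i))"
  by (subst (1 2) dotp_commute) (rule dotp_sum_left)

lemma dotp_cong: "(\<And>j. j \<in> {1..p} \<Longrightarrow> a j = a' j) \<Longrightarrow> (\<And>j. j \<in> {1..p} \<Longrightarrow> b j = b' j)
    \<Longrightarrow> dotp p a b = dotp p a' b'"
  unfolding dotp_def by (rule sum.cong) auto

lemma dotp_self_nonneg: "0 \<le> dotp p u u"
  by (simp add: dotp_def sum_nonneg)

lemma L2_set_square_dotp: "(L2_set u {1..p})\<^sup>2 = dotp p u u"
  by (simp add: L2_set_def dotp_def sum_nonneg power2_eq_square)

lemma dotp_Cauchy_Schwarz: "\<bar>dotp p u v\<bar> \<le> L2_set u {1..p} * L2_set v {1..p}"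
proof -
  have "\<bar>dotp p u v\<bar> \<le> (\<Sum>j=1..p. \<bar>u j\<bar> * \<bar>v j\<bar>)"
    unfolding dotp_def by (rule order_trans[OF sum_abs]) (simp add: abs_mult)
  then show ?thesis using L2_set_mult_ineq order_trans by blast
qed

lemma quad_form_cong:
  "(\<And>j. j \<in> {1..p} \<Longrightarrow> a j = b j) \<Longrightarrow> quad_form p A a = quad_form p A b"
  unfolding quad_form_def matvec_def dotp_def by (intro sum.cong) auto

lemma quad_form_diff_matrix:
  "quad_form p (\<lambda>a b. A a b - B a b) u = quad_form p A u - quad_form p B u"
  unfolding quad_form_def matvec_def dotp_def
  by (simp add: left_diff_distrib right_diff_distrib sum_subtractf)

text \<open>The residual \<open>r\<close> is orthogonal to every v i. With it there are p + 1
  vectors in dimension p, hence a nontrivial relation; pairing the relation with v k kills the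
  coefficient of v k, and a nonzero residual then kills its own.\<close>

lemma orthonormal_expansion:
  assumes on: "\<And>i j. i \<in> {1..p} \<Longrightarrow> j \<in> {1..p} \<Longrightarrow> dotp p (v i) (v j) = (if i = j then 1 else 0)"
    and l: "l \<in> {1..p}"
  shows "u l = (\<Sum>i=1..p. dotp p u (v i) * v i l)"
proof (rule ccontr)
  define r where "r = (\<lambda>l. u l - (\<Sum>i=1..p. dotp p u (v i) * v i l))"
  assume "u l \<noteq> (\<Sum>i=1..p. dotp p u (v i) * v i l)"
  then have rl: "r l \<noteq> 0" by (simp add: r_def)
  have orth: "dotp p r (v i) = 0" if "i \<in> {1..p}" for i
  proof -
    have "dotp p r (v i) = dotp p u (v i) - (\<Sum>k=1..p. dotp p u (v k) * dotp p (v k) (v i))"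
      unfolding r_def dotp_diff_left dotp_sum_left ..
    also have "(\<Sum>k=1..p. dotp p u (v k) * dotp p (v k) (v i))
        = (\<Sum>k=1..p. if k = i then dotp p u (v k) else 0)"
      using that by (intro sum.cong) (auto simp: on)
    finally show ?thesis using that by simp
  qed
  define V where "V = (\<lambda>i. if i = 0 then r else v i)"
  obtain c where c: "\<exists>i\<in>{0..p}. c i \<noteq> 0" "\<And>j. j \<in> {1..p} \<Longrightarrow> (\<Sum>i=0..p. V i j * c i) = 0"
    using homogeneous_system_nontrivial[of "{1..p}" "{0..p}" "\<lambda>j i. V i j", simplified
        card_atLeastAtMost]
    by fastforce
  have comb: "c 0 * r j + (\<Sum>i=1..p. c i * v i j) = 0" if "j \<in> {1..p}" for j
  proof -
    have "(\<Sum>i=0..p. V i j * c i) = V 0 j * c 0 + (\<Sum>i=1..p. V i j * c i)"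
      by (simp add: sum.atLeast_Suc_atMost One_nat_def)
    also have "(\<Sum>i=1..p. V i j * c i) = (\<Sum>i=1..p. c i * v i j)"
      by (intro sum.cong) (auto simp: V_def)
    finally show ?thesis using c(2)[OF that] by (simp add: V_def mult.commute[of "r j"])
  qed
  have c0: "c k = 0" if k: "k \<in> {1..p}" for k
  proof -
    have "dotp p (\<lambda>j. c 0 * r j + (\<Sum>i=1..p. c i * v i j)) (v k) = 0"
      unfolding dotp_def using comb by (intro sum.neutral) auto
    moreover have "dotp p (\<lambda>j. c 0 * r j) (v k) = c 0 * dotp p r (v k)"
      by (simp add: dotp_def sum_distrib_left mult.assoc)
    moreover have "(\<Sum>i=1..p. c i * dotp p (v i) (v k)) = (\<Sum>i=1..p. if i = k then c i else 0)"
      using k by (intro sum.cong) (auto simp: on)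
    ultimately show ?thesis using k orth[OF k] by (simp add: dotp_add_left dotp_sum_left)
  qed
  with comb[OF l] rl have "c 0 = 0" by simp
  with c0 have "c i = 0" if "i \<in> {0..p}" for i using that by (cases "i = 0") auto
  with c(1) show False by blast
qed

lemma orthonormal_Parseval:
  assumes on: "\<And>i j. i \<in> {1..p} \<Longrightarrow> j \<in> {1..p} \<Longrightarrow> dotp p (v i) (v j) = (if i = j then 1 else 0)"
  shows "dotp p u x = (\<Sum>i=1..p. dotp p u (v i) * dotp p x (v i))"
proof -
  have "dotp p u x = dotp p (\<lambda>l. \<Sum>i=1..p. dotp p u (v i) * v i l) x"
    by (rule dotp_cong) (use orthonormal_expansion[OF on] in auto)
  then show ?thesis by (simp add: dotp_sum_left dotp_commute[of p x])
qed

lemma eigensystem_orthonormal: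
  "eigensystem p A lam v \<Longrightarrow> i \<in> {1..p} \<Longrightarrow> j \<in> {1..p} \<Longrightarrow>
    dotp p (v i) (v j) = (if i = j then 1 else 0)"
  by (simp add: eigensystem_def)

lemma eigensystem_mono:
  "eigensystem p A lam v \<Longrightarrow> i \<in> {1..p} \<Longrightarrow> j \<in> {1..p} \<Longrightarrow> i \<le> j \<Longrightarrow> lam j \<le> lam i"
  unfolding eigensystem_def by (auto simp: monotone_on_def)

lemma eigensystem_quad_form:
  assumes es: "eigensystem p A lam v"
  shows "quad_form p A u = (\<Sum>i=1..p. lam i * (dotp p u (v i))\<^sup>2)"
proof -
  note on = eigensystem_orthonormal[OF es]
  have "matvec p A u l = (\<Sum>i=1..p. dotp p u (v i) * lam i * v i l)" if l: "l \<in> {1..p}" for l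
  proof -
    have "matvec p A u l = (\<Sum>j=1..p. A l j * (\<Sum>i=1..p. dotp p u (v i) * v i j))"
      unfolding matvec_def by (intro sum.cong refl) (use orthonormal_expansion[OF on] in auto)
    also have "\<dots> = (\<Sum>i=1..p. dotp p u (v i) * matvec p A (v i) l)"
      unfolding matvec_def sum_distrib_left by (subst sum.swap) (simp add: ac_simps)
    also have "\<dots> = (\<Sum>i=1..p. dotp p u (v i) * lam i * v i l)"
      using es l by (intro sum.cong) (auto simp: eigensystem_def)
    finally show ?thesis .
  qed
  then have "quad_form p A u = dotp p u (\<lambda>l. \<Sum>i=1..p. (dotp p u (v i) * lam i) * v i l)"
    unfolding quad_form_def by (intro dotp_cong) auto
  then show ?thesis unfolding dotp_sum_right by (simp add: power2_eq_square ac_simps)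
qed

lemma eigensystem_eigenvalue:
  assumes es: "eigensystem p A lam v" and i: "i \<in> {1..p}"
  shows "lam i = quad_form p A (v i)"
proof -
  have "quad_form p A (v i) = (\<Sum>k=1..p. if k = i then lam k else 0)"
    unfolding eigensystem_quad_form[OF es]
    by (intro sum.cong) (use i in \<open>auto simp: eigensystem_orthonormal[OF es]\<close>)
  with i show ?thesis by simp
qed

text \<open>The dimension count of Courant and Fischer: some nonzero u in the span of v 1, ..., v i
  is orthogonal to w 1, ..., w (i - 1). Its Rayleigh quotient is at least a i for A and at most b i
  for B. The comparison of forms is one-sided, so the two-sided eigenvalue bound takes two
  applications.\<close>

lemma Weyl_inequality:
  assumes A: "eigensystem p A a v" and B: "eigensystem p B b w"
    and le: "\<And>u. quad_form p A u \<le> quad_form p B u + \<delta> * dotp p u u"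
    and i: "i \<in> {1..p}"
  shows "a i \<le> b i + \<delta>"
proof -
  note onA = eigensystem_orthonormal[OF A]
  note onB = eigensystem_orthonormal[OF B]
  obtain c where c: "\<exists>k\<in>{1..i}. c k \<noteq> 0"
    "\<And>j. j \<in> {1..<i} \<Longrightarrow> (\<Sum>k=1..i. dotp p (v k) (w j) * c k) = 0"
    using homogeneous_system_nontrivial[of "{1..<i}" "{1..i}" "\<lambda>j k. dotp p (v k) (w j)"] i
    by fastforce
  define u where "u = (\<lambda>l. \<Sum>k=1..i. c k * v k l)"
  have uv: "dotp p u (v l) = (if l \<le> i then c l else 0)" if "l \<in> {1..p}" for l
  proof -
    have "dotp p u (v l) = (\<Sum>k=1..i. if k = l then c k else 0)"
      unfolding u_def dotp_sum_left by (intro sum.cong) (use that i in \<open>auto simp: onA\<close>)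
    then show ?thesis using that by simp
  qed
  have uw: "dotp p u (w j) = 0" if "j \<in> {1..<i}" for j
    using c(2)[OF that] unfolding u_def dotp_sum_left by (simp add: mult.commute)
  have pos: "0 < dotp p u u"
  proof -
    obtain k where k: "k \<in> {1..i}" "c k \<noteq> 0" using c(1) by blast
    have "(dotp p u (v k))\<^sup>2 \<le> (\<Sum>l=1..p. (dotp p u (v l))\<^sup>2)"
      by (rule member_le_sum) (use k i in auto)
    moreover have "0 < (dotp p u (v k))\<^sup>2" using k i uv[of k] by auto
    ultimately show ?thesis
      using orthonormal_Parseval[of p v u u] onA by (simp add: power2_eq_square)
  qed
  have PA: "dotp p u u = (\<Sum>i=1..p. dotp p u (v i) * dotp p u (v i))"
    by (rule orthonormal_Parseval) (rule onA)
  have PB: "dotp p u u = (\<Sum>i=1..p. dotp p u (w i) * dotp p u (w i))"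
    by (rule orthonormal_Parseval) (rule onB)
  have "a i * dotp p u u \<le> quad_form p A u"
    unfolding eigensystem_quad_form[OF A] PA sum_distrib_left
    using eigensystem_mono[OF A] i uv
    by (intro sum_mono) (auto simp: power2_eq_square intro!: mult_right_mono)
  also have "\<dots> \<le> quad_form p B u + \<delta> * dotp p u u" by (rule le)
  also have "quad_form p B u \<le> b i * dotp p u u"
    unfolding eigensystem_quad_form[OF B] PB sum_distrib_left
  proof (rule sum_mono)
    fix j assume j: "j \<in> {1..p}"
    show "b j * (dotp p u (w j))\<^sup>2 \<le> b i * (dotp p u (w j) * dotp p u (w j))"
      using uw[of j] j eigensystem_mono[OF B i j]
      by (cases "j < i") (auto simp: power2_eq_square intro!: mult_right_mono)
  qed
  finally have "a i * dotp p u u \<le> (b i + \<delta>) * dotp p u u" by (simp add: algebra_simps)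
  with pos show ?thesis by simp
qed

text \<open>A real supremum bounds its members only once the set is known to be bounded; the sum of
  the absolute values of all entries is a crude bound.\<close>

lemma L2_set_matvec_le_op_norm:
  assumes "L2_set u {1..p} \<le> 1"
  shows "L2_set (matvec p A u) {1..p} \<le> op_norm p A"
  unfolding op_norm_def
proof (rule cSUP_upper)
  show "u \<in> {u. L2_set u {1..p} \<le> 1}" using assms by simp
  show "bdd_above ((\<lambda>u. L2_set (matvec p A u) {1..p}) ` {u. L2_set u {1..p} \<le> 1})"
  proof (rule bdd_aboveI2)
    fix u assume "u \<in> {u. L2_set u {1..p} \<le> 1}"
    then have u: "\<bar>u j\<bar> \<le> 1" if "j \<in> {1..p}" for j
      using member_le_L2_set[of "{1..p}" j "\<lambda>j. \<bar>u j\<bar>"] that by (simp add: L2_set_def del: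
          real_sqrt_le_1_iff)
    have "L2_set (matvec p A u) {1..p} \<le> (\<Sum>i=1..p. \<bar>matvec p A u i\<bar>)"
      by (rule L2_set_le_sum_abs)
    also have "\<dots> \<le> (\<Sum>i=1..p. \<Sum>j=1..p. \<bar>A i j\<bar>)"
    proof (rule sum_mono)
      fix i
      have "\<bar>matvec p A u i\<bar> \<le> (\<Sum>j=1..p. \<bar>A i j * u j\<bar>)" unfolding matvec_def by (rule sum_abs)
      also have "\<dots> \<le> (\<Sum>j=1..p. \<bar>A i j\<bar>)"
        using u by (intro sum_mono) (auto simp: abs_mult mult_left_le)
      finally show "\<bar>matvec p A u i\<bar> \<le> (\<Sum>j=1..p. \<bar>A i j\<bar>)" .
    qed
    finally show "L2_set (matvec p A u) {1..p} \<le> (\<Sum>i=1..p. \<Sum>j=1..p. \<bar>A i j\<bar>)" .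
  qed
qed

lemma abs_quad_form_le_op_norm: "\<bar>quad_form p A u\<bar> \<le> op_norm p A * dotp p u u"
proof (cases "L2_set u {1..p} = 0")
  case True
  then have "u j = 0" if "j \<in> {1..p}" for j using that by (simp add: L2_set_eq_0_iff)
  then show ?thesis by (simp add: quad_form_def dotp_def)
next
  case False
  define r where "r = L2_set u {1..p}"
  have r: "r > 0" using False L2_set_nonneg[of u "{1..p}"] by (simp add: r_def order_less_le)
  define x where "x = (\<lambda>j. (1 / r) * u j)"
  have "L2_set x {1..p} = 1 / r * r"
    unfolding x_def by (subst L2_set_right_distrib[symmetric]) (use r in \<open>auto simp: r_def\<close>)
  then have x1: "L2_set x {1..p} = 1" using r by simp
  have "\<bar>quad_form p A x\<bar> \<le> L2_set x {1..p} * L2_set (matvec p A x) {1..p}"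
    unfolding quad_form_def by (rule dotp_Cauchy_Schwarz)
  also have "\<dots> \<le> op_norm p A" using L2_set_matvec_le_op_norm[of x p A] x1 by simp
  finally have "\<bar>quad_form p A x\<bar> \<le> op_norm p A" .
  moreover have "quad_form p A x = quad_form p A u / r\<^sup>2"
    unfolding quad_form_def matvec_def dotp_def x_def
    by (simp add: sum_divide_distrib sum_distrib_left power2_eq_square ac_simps)
  moreover have "dotp p u u = r\<^sup>2" by (simp add: r_def L2_set_square_dotp)
  ultimately show ?thesis using r by (simp add: field_simps)
qed

lemma quad_form_diag: "quad_form k (diag_matrix a) b = (\<Sum>i=1..k. a i * (b i)\<^sup>2)"
proof -
  have "matvec k (diag_matrix a) b i = a i * b i" if "i \<in> {1..k}" for i
  proof -
    have "matvec k (diag_matrix a) b i = (\<Sum>j=1..k. if j = i then a j * b j else 0)"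
      unfolding matvec_def diag_matrix_def by (intro sum.cong) auto
    with that show ?thesis by simp
  qed
  then show ?thesis
    unfolding quad_form_def dotp_def by (intro sum.cong) (auto simp: power2_eq_square)
qed

text \<open>Linearly dependent vectors are allowed: one whose residual norm \<open>s\<close>
  vanishes adds no new direction, so r may be smaller than d. The bound r \<le> d is what later
  limits the number of directions in which the noise can be fitted.\<close>

lemma Gram_Schmidt:
  fixes g :: "nat \<Rightarrow> 'a \<Rightarrow> real"
  assumes "finite D"
  shows "\<exists>r u c. r \<le> d \<and>
    (\<forall>k<r. \<forall>l<r. (\<Sum>i\<in>D. u k i * u l i) = (if k = l then 1 else (0::real))) \<and>
    (\<forall>j<d. \<forall>i\<in>D. g j i = (\<Sum>k<r. c j k * u k i))"
proof (induction d)
  case 0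
  show ?case by (rule exI[of _ 0]) auto
next
  case (Suc d)
  then obtain r u c where IH: "r \<le> d"
    "\<And>k l. k < r \<Longrightarrow> l < r \<Longrightarrow> (\<Sum>i\<in>D. u k i * u l i) = (if k = l then 1 else (0::real))"
    "\<And>j i. j < d \<Longrightarrow> i \<in> D \<Longrightarrow> g j i = (\<Sum>k<r. c j k * u k i)" by blast
  define a where "a = (\<lambda>k. \<Sum>i\<in>D. g d i * u k i)"
  define x where "x = (\<lambda>i. g d i - (\<Sum>k<r. a k * u k i))"
  define s where "s = sqrt (\<Sum>i\<in>D. (x i)\<^sup>2)"
  have xu: "(\<Sum>i\<in>D. x i * u l i) = 0" if "l < r" for l
  proof -
    have "(\<Sum>i\<in>D. x i * u l i) = a l - (\<Sum>i\<in>D. \<Sum>k<r. a k * (u k i * u l i))"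
      by (simp add: x_def a_def left_diff_distrib sum_subtractf sum_distrib_right mult.assoc)
    also have "(\<Sum>i\<in>D. \<Sum>k<r. a k * (u k i * u l i)) = (\<Sum>k<r. a k * (\<Sum>i\<in>D. u k i * u l i))"
      unfolding sum_distrib_left by (rule sum.swap)
    also have "\<dots> = (\<Sum>k<r. if k = l then a k else 0)"
      using that by (intro sum.cong) (auto simp: IH(2))
    finally show ?thesis using that by simp
  qed
  show ?case
  proof (cases "s = 0")
    case True
    then have "x i = 0" if "i \<in> D" for i
      using that assms by (simp add: s_def sum_nonneg_eq_0_iff sum_nonneg)
    then have gd: "g d i = (\<Sum>k<r. a k * u k i)" if "i \<in> D" for i
      using that by (simp add: x_def)
    have "\<forall>j<Suc d. \<forall>i\<in>D. g j i = (\<Sum>k<r. (c(d := a)) j k * u k i)"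
      using IH(3) gd by (auto simp: less_Suc_eq)
    with IH(1,2) show ?thesis
      by (intro exI[of _ r] exI[of _ u] exI[of _ "c(d := a)"]) auto
  next
    case False
    have s: "s > 0" using False by (simp add: s_def sum_nonneg order_less_le)
    have s2: "(\<Sum>i\<in>D. x i * x i) = s * s"
      by (simp add: s_def sum_nonneg power2_eq_square)
    define u' where "u' = u(r := (\<lambda>i. x i / s))"
    define c' where "c' = (\<lambda>j. if j = d then a(r := s) else (c j)(r := 0))"
    have un: "(\<Sum>i\<in>D. u' k i * u' l i) = (if k = l then 1 else 0)"
      if "k < Suc r" "l < Suc r" for k l
    proof -
      have xu': "(\<Sum>i\<in>D. x i * u l i / s) = 0" "(\<Sum>i\<in>D. u l i * x i / s) = 0" if "l < r" for l
        using xu[OF that] by (simp_all add: sum_divide_distrib[symmetric] mult.commute)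
      have "(\<Sum>i\<in>D. x i / s * (x i / s)) = (\<Sum>i\<in>D. x i * x i) / (s * s)"
        by (simp add: sum_divide_distrib)
      then have xx: "(\<Sum>i\<in>D. x i * x i / (s * s)) = 1" using s s2 by simp
      show ?thesis using that IH(2)[of k l] xx
        by (auto simp: u'_def less_Suc_eq xu')
    qed
    have "g j i = (\<Sum>k<Suc r. c' j k * u' k i)" if "j < Suc d" "i \<in> D" for i j
    proof -
      have "(\<Sum>k<Suc r. c' j k * u' k i) = (\<Sum>k<r. c' j k * u k i) + c' j r * (x i / s)"
        by (simp add: u'_def)
      also have "\<dots> = g j i"
        using that IH(3) s by (auto simp: c'_def x_def less_Suc_eq)
      finally show ?thesis ..
    qed
    with IH(1) un show ?thesis
      by (intro exI[of _ "Suc r"] exI[of _ u'] exI[of _ c']) auto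
  qed
qed

section \<open>Gaussian integrals and product measures\<close>

abbreviation normal_law :: "real \<Rightarrow> real measure" where
  "normal_law s \<equiv> density lborel (\<lambda>e. ennreal (normal_density 0 s e))"

lemma prob_space_normal_law: "0 < s \<Longrightarrow> prob_space (normal_law s)"
  by (rule prob_space_normal_density)

lemma product_sigma_finite_prob: "prob_space M \<Longrightarrow> product_sigma_finite (\<lambda>_. M)"
  by (simp add: product_sigma_finite_def prob_space_imp_sigma_finite)

lemma product_sigma_finite_lborel: "product_sigma_finite (\<lambda>_. lborel :: real measure)"
  by (simp add: product_sigma_finite_def sigma_finite_lborel)

lemma sigma_finite_PiM_lborel: "finite I \<Longrightarrow> sigma_finite_measure (Pi\<^sub>M I (\<lambda>_. lborel :: real measure))"
  by (rule product_sigma_finite.sigma_finite[OF product_sigma_finite_lborel])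

lemma nn_integral_normal_density:
  assumes "0 < s"
  shows "(\<integral>\<^sup>+x. ennreal (normal_density \<mu> s x) \<partial>lborel) = 1"
  using prob_space.emeasure_space_1[OF prob_space_normal_density[OF assms, of \<mu>]]
  by (simp add: emeasure_density)

text \<open>Tilting a centred normal density by exp (t x^2) gives 1 / q times the normal density of
  standard deviation s / q.\<close>

lemma nn_integral_exp_square_normal:
  assumes s: "0 < s" and t: "2 * t * s\<^sup>2 < 1"
  shows "(\<integral>\<^sup>+x. ennreal (exp (t * x\<^sup>2)) \<partial>normal_law s) = ennreal (1 / sqrt (1 - 2 * t * s\<^sup>2))"
proof -
  define q where "q = sqrt (1 - 2 * t * s\<^sup>2)"
  have q: "0 < q" "q\<^sup>2 = 1 - 2 * t * s\<^sup>2" using t by (auto simp: q_def)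
  have eq: "normal_density 0 s x * exp (t * x\<^sup>2) = (1 / q) * normal_density 0 (s / q) x" for x
  proof -
    have "- (x\<^sup>2 / (2 * s\<^sup>2)) + t * x\<^sup>2 = - (x\<^sup>2 * q\<^sup>2 / (2 * s\<^sup>2))"
      unfolding q(2) using s by (simp add: field_simps)
    then have "exp (- (x\<^sup>2 / (2 * s\<^sup>2))) * exp (t * x\<^sup>2) = exp (- (x\<^sup>2 * q\<^sup>2 / (2 * s\<^sup>2)))"
      by (simp flip: exp_add)
    moreover have "sqrt (2 * pi * (s / q)\<^sup>2) = sqrt (2 * pi * s\<^sup>2) / q"
      using q(1) by (simp add: power_divide real_sqrt_divide)
    ultimately show ?thesis
      using q(1) by (simp add: normal_density_def power_divide)
  qed
  have "(\<integral>\<^sup>+x. ennreal (exp (t * x\<^sup>2)) \<partial>normal_law s)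
      = (\<integral>\<^sup>+x. ennreal (1 / q) * ennreal (normal_density 0 (s / q) x) \<partial>lborel)"
    using q(1) by (simp add: nn_integral_density eq flip: ennreal_mult')
  also have "\<dots> = ennreal (1 / q)"
    using q(1) s by (simp add: nn_integral_cmult nn_integral_normal_density)
  finally show ?thesis by (simp add: q_def)
qed

lemma nn_integral_exp_linear_normal:
  assumes s: "0 < s"
  shows "(\<integral>\<^sup>+x. ennreal (exp (c * x)) \<partial>normal_law s) = ennreal (exp (c\<^sup>2 * s\<^sup>2 / 2))"
proof -
  have eq: "normal_density 0 s x * exp (c * x)
      = exp (c\<^sup>2 * s\<^sup>2 / 2) * normal_density (c * s\<^sup>2) s x" for x
  proof -
    have "- (x\<^sup>2 / (2 * s\<^sup>2)) + c * x = c\<^sup>2 * s\<^sup>2 / 2 - (x - c * s\<^sup>2)\<^sup>2 / (2 * s\<^sup>2)"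
      using s by (simp add: field_simps power2_eq_square)
    then have "exp (- (x\<^sup>2 / (2 * s\<^sup>2))) * exp (c * x)
        = exp (c\<^sup>2 * s\<^sup>2 / 2) * exp (- ((x - c * s\<^sup>2)\<^sup>2 / (2 * s\<^sup>2)))"
      by (simp flip: exp_add)
    then show ?thesis by (simp add: normal_density_def)
  qed
  have "(\<integral>\<^sup>+x. ennreal (exp (c * x)) \<partial>normal_law s)
      = (\<integral>\<^sup>+x. ennreal (exp (c\<^sup>2 * s\<^sup>2 / 2)) * ennreal (normal_density (c * s\<^sup>2) s x) \<partial>lborel)"
    by (simp add: nn_integral_density eq flip: ennreal_mult')
  also have "\<dots> = ennreal (exp (c\<^sup>2 * s\<^sup>2 / 2))"
    using s by (simp add: nn_integral_cmult nn_integral_normal_density)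
  finally show ?thesis .
qed

lemma nn_integral_exp_neg_square:
  assumes a: "0 < a"
  shows "(\<integral>\<^sup>+x. ennreal (exp (- (x\<^sup>2 / a))) \<partial>lborel) = ennreal (sqrt (pi * a))"
proof -
  have eq: "exp (- (x\<^sup>2 / a)) = sqrt (pi * a) * normal_density 0 (sqrt (a / 2)) x" for x
    using a by (simp add: normal_density_def)
  have "(\<integral>\<^sup>+x. ennreal (exp (- (x\<^sup>2 / a))) \<partial>lborel)
      = (\<integral>\<^sup>+x. ennreal (sqrt (pi * a)) * ennreal (normal_density 0 (sqrt (a / 2)) x) \<partial>lborel)"
    unfolding eq using a by (subst ennreal_mult') auto
  also have "\<dots> = ennreal (sqrt (pi * a))"
    using a by (simp add: nn_integral_cmult nn_integral_normal_density)
  finally show ?thesis .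
qed

lemma exp_sum_ennreal: "finite I \<Longrightarrow> ennreal (exp (\<Sum>i\<in>I. f i)) = (\<Prod>i\<in>I. ennreal (exp (f i)))"
  by (simp add: exp_sum prod_ennreal)

lemma nn_integral_exp_projection:
  fixes u :: "nat \<Rightarrow> 'a \<Rightarrow> real"
  assumes s: "0 < s" and I: "finite I"
    and on: "\<And>k l. k < r \<Longrightarrow> l < r \<Longrightarrow> (\<Sum>i\<in>I. u k i * u l i) = (if k = l then 1 else 0)"
  shows "(\<integral>\<^sup>+e. ennreal (exp ((\<Sum>k<r. (\<Sum>i\<in>I. e i * u k i)\<^sup>2) / (4 * s\<^sup>2))) \<partial>Pi\<^sub>M I (\<lambda>_. normal_law s))
    = ennreal (sqrt 2 ^ r)"
proof -
  \<comment> \<open>Write \<open>exp (c\<^sup>2/(4s\<^sup>2))\<close> as a standard normal mixture of \<open>exp (gc/(\<surd>2 s))\<close> and exchange the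
      integrals.\<close>
  let ?E = "Pi\<^sub>M I (\<lambda>_. normal_law s)" and ?G = "Pi\<^sub>M {..<r} (\<lambda>_. normal_law 1)"
  interpret E: product_sigma_finite "\<lambda>_ :: 'a. normal_law s"
    by (rule product_sigma_finite_prob[OF prob_space_normal_law[OF s]])
  interpret G: product_sigma_finite "\<lambda>_ :: nat. normal_law 1"
    by (rule product_sigma_finite_prob[OF prob_space_normal_law]) simp
  interpret EG: pair_sigma_finite ?G ?E
    using E.sigma_finite[OF I] G.sigma_finite[of "{..<r}"] by (simp add: pair_sigma_finite_def)
  define w where "w = sqrt 2 * s"
  have w: "w > 0" "w\<^sup>2 = 2 * s\<^sup>2" using s by (auto simp: w_def power_mult_distrib)
  define c where "c = (\<lambda>e k. \<Sum>i\<in>I. e i * u k i)"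
  have mix: "ennreal (exp ((\<Sum>k<r. (c e k)\<^sup>2) / (4 * s\<^sup>2)))
      = (\<integral>\<^sup>+g. ennreal (exp (\<Sum>k<r. c e k / w * g k)) \<partial>?G)" for e
  proof -
    have "(\<integral>\<^sup>+g. ennreal (exp (\<Sum>k<r. c e k / w * g k)) \<partial>?G)
        = (\<Prod>k<r. \<integral>\<^sup>+x. ennreal (exp (c e k / w * x)) \<partial>normal_law 1)"
      unfolding exp_sum_ennreal[OF finite_lessThan] by (rule G.product_nn_integral_prod) auto
    also have "\<dots> = (\<Prod>k<r. ennreal (exp ((c e k)\<^sup>2 / (4 * s\<^sup>2))))"
      by (subst nn_integral_exp_linear_normal) (auto simp: power_divide w(2))
    also have "\<dots> = ennreal (exp ((\<Sum>k<r. (c e k)\<^sup>2) / (4 * s\<^sup>2)))"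
      by (simp add: exp_sum_ennreal sum_divide_distrib)
    finally show ?thesis ..
  qed
  have inner: "(\<integral>\<^sup>+e. ennreal (exp (\<Sum>k<r. c e k / w * g k)) \<partial>?E)
      = (\<Prod>k<r. ennreal (exp (1 / 4 * (g k)\<^sup>2)))" for g
  proof -
    define a where "a = (\<lambda>i. \<Sum>k<r. g k * u k i)"
    have "(\<Sum>k<r. c e k / w * g k) = (\<Sum>i\<in>I. a i / w * e i)" for e
      unfolding c_def a_def sum_divide_distrib sum_distrib_right
      by (subst sum.swap) (simp add: ac_simps)
    then have "(\<integral>\<^sup>+e. ennreal (exp (\<Sum>k<r. c e k / w * g k)) \<partial>?E)
        = (\<Prod>i\<in>I. \<integral>\<^sup>+x. ennreal (exp (a i / w * x)) \<partial>normal_law s)"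
      by (simp only: exp_sum_ennreal[OF I]) (rule E.product_nn_integral_prod[OF I], auto)
    also have "\<dots> = (\<Prod>i\<in>I. ennreal (exp (1 / 4 * (a i)\<^sup>2)))"
      using s by (subst nn_integral_exp_linear_normal) (auto simp: power_divide w(2))
    also have "\<dots> = ennreal (exp (1 / 4 * (\<Sum>i\<in>I. (a i)\<^sup>2)))"
      by (simp add: exp_sum_ennreal I sum_divide_distrib)
    \<comment> \<open>By orthonormality the squared norm of the combination is the sum of the (g
      k)^2, whatever the size of \<open>I\<close>; the final bound thus depends on the rank r
      alone.\<close>
    also have "(\<Sum>i\<in>I. (a i)\<^sup>2) = (\<Sum>i\<in>I. \<Sum>k<r. \<Sum>l<r. g k * g l * (u k i * u l i))"
      by (simp add: a_def power2_eq_square sum_product ac_simps)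
    also have "\<dots> = (\<Sum>k<r. \<Sum>l<r. \<Sum>i\<in>I. g k * g l * (u k i * u l i))"
      by (subst sum.swap) (simp add: sum.swap[of _ I])
    also have "\<dots> = (\<Sum>k<r. \<Sum>l<r. if l = k then g k * g l else 0)"
      unfolding sum_distrib_left[symmetric] by (intro sum.cong refl) (auto simp: on)
    also have "\<dots> = (\<Sum>k<r. (g k)\<^sup>2)"
      by (intro sum.cong refl) (simp add: power2_eq_square)
    finally show ?thesis by (simp add: exp_sum_ennreal sum_divide_distrib)
  qed
  have "(\<integral>\<^sup>+e. ennreal (exp ((\<Sum>k<r. (c e k)\<^sup>2) / (4 * s\<^sup>2))) \<partial>?E)
      = (\<integral>\<^sup>+e. \<integral>\<^sup>+g. ennreal (exp (\<Sum>k<r. c e k / w * g k)) \<partial>?G \<partial>?E)"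
    by (simp add: mix)
  also have "\<dots> = (\<integral>\<^sup>+g. \<integral>\<^sup>+e. ennreal (exp (\<Sum>k<r. c e k / w * g k)) \<partial>?E \<partial>?G)"
    by (rule EG.Fubini') (simp add: c_def split_beta')
  also have "\<dots> = (\<Prod>k<r. \<integral>\<^sup>+x. ennreal (exp (1 / 4 * x\<^sup>2)) \<partial>normal_law 1)"
    unfolding inner by (rule G.product_nn_integral_prod) auto
  also have "\<dots> = ennreal (sqrt 2) ^ r"
    by (subst nn_integral_exp_square_normal) (auto simp: real_sqrt_divide)
  finally show ?thesis by (simp add: c_def ennreal_power)
qed

text \<open>Chernoff bound at the exponent 1 / (4 s^2). Each direction costs a factor sqrt 2,
  rounded up to e so that the rank enters the exponent with coefficient one.\<close>

lemma projection_tail_bound: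
  fixes u :: "nat \<Rightarrow> 'a \<Rightarrow> real"
  assumes s: "0 < s" and I: "finite I"
    and on: "\<And>k l. k < r \<Longrightarrow> l < r \<Longrightarrow> (\<Sum>i\<in>I. u k i * u l i) = (if k = l then 1 else 0)"
  shows "emeasure (Pi\<^sub>M I (\<lambda>_. normal_law s))
      {e \<in> space (Pi\<^sub>M I (\<lambda>_. normal_law s)). 4 * s\<^sup>2 * t < (\<Sum>k<r. (\<Sum>i\<in>I. e i * u k i)\<^sup>2)}
    \<le> ennreal (exp (real r - t))" (is "emeasure ?E ?A \<le> _")
proof -
  have A: "?A \<in> sets ?E" by measurable
  have "emeasure ?E ?A = (\<integral>\<^sup>+e. indicator ?A e \<partial>?E)" using A by simp
  also have "\<dots> \<le> (\<integral>\<^sup>+e. ennreal (exp (- t)) *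
      ennreal (exp ((\<Sum>k<r. (\<Sum>i\<in>I. e i * u k i)\<^sup>2) / (4 * s\<^sup>2))) \<partial>?E)"
    using s by (intro nn_integral_mono)
      (auto simp: indicator_def field_simps simp flip: ennreal_mult' exp_add ennreal_1)
  also have "\<dots> = ennreal (exp (- t)) * ennreal (sqrt 2 ^ r)"
    by (subst nn_integral_cmult) (auto simp: nn_integral_exp_projection[OF s I on])
  also have "\<dots> = ennreal (exp (- t) * sqrt 2 ^ r)"
    by (simp add: ennreal_mult')
  also have "\<dots> \<le> ennreal (exp (- t) * exp 1 ^ r)"
  proof -
    have "sqrt 2 \<le> sqrt (2\<^sup>2)" by (rule real_sqrt_le_mono) simp
    also have "\<dots> \<le> exp (1::real)" using exp_ge_add_one_self[of "1::real"] by simp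
    finally have "sqrt 2 ^ r \<le> exp (1::real) ^ r" by (intro power_mono) auto
    then show ?thesis by (intro ennreal_leI mult_left_mono) auto
  qed
  also have "exp (- t) * exp 1 ^ r = exp (real r - t)"
    by (simp add: exp_diff exp_minus field_simps flip: exp_of_nat_mult)
  finally show ?thesis .
qed

lemma nn_integral_exp_sum_squares:
  assumes s: "0 < s" and I: "finite I" and t: "2 * t * s\<^sup>2 < 1"
  shows "(\<integral>\<^sup>+e. ennreal (exp (t * (\<Sum>i\<in>I. (e i)\<^sup>2))) \<partial>Pi\<^sub>M I (\<lambda>_. normal_law s))
    = ennreal (exp (- (real (card I) / 2) * ln (1 - 2 * t * s\<^sup>2)))"
proof -
  interpret E: product_sigma_finite "\<lambda>_ :: 'a. normal_law s"
    by (rule product_sigma_finite_prob[OF prob_space_normal_law[OF s]])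
  let ?z = "1 - 2 * t * s\<^sup>2"
  have "(\<integral>\<^sup>+e. ennreal (exp (t * (\<Sum>i\<in>I. (e i)\<^sup>2))) \<partial>Pi\<^sub>M I (\<lambda>_. normal_law s))
      = (\<integral>\<^sup>+e. (\<Prod>i\<in>I. ennreal (exp (t * (e i)\<^sup>2))) \<partial>Pi\<^sub>M I (\<lambda>_. normal_law s))"
    by (simp add: sum_distrib_left exp_sum_ennreal I)
  also have "\<dots> = (\<Prod>i\<in>I. ennreal (1 / sqrt ?z))"
    using s t I by (subst E.product_nn_integral_prod) (auto simp: nn_integral_exp_square_normal)
  also have "\<dots> = ennreal ((1 / sqrt ?z) ^ card I)"
    using t by (simp add: ennreal_power)
  also have "1 / sqrt ?z = exp (- (1 / 2) * ln ?z)"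
    using t by (simp add: powr_half_sqrt[symmetric] powr_def exp_minus field_simps)
  also have "exp (- (1 / 2) * ln ?z) ^ card I = exp (- (real (card I) / 2) * ln ?z)"
    by (simp flip: exp_of_nat_mult)
  finally show ?thesis .
qed

text \<open>Chernoff bound for both tails with tilts of the same size y / (8 s^2), where y is the
  relative deviation. The tilt is kept small so that quadratic bounds for ln (1 - y/4) and ln (1 +
  y/4) suffice: a gain of y^2 / 8 against a loss of at most y^2 / 16.\<close>

lemma sum_squares_deviation:
  fixes I :: "'a set"
  assumes s: "0 < s" and I: "finite I" and x: "0 < x" "x \<le> s\<^sup>2"
  shows "emeasure (Pi\<^sub>M I (\<lambda>_. normal_law s))
      {e \<in> space (Pi\<^sub>M I (\<lambda>_. normal_law s)).
        real (card I) * x < \<bar>(\<Sum>i\<in>I. (e i)\<^sup>2) - real (card I) * s\<^sup>2\<bar>}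
    \<le> ennreal (2 * exp (- (real (card I) * (x / s\<^sup>2)\<^sup>2 / 16)))" (is "emeasure ?E ?A \<le> _")
proof -
  let ?m = "real (card I)"
  define y where "y = x / s\<^sup>2"
  have y: "0 < y" "y \<le> 1" "x = y * s\<^sup>2" using x s by (auto simp: y_def)
  define t where "t = y / (8 * s\<^sup>2)"
  have ts: "t * s\<^sup>2 = y / 8" using s by (simp add: t_def)
  have ts1: "2 * t * s\<^sup>2 = y / 4" "2 * (- t) * s\<^sup>2 = - (y / 4)" using ts by simp_all
  have A: "?A \<in> sets ?E" by measurable
  have "emeasure ?E ?A = (\<integral>\<^sup>+e. indicator ?A e \<partial>?E)" using A by simp
  also have "\<dots> \<le> (\<integral>\<^sup>+e. ennreal (exp (- ?m * (y / 8) * (1 + y))) * ennreal (exp (t * (\<Sum>i\<in>I. (e i)\<^sup>2)))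
      + ennreal (exp (?m * (y / 8) * (1 - y))) * ennreal (exp ((- t) * (\<Sum>i\<in>I. (e i)\<^sup>2))) \<partial>?E)"
  proof (rule nn_integral_mono)
    fix e :: "'a \<Rightarrow> real"
    let ?S = "\<Sum>i\<in>I. (e i)\<^sup>2"
    have t0: "t > 0" using y s by (simp add: t_def)
    have "1 \<le> exp (- ?m * (y / 8) * (1 + y)) * exp (t * ?S) + exp (?m * (y / 8) * (1 - y)) * exp ((-
        t) * ?S)"
      if "e \<in> ?A"
    proof -
      have "?m * x < ?S - ?m * s\<^sup>2 \<or> ?m * x < ?m * s\<^sup>2 - ?S"
        using that by (auto simp: abs_less_iff abs_if split: if_splits)
      then show ?thesis
      proof
        assume "?m * x < ?S - ?m * s\<^sup>2"
        then have "t * (?m * x + ?m * s\<^sup>2) \<le> t * ?S" using t0 by (intro mult_left_mono) auto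
        also have "t * (?m * x + ?m * s\<^sup>2) = ?m * (t * s\<^sup>2) * (1 + y)"
          by (simp add: y(3) algebra_simps)
        finally have "1 \<le> exp (- ?m * (y / 8) * (1 + y)) * exp (t * ?S)"
          by (simp add: ts flip: exp_add)
        then show ?thesis by (smt (verit) exp_gt_zero mult_pos_pos)
      next
        assume "?m * x < ?m * s\<^sup>2 - ?S"
        then have "t * ?S \<le> t * (?m * s\<^sup>2 - ?m * x)" using t0 by (intro mult_left_mono) auto
        also have "t * (?m * s\<^sup>2 - ?m * x) = ?m * (t * s\<^sup>2) * (1 - y)"
          by (simp add: y(3) algebra_simps)
        finally have "1 \<le> exp (?m * (y / 8) * (1 - y)) * exp ((- t) * ?S)"
          by (simp add: ts flip: exp_add)
        then show ?thesis by (smt (verit) exp_gt_zero mult_pos_pos)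
      qed
    qed
    then have "e \<in> ?A \<Longrightarrow> ennreal 1 \<le> ennreal (exp (- ?m * (y / 8) * (1 + y)) * exp (t * ?S)
        + exp (?m * (y / 8) * (1 - y)) * exp ((- t) * ?S))"
      by (intro ennreal_leI) auto
    then show "indicator ?A e \<le> ennreal (exp (- ?m * (y / 8) * (1 + y))) * ennreal (exp (t * ?S))
      + ennreal (exp (?m * (y / 8) * (1 - y))) * ennreal (exp ((- t) * ?S))"
      by (cases "e \<in> ?A") (auto simp: ennreal_plus ennreal_mult')
  qed
  also have "\<dots> = ennreal (exp (- ?m * (y / 8) * (1 + y))) * ennreal (exp (- (?m / 2) * ln (1 - y / 4)))
      + ennreal (exp (?m * (y / 8) * (1 - y))) * ennreal (exp (- (?m / 2) * ln (1 + y / 4)))"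
  proof -
    have "(\<integral>\<^sup>+e. ennreal (exp (t * (\<Sum>i\<in>I. (e i)\<^sup>2))) \<partial>?E) = ennreal (exp (- (?m / 2) * ln (1 - y / 4)))"
      using y by (subst nn_integral_exp_sum_squares[OF s I]) (auto simp: ts1)
    moreover have "(\<integral>\<^sup>+e. ennreal (exp ((- t) * (\<Sum>i\<in>I. (e i)\<^sup>2))) \<partial>?E) = ennreal (exp (- (?m / 2) * ln
        (1 + y / 4)))"
      using y by (subst nn_integral_exp_sum_squares[OF s I]) (auto simp: ts1)
    ultimately show ?thesis
      by (subst nn_integral_add) (auto simp: nn_integral_cmult)
  qed
  also have "\<dots> = ennreal (exp (- ?m * (y / 8) * (1 + y) - (?m / 2) * ln (1 - y / 4))
      + exp (?m * (y / 8) * (1 - y) - (?m / 2) * ln (1 + y / 4)))"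
    by (simp only: ennreal_mult'[symmetric] ennreal_plus[symmetric] exp_ge_zero exp_add[symmetric]) simp
  also have "\<dots> \<le> ennreal (2 * exp (- (?m * y\<^sup>2 / 16)))"
  proof (rule ennreal_leI)
    have "- (y / 4) - 2 * (y / 4)\<^sup>2 \<le> ln (1 - y / 4)"
      using y by (intro ln_one_minus_pos_lower_bound) auto
    moreover have "- (y / 8) * (1 + y) = - (y / 8) - y\<^sup>2 / 8" "(y / 4)\<^sup>2 = y\<^sup>2 / 16"
      by (simp_all add: power2_eq_square algebra_simps)
    ultimately have "- (y / 8) * (1 + y) - (1 / 2) * ln (1 - y / 4) \<le> - (y\<^sup>2 / 16)"
      by linarith
    then have "?m * (- (y / 8) * (1 + y) - (1 / 2) * ln (1 - y / 4)) \<le> ?m * (- (y\<^sup>2 / 16))"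
      by (intro mult_left_mono) auto
    then have 1: "exp (- ?m * (y / 8) * (1 + y) - (?m / 2) * ln (1 - y / 4)) \<le> exp (- (?m * y\<^sup>2 / 16))"
      by (simp add: algebra_simps)
    have "y / 4 - (y / 4)\<^sup>2 \<le> ln (1 + y / 4)"
      using y by (intro ln_one_plus_pos_lower_bound) auto
    moreover have "y / 8 * (1 - y) = y / 8 - y\<^sup>2 / 8" "(y / 4)\<^sup>2 = y\<^sup>2 / 16"
      by (simp_all add: power2_eq_square right_diff_distrib)
    moreover have "0 \<le> y\<^sup>2" by simp
    ultimately have "(y / 8) * (1 - y) - (1 / 2) * ln (1 + y / 4) \<le> - (y\<^sup>2 / 16)"
      by linarith
    then have "?m * ((y / 8) * (1 - y) - (1 / 2) * ln (1 + y / 4)) \<le> ?m * (- (y\<^sup>2 / 16))"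
      by (intro mult_left_mono) auto
    then have 2: "exp (?m * (y / 8) * (1 - y) - (?m / 2) * ln (1 + y / 4)) \<le> exp (- (?m * y\<^sup>2 / 16))"
      by (simp add: algebra_simps)
    from 1 2 show "exp (- ?m * (y / 8) * (1 + y) - (?m / 2) * ln (1 - y / 4))
      + exp (?m * (y / 8) * (1 - y) - (?m / 2) * ln (1 + y / 4)) \<le> 2 * exp (- (?m * y\<^sup>2 / 16))"
      by linarith
  qed
  finally show ?thesis by (simp add: y_def)
qed

text \<open>The one-dimensional substitution, one coordinate at a time. Restricting to
  \<open>I\<close> keeps the rescaled point among the extensional functions that make up the product
  space.\<close>

lemma nn_integral_PiM_lborel_scale:
  fixes c :: real
  assumes "finite I" "0 < c" "f \<in> borel_measurable (Pi\<^sub>M I (\<lambda>_. lborel))"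
  shows "(\<integral>\<^sup>+x. f x \<partial>Pi\<^sub>M I (\<lambda>_. lborel))
    = ennreal (c ^ card I) * (\<integral>\<^sup>+x. f (\<lambda>i\<in>I. c * x i) \<partial>Pi\<^sub>M I (\<lambda>_. lborel))"
  using assms(1,3)
proof (induction I arbitrary: f rule: finite_induct)
  case empty
  show ?case by (simp add: PiM_empty nn_integral_count_space_finite restrict_def)
next
  case (insert i I)
  note [measurable] = insert.prems
  interpret product_sigma_finite "\<lambda>_ :: 'a. lborel :: real measure" by (rule
      product_sigma_finite_lborel)
  let ?P = "Pi\<^sub>M I (\<lambda>_. lborel :: real measure)" and ?P' = "Pi\<^sub>M (insert i I) (\<lambda>_. lborel :: real
      measure)"
  have fm: "(\<lambda>x. f (\<lambda>j\<in>insert i I. c * x j)) \<in> borel_measurable ?P'"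
    by measurable
  have upd: "(\<lambda>j\<in>insert i I. c * (x(i := y)) j) = (\<lambda>j\<in>I. c * x j)(i := c * y)" for x y
    using insert.hyps by (auto simp: fun_eq_iff)
  have add: "(\<lambda>(x, y). x(i := y)) \<in> ?P \<Otimes>\<^sub>M lborel \<rightarrow>\<^sub>M ?P'"
    by (rule measurable_add_dim)
  have Fm: "(\<lambda>x. \<integral>\<^sup>+y. f (x(i := c * y)) \<partial>lborel) \<in> borel_measurable ?P"
  proof (rule lborel.borel_measurable_nn_integral)
    have "(\<lambda>(x, y). (x, c * y)) \<in> ?P \<Otimes>\<^sub>M lborel \<rightarrow>\<^sub>M ?P \<Otimes>\<^sub>M lborel" by measurable
    from measurable_compose[OF this measurable_compose[OF add insert.prems]]
    show "(\<lambda>(x, y). f (x(i := c * y))) \<in> borel_measurable (?P \<Otimes>\<^sub>M lborel)"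
      by (simp add: split_beta')
  qed
  have "(\<integral>\<^sup>+x. f x \<partial>?P') = (\<integral>\<^sup>+x. \<integral>\<^sup>+y. f (x(i := y)) \<partial>lborel \<partial>?P)"
    by (rule product_nn_integral_insert) (use insert in auto)
  also have "\<dots> = (\<integral>\<^sup>+x. ennreal c * (\<integral>\<^sup>+y. f (x(i := c * y)) \<partial>lborel) \<partial>?P)"
  proof (rule nn_integral_cong)
    fix x assume "x \<in> space ?P"
    then have "(\<lambda>y. (x, y)) \<in> lborel \<rightarrow>\<^sub>M ?P \<Otimes>\<^sub>M lborel" by simp
    from measurable_compose[OF this measurable_compose[OF add insert.prems]]
    have "(\<lambda>y. f (x(i := y))) \<in> borel_measurable borel" by (simp add: fun_upd_def)
    then show "(\<integral>\<^sup>+y. f (x(i := y)) \<partial>lborel) = ennreal c * (\<integral>\<^sup>+y. f (x(i := c * y)) \<partial>lborel)"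
      using nn_integral_real_affine[of "\<lambda>y. f (x(i := y))" c 0] assms(2) by simp
  qed
  also have "\<dots> = ennreal c * (\<integral>\<^sup>+x. \<integral>\<^sup>+y. f (x(i := c * y)) \<partial>lborel \<partial>?P)"
    by (rule nn_integral_cmult[OF Fm])
  also have "(\<integral>\<^sup>+x. \<integral>\<^sup>+y. f (x(i := c * y)) \<partial>lborel \<partial>?P)
      = ennreal (c ^ card I) * (\<integral>\<^sup>+x. \<integral>\<^sup>+y. f ((\<lambda>j\<in>I. c * x j)(i := c * y)) \<partial>lborel \<partial>?P)"
    by (rule insert.IH[OF Fm])
  also have "(\<integral>\<^sup>+x. \<integral>\<^sup>+y. f ((\<lambda>j\<in>I. c * x j)(i := c * y)) \<partial>lborel \<partial>?P)
      = (\<integral>\<^sup>+x. f (\<lambda>j\<in>insert i I. c * x j) \<partial>?P')"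
    using insert.hyps by (subst product_nn_integral_insert[OF _ _ fm]) (simp_all only: upd
        not_False_eq_True)
  also have "ennreal c * (ennreal (c ^ card I) * (\<integral>\<^sup>+x. f (\<lambda>j\<in>insert i I. c * x j) \<partial>?P'))
      = ennreal (c ^ card (insert i I)) * (\<integral>\<^sup>+x. f (\<lambda>j\<in>insert i I. c * x j) \<partial>?P')"
    using insert.hyps assms(2) by (simp add: ennreal_mult' mult.assoc)
  finally show ?case .
qed

text \<open>Variances of independent centred variables add, because the cross terms integrate to a
  product of means.\<close>

lemma nn_integral_square_sum_iid:
  fixes Q :: "'a measure" and I :: "'b set"
  assumes Q: "prob_space Q" and I: "finite I"
    and g2: "integrable Q (\<lambda>x. (g x)\<^sup>2)" and g1: "integrable Q g" "(\<integral>x. g x \<partial>Q) = 0"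
  shows "(\<integral>\<^sup>+x. ennreal ((\<Sum>i\<in>I. g (x i))\<^sup>2) \<partial>Pi\<^sub>M I (\<lambda>_. Q)) = ennreal (real (card I) * (\<integral>x. (g x)\<^sup>2 \<partial>Q))"
proof -
  interpret Q: prob_space Q by fact
  interpret P: product_sigma_finite "\<lambda>_ :: 'b. Q" by (rule product_sigma_finite_prob[OF Q])
  \<comment> \<open>Writes g (x i) * g (x j) as a product over all coordinates, with factor one away
    from i and j and factor g^2 on the diagonal; in this shape the integral of a product
    factorises.\<close>
  define h where "h = (\<lambda>i j k. if k = i \<and> k = j then (\<lambda>x. (g x)\<^sup>2) else if k = i \<or> k = (j::'b) then g
      else (\<lambda>_. 1 :: real))"
  have hint: "integrable Q (h i j k)" for i j k :: 'b
    unfolding h_def using g2 g1 by auto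
  have hval: "(\<Prod>k\<in>I. h i j k (x k)) = g (x i) * g (x j)" if "i \<in> I" "j \<in> I" for i j x
  proof (cases "i = j")
    case True
    have "(\<Prod>k\<in>I. h i j k (x k)) = (\<Prod>k\<in>I. if k = i then (g (x k))\<^sup>2 else 1)"
      by (intro prod.cong) (auto simp: h_def True)
    then show ?thesis using that I True by (simp add: power2_eq_square)
  next
    case False
    have "(\<Prod>k\<in>I. h i j k (x k)) = (\<Prod>k\<in>I. (if k = i then g (x k) else 1) * (if k = j then g (x k)
        else 1))"
      by (intro prod.cong) (use False in \<open>auto simp: h_def\<close>)
    then show ?thesis using that I by (simp add: prod.distrib)
  qed
  have int: "integrable (Pi\<^sub>M I (\<lambda>_. Q)) (\<lambda>x. g (x i) * g (x j))" if "i \<in> I" "j \<in> I" for i j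
    using P.product_integrable_prod[OF I, of "h i j"] hint hval[OF that] by simp
  have val: "(\<integral>x. g (x i) * g (x j) \<partial>Pi\<^sub>M I (\<lambda>_. Q)) = (if i = j then \<integral>x. (g x)\<^sup>2 \<partial>Q else 0)"
    if "i \<in> I" "j \<in> I" for i j
  proof -
    have "(\<integral>x. g (x i) * g (x j) \<partial>Pi\<^sub>M I (\<lambda>_. Q)) = (\<Prod>k\<in>I. \<integral>x. h i j k x \<partial>Q)"
      using P.product_integral_prod[OF I, of "h i j"] hint hval[OF that] by simp
    also have "\<dots> = (if i = j then \<integral>x. (g x)\<^sup>2 \<partial>Q else 0)"
    proof (cases "i = j")
      case True
      have "(\<Prod>k\<in>I. \<integral>x. h i j k x \<partial>Q) = (\<Prod>k\<in>I. if k = i then \<integral>x. (g x)\<^sup>2 \<partial>Q else 1)"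
        by (intro prod.cong) (auto simp: h_def True Q.prob_space)
      then show ?thesis using that I True by simp
    next
      case False
      have "(\<integral>x. h i j i x \<partial>Q) = 0" using g1 False by (simp add: h_def)
      then show ?thesis using False I that by (auto intro!: prod_zero)
    qed
    finally show ?thesis .
  qed
  have sq: "(\<Sum>i\<in>I. g (x i))\<^sup>2 = (\<Sum>i\<in>I. \<Sum>j\<in>I. g (x i) * g (x j))" for x :: "'b \<Rightarrow> 'a"
    by (simp add: power2_eq_square sum_product)
  have "(\<integral>\<^sup>+x. ennreal ((\<Sum>i\<in>I. g (x i))\<^sup>2) \<partial>Pi\<^sub>M I (\<lambda>_. Q))
      = ennreal (\<integral>x. (\<Sum>i\<in>I. g (x i))\<^sup>2 \<partial>Pi\<^sub>M I (\<lambda>_. Q))"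
  proof (rule nn_integral_eq_integral)
    show "integrable (Pi\<^sub>M I (\<lambda>_. Q)) (\<lambda>x. (\<Sum>i\<in>I. g (x i))\<^sup>2)"
      unfolding sq by (intro Bochner_Integration.integrable_sum int)
  qed simp
  also have "(\<integral>x. (\<Sum>i\<in>I. g (x i))\<^sup>2 \<partial>Pi\<^sub>M I (\<lambda>_. Q)) = (\<Sum>i\<in>I. \<Sum>j\<in>I. if i = j then \<integral>x. (g x)\<^sup>2 \<partial>Q else 0)"
    unfolding sq
    by (simp add: Bochner_Integration.integral_sum Bochner_Integration.integrable_sum int val cong:
        sum.cong)
  also have "\<dots> = real (card I) * (\<integral>x. (g x)\<^sup>2 \<partial>Q)" using I by simp
  finally show ?thesis .
qed

text \<open>Regroups independent pairs into the family of first components and the family of second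
  components, so that the noise can be integrated with the covariates held fixed. Both measures
  agree on boxes, whose indicator factorises over the coordinates.\<close>

lemma PiM_distr_pair:
  fixes I :: "'d set"
  assumes M: "prob_space M" and N: "prob_space N" and I: "finite I"
    and f[measurable]: "f \<in> M \<Otimes>\<^sub>M N \<rightarrow>\<^sub>M S"
  shows "Pi\<^sub>M I (\<lambda>_. distr (M \<Otimes>\<^sub>M N) S f)
    = distr (Pi\<^sub>M I (\<lambda>_. M) \<Otimes>\<^sub>M Pi\<^sub>M I (\<lambda>_. N)) (Pi\<^sub>M I (\<lambda>_. S)) (\<lambda>(a, b). \<lambda>i\<in>I. f (a i, b i))"
proof -
  interpret M: prob_space M by fact
  interpret N: prob_space N by fact
  interpret MN: pair_prob_space M N ..
  have D: "prob_space (distr (M \<Otimes>\<^sub>M N) S f)" by (rule MN.P.prob_space_distr) fact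
  interpret D: product_sigma_finite "\<lambda>_ :: 'd. distr (M \<Otimes>\<^sub>M N) S f" by (rule
      product_sigma_finite_prob[OF D])
  interpret PM: product_sigma_finite "\<lambda>_ :: 'd. M" by (rule product_sigma_finite_prob[OF M])
  interpret PN: product_sigma_finite "\<lambda>_ :: 'd. N" by (rule product_sigma_finite_prob[OF N])
  interpret PPN: sigma_finite_measure "Pi\<^sub>M I (\<lambda>_ :: 'd. N)" by (rule PN.sigma_finite[OF I])
  let ?g = "\<lambda>(a, b). \<lambda>i\<in>I. f (a i, b i)"
  let ?P = "Pi\<^sub>M I (\<lambda>_. M) \<Otimes>\<^sub>M Pi\<^sub>M I (\<lambda>_. N)"
  have g[measurable]: "?g \<in> ?P \<rightarrow>\<^sub>M Pi\<^sub>M I (\<lambda>_. S)" by measurable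
  have "distr ?P (Pi\<^sub>M I (\<lambda>_. S)) ?g = Pi\<^sub>M I (\<lambda>_. distr (M \<Otimes>\<^sub>M N) S f)"
  proof (rule D.PiM_eqI[OF I])
    show "sets (distr ?P (Pi\<^sub>M I (\<lambda>_. S)) ?g) = sets (Pi\<^sub>M I (\<lambda>_. distr (M \<Otimes>\<^sub>M N) S f))"
      by (simp cong: sets_PiM_cong)
    fix A assume "\<And>i. i \<in> I \<Longrightarrow> A i \<in> sets (distr (M \<Otimes>\<^sub>M N) S f)"
    then have A[measurable]: "\<And>i. i \<in> I \<Longrightarrow> A i \<in> sets S" by simp
    have box: "Pi\<^sub>E I A \<in> sets (Pi\<^sub>M I (\<lambda>_. S))" using I A by (intro sets_PiM_I_finite) auto
    have ind: "indicator (Pi\<^sub>E I A) (?g (a, b)) = (\<Prod>i\<in>I. indicator (A i) (f (a i, b i)) :: ennreal)"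
        for a b
      by (auto simp: indicator_def I PiE_iff prod_zero_iff)
    have "emeasure (distr ?P (Pi\<^sub>M I (\<lambda>_. S)) ?g) (Pi\<^sub>E I A)
        = (\<integral>\<^sup>+z. indicator (Pi\<^sub>E I A) z \<partial>distr ?P (Pi\<^sub>M I (\<lambda>_. S)) ?g)"
      using box by simp
    also have "\<dots> = (\<integral>\<^sup>+z. indicator (Pi\<^sub>E I A) (?g z) \<partial>?P)"
      using box by (intro nn_integral_distr) auto
    also have "\<dots> = (\<integral>\<^sup>+a. \<integral>\<^sup>+b. indicator (Pi\<^sub>E I A) (?g (a, b)) \<partial>Pi\<^sub>M I (\<lambda>_. N) \<partial>Pi\<^sub>M I (\<lambda>_. M))"
      using box by (intro PPN.nn_integral_fst[symmetric] measurable_compose[OF g]) auto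
    also have "\<dots> = (\<integral>\<^sup>+a. \<integral>\<^sup>+b. (\<Prod>i\<in>I. indicator (A i) (f (a i, b i))) \<partial>Pi\<^sub>M I (\<lambda>_. N) \<partial>Pi\<^sub>M I (\<lambda>_. M))"
      unfolding ind ..
    also have "\<dots> = (\<integral>\<^sup>+a. (\<Prod>i\<in>I. \<integral>\<^sup>+y. indicator (A i) (f (a i, y)) \<partial>N) \<partial>Pi\<^sub>M I (\<lambda>_. M))"
      using I A by (intro nn_integral_cong PN.product_nn_integral_prod) (auto simp: space_PiM PiE_iff)
    also have "\<dots> = (\<Prod>i\<in>I. \<integral>\<^sup>+x. \<integral>\<^sup>+y. indicator (A i) (f (x, y)) \<partial>N \<partial>M)"
      using I A by (intro PM.product_nn_integral_prod) auto
    also have "\<dots> = (\<Prod>i\<in>I. emeasure (distr (M \<Otimes>\<^sub>M N) S f) (A i))"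
    proof (rule prod.cong[OF refl])
      fix i assume i: "i \<in> I"
      have "emeasure (distr (M \<Otimes>\<^sub>M N) S f) (A i) = (\<integral>\<^sup>+z. indicator (A i) z \<partial>distr (M \<Otimes>\<^sub>M N) S f)"
        using A[OF i] by simp
      also have "\<dots> = (\<integral>\<^sup>+z. indicator (A i) (f z) \<partial>(M \<Otimes>\<^sub>M N))"
        using A[OF i] by (intro nn_integral_distr) auto
      also have "\<dots> = (\<integral>\<^sup>+x. \<integral>\<^sup>+y. indicator (A i) (f (x, y)) \<partial>N \<partial>M)"
        using A[OF i] by (intro N.nn_integral_fst[symmetric] measurable_compose[OF f]) auto
      finally show "(\<integral>\<^sup>+x. \<integral>\<^sup>+y. indicator (A i) (f (x, y)) \<partial>N \<partial>M) = emeasure (distr (M \<Otimes>\<^sub>M N) S f) (A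
          i)" ..
    qed
    finally show "emeasure (distr ?P (Pi\<^sub>M I (\<lambda>_. S)) ?g) (Pi\<^sub>E I A) = (\<Prod>i\<in>I. emeasure (distr (M \<Otimes>\<^sub>M N)
        S f) (A i))" .
  qed
  then show ?thesis ..
qed

section \<open>Likelihood and priors\<close>

lemma inverse_sqrt_eq_exp:
  fixes x :: real
  assumes "0 < x"
  shows "1 / sqrt x = exp (- (1 / 2) * ln x)"
proof -
  have "sqrt x = exp (ln x / 2)"
    by (rule real_sqrt_unique) (use assms in \<open>simp_all add: power2_eq_square flip: exp_add\<close>)
  then show ?thesis by (simp add: exp_minus field_simps)
qed

lemma likelihood2_eq:
  assumes "0 < s2"
  shows "likelihood2 n p d \<theta> s2 = exp (- (real (card {n div 2 + 1..n}) / 2) * ln (2 * pi * s2)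
    - (\<Sum>i=n div 2 + 1..n. (fst (d i) - dotp p (snd (d i)) \<theta>)\<^sup>2) / (2 * s2))"
proof -
  let ?D = "{n div 2 + 1..n}"
  have nd: "normal_density \<mu> (sqrt s2) y = exp (- (1 / 2) * ln (2 * pi * s2) - (y - \<mu>)\<^sup>2 / (2 * s2))"
      for \<mu> y
  proof -
    have "1 / sqrt (2 * pi * s2) = exp (- (1 / 2) * ln (2 * pi * s2))"
      using assms by (intro inverse_sqrt_eq_exp) simp
    then have "normal_density \<mu> (sqrt s2) y
        = exp (- (1 / 2) * ln (2 * pi * s2)) * exp (- ((y - \<mu>)\<^sup>2 / (2 * s2)))"
      unfolding normal_density_def using assms by simp
    then show ?thesis by (simp flip: exp_add)
  qed
  have "likelihood2 n p d \<theta> s2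
      = exp (\<Sum>i\<in>?D. - (1 / 2) * ln (2 * pi * s2) - (fst (d i) - dotp p (snd (d i)) \<theta>)\<^sup>2 / (2 * s2))"
    unfolding likelihood2_def nd by (rule exp_sum[symmetric]) simp
  then show ?thesis unfolding sum_subtractf sum_divide_distrib[symmetric] sum_constant by simp
qed

text \<open>Twice the Kullback-Leibler divergence of N(0, r) from N(0, 1), i.e. with the expectation
  under N(0, 1): the cost per observation, in units of one half, of a variance r times too
  large.\<close>

definition rate_fn :: "real \<Rightarrow> real" where
  "rate_fn r = ln r + 1 / r - 1"

text \<open>From \<open>ln x = 2 ln \<surd>x \<le> 2 (\<surd>x - 1)\<close>.\<close>

lemma rate_fn_lower:
  assumes "0 < r"
  shows "(1 / sqrt r - 1)\<^sup>2 \<le> rate_fn r"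
proof -
  have "ln (1 / sqrt r) \<le> 1 / sqrt r - 1" using assms by (intro ln_le_minus_one) auto
  moreover have "ln (1 / sqrt r) = - ln r / 2" using assms by (simp add: ln_div ln_sqrt)
  moreover have "(1 / sqrt r - 1)\<^sup>2 = 1 / r - 2 * (1 / sqrt r) + 1"
    using assms by (simp add: power2_diff power_divide)
  ultimately show ?thesis unfolding rate_fn_def by linarith
qed

lemma rate_fn_nonneg: "0 < r \<Longrightarrow> 0 \<le> rate_fn r"
  using rate_fn_lower[of r] zero_le_power2[of "1 / sqrt r - 1"] by linarith

lemma rate_fn_upper:
  assumes "0 < r"
  shows "rate_fn r \<le> (r - 1)\<^sup>2 / r"
proof -
  have "ln r \<le> r - 1" using assms by (rule ln_le_minus_one)
  then have "rate_fn r \<le> r + 1 / r - 2" unfolding rate_fn_def by linarith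
  also have "\<dots> = (r - 1)\<^sup>2 / r" using assms by (simp add: field_simps power2_eq_square)
  finally show ?thesis .
qed

text \<open>The interaction of noise and prediction error will contribute k / r, which is unbounded
  as the candidate variance tends to zero. The rate dominates it, since 1 / r \<le> 2 * rate_fn r +
  2; for k \<le> 1 / 4 half of the rate absorbs the growing part.\<close>

lemma rate_fn_minus_inverse:
  assumes r: "0 < r" and k: "0 \<le> k" "k \<le> 1 / 4"
  shows "rate_fn r / 2 - 2 * k \<le> rate_fn r - k / r"
proof -
  \<comment> \<open>Taking the logarithm at 1 / (2 r) instead of 1 / r leaves half of 1 / r to
    spare.\<close>
  have "ln (1 / (2 * r)) \<le> 1 / (2 * r) - 1" using r by (intro ln_le_minus_one) auto
  moreover have "ln (1 / (2 * r)) = - ln r - ln 2" using r by (simp add: ln_div ln_mult)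
  moreover have "ln 2 \<le> (1::real)" using ln_le_minus_one[of "2::real"] by simp
  moreover define x where "x = 1 / r"
  ultimately have "- ln r - ln 2 \<le> x / 2 - 1" "ln 2 \<le> (1::real)" by simp_all
  then have "x \<le> 2 * (ln r + x - 1) + 2" by argo
  then have "1 / r \<le> 2 * rate_fn r + 2" unfolding rate_fn_def x_def .
  then have "k * (1 / r) \<le> k * (2 * rate_fn r + 2)" using k by (intro mult_left_mono) auto
  also have "\<dots> = (2 * k) * rate_fn r + 2 * k" by (simp add: algebra_simps)
  also have "(2 * k) * rate_fn r \<le> (1 / 2) * rate_fn r"
    using k rate_fn_nonneg[OF r] by (intro mult_right_mono) auto
  finally show ?thesis by simp
qed

text \<open>For r \<le> 2 the bound of \<open>rate_fn_lower\<close> is quadratic in r - 1. For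
  larger r it only gives a positive constant, and the rate itself grows only logarithmically; hence
  the cap t \<le> 1.\<close>

lemma rate_fn_away:
  assumes r: "0 < r" and t: "0 \<le> t" "t \<le> 1" "t \<le> \<bar>r - 1\<bar>"
  shows "t\<^sup>2 / 16 \<le> rate_fn r"
proof -
  define q where "q = sqrt r"
  have q: "0 < q" "r = q\<^sup>2" using r by (auto simp: q_def)
  have "t \<le> 4 * \<bar>1 / q - 1\<bar>"
  proof (cases "r \<le> 2")
    case True
    have "q\<^sup>2 \<le> (3/2)\<^sup>2" using True q by (simp add: power2_eq_square)
    then have q1: "q \<le> 3/2" by (rule power2_le_imp_le) simp
    have "r - 1 = (q - 1) * (q + 1)" using q by (simp add: power2_eq_square algebra_simps)
    then have "\<bar>r - 1\<bar> = \<bar>q - 1\<bar> * (q + 1)" using q by (simp add: abs_mult)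
    moreover have "q - 1 = - ((1 / q - 1) * q)" using q by (simp add: field_simps)
    then have "\<bar>q - 1\<bar> = \<bar>1 / q - 1\<bar> * q" using q by (simp add: abs_mult)
    ultimately have "\<bar>r - 1\<bar> = \<bar>1 / q - 1\<bar> * (q * (q + 1))" by simp
    also have "\<dots> \<le> \<bar>1 / q - 1\<bar> * 4"
    proof (rule mult_left_mono)
      have "q * q \<le> 2" using True q by (simp add: power2_eq_square)
      then show "q * (q + 1) \<le> 4" using q1 by (simp add: algebra_simps)
    qed simp
    finally show ?thesis using t by linarith
  next
    case False
    have "(4/3)\<^sup>2 \<le> q\<^sup>2" using False q by (simp add: power2_eq_square)
    then have "4/3 \<le> q" by (rule power2_le_imp_le) (use q in simp)
    then have "1 / q \<le> 3/4" using q by (simp add: field_simps)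
    then have "1 / 4 \<le> \<bar>1 / q - 1\<bar>" by (simp add: abs_if)
    then have "1 \<le> 4 * \<bar>1 / q - 1\<bar>" by simp
    then show ?thesis using t(2) by (rule order_trans[rotated])
  qed
  then have "t\<^sup>2 \<le> (4 * \<bar>1 / q - 1\<bar>)\<^sup>2" using t by (intro power_mono) auto
  then have "t\<^sup>2 \<le> 16 * (1 / q - 1)\<^sup>2" by (simp add: power_mult_distrib)
  then show ?thesis using rate_fn_lower[OF r] by (simp add: q_def)
qed

section \<open>Inverse Gaussian prior of the variance\<close>

lemma inv_gauss_density_nonneg: "0 < xi \<Longrightarrow> 0 < s2 \<Longrightarrow> 0 \<le> inv_gauss_density eta xi s2"
  by (simp add: inv_gauss_density_def)

lemma borel_measurable_inv_gauss_density [measurable]: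
  "inv_gauss_density eta xi \<in> borel_measurable borel"
  unfolding inv_gauss_density_def by measurable

text \<open>Expanding the square splits the exponent into linear decay in s, a constant and - xi /
  (2 s). The last part beats the singularity at zero: the prefactor is at most a multiple of 1 + 1 /
  s^2, and y^2 exp (- y) \<le> 2 at y = xi / (2 s).\<close>

lemma inv_gauss_density_le_exp:
  assumes eta: "0 < eta" and xi: "0 < xi" and s: "0 < s"
  shows "inv_gauss_density eta xi s \<le> sqrt xi * exp (xi / eta) * (1 + 8 / xi\<^sup>2) * exp (- (xi / (2 *
      eta\<^sup>2)) * s)"
proof -
  have e: "- (xi * (s - eta)\<^sup>2) / (2 * eta\<^sup>2 * s) = - (xi / (2 * eta\<^sup>2)) * s + xi / eta - xi / (2 * s)"
    using eta s by (simp add: field_simps power2_eq_square)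
  have root: "sqrt (xi / (2 * pi * s ^ 3)) \<le> sqrt xi * (1 + 1 / s\<^sup>2)"
  proof (rule real_le_lsqrt)
    have "1 / s ^ 3 \<le> (1 + 1 / s\<^sup>2)\<^sup>2"
    proof (cases "s \<le> 1")
      case True
      have "1 / s ^ 3 \<le> 1 / s ^ 4" using True s by (intro divide_left_mono power_decreasing) auto
      also have "\<dots> = (1 / s\<^sup>2)\<^sup>2" using s by (simp add: power_divide)
      also have "\<dots> \<le> (1 + 1 / s\<^sup>2)\<^sup>2" using s by (intro power_mono) auto
      finally show ?thesis .
    next
      case False
      have "1 / s ^ 3 \<le> 1" using False by simp
      also have "\<dots> \<le> (1 + 1 / s\<^sup>2)\<^sup>2" using s by (intro one_le_power) auto
      finally show ?thesis .
    qed
    then have "xi * (1 / s ^ 3) \<le> xi * (1 + 1 / s\<^sup>2)\<^sup>2" using xi by (intro mult_left_mono) auto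
    moreover have "xi / (2 * pi * s ^ 3) \<le> xi / s ^ 3"
    proof (rule divide_left_mono)
      have "1 * s ^ 3 \<le> 2 * pi * s ^ 3" using s pi_gt3 by (intro mult_right_mono) auto
      then show "s ^ 3 \<le> 2 * pi * s ^ 3" by simp
    qed (use s xi in auto)
    ultimately show "xi / (2 * pi * s ^ 3) \<le> (sqrt xi * (1 + 1 / s\<^sup>2))\<^sup>2"
      using xi by (simp add: power_mult_distrib)
  qed (use s xi in auto)
  have exps: "(1 + 1 / s\<^sup>2) * exp (- (xi / (2 * s))) \<le> 1 + 8 / xi\<^sup>2"
  proof -
    define y where "y = xi / (2 * s)"
    have y: "0 < y" using xi s by (simp add: y_def)
    have "y\<^sup>2 / 2 \<le> exp y"
    proof -
      have "1 + y + y\<^sup>2 / 2 \<le> exp y" using y by (intro exp_lower_Taylor_quadratic) auto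
      then show ?thesis using y by linarith
    qed
    then have "y\<^sup>2 * exp (- y) \<le> 2" by (simp add: exp_minus field_simps)
    then have "(4 / xi\<^sup>2) * (y\<^sup>2 * exp (- y)) \<le> (4 / xi\<^sup>2) * 2" by (intro mult_left_mono) auto
    moreover have "(4 / xi\<^sup>2) * y\<^sup>2 = 1 / s\<^sup>2" using xi s by (simp add: y_def power_divide
        power_mult_distrib)
    moreover have "(4 / xi\<^sup>2) * (y\<^sup>2 * exp (- y)) = ((4 / xi\<^sup>2) * y\<^sup>2) * exp (- y)" by simp
    ultimately have e1: "1 / s\<^sup>2 * exp (- y) \<le> 8 / xi\<^sup>2" by simp
    have "1 * exp (- y) \<le> 1" using y by simp
    from add_mono[OF this e1] have "1 * exp (- y) + 1 / s\<^sup>2 * exp (- y) \<le> 1 + 8 / xi\<^sup>2" .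
    then show ?thesis unfolding y_def distrib_right .
  qed
  have "inv_gauss_density eta xi s \<le> sqrt xi * (1 + 1 / s\<^sup>2) * exp (- (xi * (s - eta)\<^sup>2) / (2 * eta\<^sup>2 *
      s))"
    unfolding inv_gauss_density_def by (intro mult_right_mono root) auto
  also have "\<dots> = sqrt xi * exp (xi / eta) * ((1 + 1 / s\<^sup>2) * exp (- (xi / (2 * s)))) * exp (- (xi /
      (2 * eta\<^sup>2)) * s)"
    unfolding e by (simp only: diff_conv_add_uminus exp_add mult_ac)
  also have "\<dots> \<le> sqrt xi * exp (xi / eta) * (1 + 8 / xi\<^sup>2) * exp (- (xi / (2 * eta\<^sup>2)) * s)"
    using xi by (intro mult_right_mono mult_left_mono exps) auto
  finally show ?thesis .
qed

text \<open>Comparison with a multiple of an exponential density. The constant only multiplies exp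
  (- n eps^2) in the end, so its size does not matter.\<close>

lemma inv_gauss_density_mass_finite:
  assumes eta: "0 < eta" and xi: "0 < xi"
  shows "\<exists>C>0. (\<integral>\<^sup>+s. ennreal (inv_gauss_density eta xi s) * indicator {0<..} s \<partial>lborel) \<le> ennreal C"
proof -
  define a where "a = xi / (2 * eta\<^sup>2)"
  define c where "c = sqrt xi * exp (xi / eta) * (1 + 8 / xi\<^sup>2)"
  have a: "0 < a" and c: "0 < c" using eta xi by (auto simp: a_def c_def intro!: mult_pos_pos
      add_pos_pos)
  have 1: "(\<integral>\<^sup>+s. ennreal (exponential_density a s) \<partial>lborel) = 1"
    using prob_space.emeasure_space_1[OF prob_space_exponential_density[OF a]]
    by (simp add: emeasure_density)
  have "(\<integral>\<^sup>+s. ennreal (inv_gauss_density eta xi s) * indicator {0<..} s \<partial>lborel)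
      \<le> (\<integral>\<^sup>+s. ennreal (c / a) * ennreal (exponential_density a s) \<partial>lborel)"
  proof (rule nn_integral_mono)
    fix s :: real
    show "ennreal (inv_gauss_density eta xi s) * indicator {0<..} s \<le> ennreal (c / a) * ennreal
        (exponential_density a s)"
    proof (cases "0 < s")
      case True
      have "inv_gauss_density eta xi s \<le> c * exp (- a * s)"
        using inv_gauss_density_le_exp[OF eta xi True] by (simp add: a_def c_def)
      also have "\<dots> = c / a * exponential_density a s"
        using a True by (simp add: exponential_density_def mult.commute)
      finally have "inv_gauss_density eta xi s \<le> c / a * exponential_density a s" .
      then show ?thesis using True a c by (auto simp: ennreal_mult'[symmetric] intro!: ennreal_leI)
    qed auto
  qed
  also have "\<dots> = ennreal (c / a)" by (subst nn_integral_cmult) (auto simp: 1)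
  finally show ?thesis using a c by (intro exI[of _ "c / a"]) auto
qed

text \<open>A positive minimum by compactness. With s0 the true variance, the unit interval contains
  every window of length eps used for the normalising constant, so one constant serves all sample
  sizes.\<close>

lemma inv_gauss_density_lower:
  assumes xi: "0 < xi" and s0: "0 < s0"
  shows "\<exists>c>0. \<forall>s\<in>{s0..s0+1}. c \<le> inv_gauss_density eta xi s"
proof -
  define g where "g = (\<lambda>s. inv_gauss_density eta xi s)"
  have "continuous_on {s0..s0+1} g"
    unfolding g_def inv_gauss_density_def using s0
    by (cases "eta = 0") (auto intro!: continuous_intros)
  then obtain x where x: "x \<in> {s0..s0+1}" "\<And>y. y \<in> {s0..s0+1} \<Longrightarrow> g x \<le> g y"
    using continuous_attains_inf[of "{s0..s0+1}" g] by auto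
  have "0 < g x" using x(1) s0 xi by (auto simp: g_def inv_gauss_density_def)
  with x(2) show ?thesis by (intro exI[of _ "g x"]) (auto simp: g_def)
qed

section \<open>Truncated Gaussian prior of the coefficients\<close>

definition prior_form :: "nat \<Rightarrow> rvec \<Rightarrow> rvec \<Rightarrow> real" where
  "prior_form k la b = (\<Sum>i=1..k. (b i)\<^sup>2 / la i)"

lemma beta_kernel_eq:
  "beta_kernel k la R b = exp (- prior_form k la b) *
    (if ereal (sqrt (\<Sum>i=1..k. la i * (b i)\<^sup>2)) \<le> R then 1 else 0)"
  unfolding beta_kernel_def mat_norm_def quad_form_diag prior_form_def by simp

lemma beta_kernel_nonneg: "0 \<le> beta_kernel k la R b"
  unfolding beta_kernel_def by simp

lemma borel_measurable_prior_form [measurable]: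
  "prior_form k la \<in> borel_measurable (Pi\<^sub>M {1..k} (\<lambda>_. lborel))"
  unfolding prior_form_def[abs_def] by measurable

lemma borel_measurable_beta_kernel [measurable]:
  "beta_kernel k la R \<in> borel_measurable (Pi\<^sub>M {1..k} (\<lambda>_. lborel))"
  unfolding beta_kernel_eq[abs_def] prior_form_def by measurable

lemma nn_integral_beta_kernel_le:
  assumes la: "\<And>i. i \<in> {1..k} \<Longrightarrow> 0 < la i"
  shows "(\<integral>\<^sup>+b. ennreal (beta_kernel k la R b) \<partial>Pi\<^sub>M {1..k} (\<lambda>_. lborel)) \<le> ennreal (\<Prod>i=1..k. sqrt (pi
      * la i))"
proof -
  interpret product_sigma_finite "\<lambda>_ :: nat. lborel :: real measure" by (rule
      product_sigma_finite_lborel)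
  have "(\<integral>\<^sup>+b. ennreal (beta_kernel k la R b) \<partial>Pi\<^sub>M {1..k} (\<lambda>_. lborel))
      \<le> (\<integral>\<^sup>+b. (\<Prod>i=1..k. ennreal (exp (- ((b i)\<^sup>2 / la i)))) \<partial>Pi\<^sub>M {1..k} (\<lambda>_. lborel))"
    by (intro nn_integral_mono)
      (auto simp: beta_kernel_eq prior_form_def exp_sum prod_ennreal sum_negf[symmetric])
  also have "\<dots> = (\<Prod>i=1..k. \<integral>\<^sup>+x. ennreal (exp (- (x\<^sup>2 / la i))) \<partial>lborel)"
    by (rule product_nn_integral_prod) auto
  also have "\<dots> = (\<Prod>i=1..k. ennreal (sqrt (pi * la i)))"
    using la by (intro prod.cong refl nn_integral_exp_neg_square) auto
  also have "\<dots> = ennreal (\<Prod>i=1..k. sqrt (pi * la i))"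
    using la by (intro prod_ennreal) (auto simp: less_imp_le)
  finally show ?thesis .
qed

lemma beta_kernel_integrable:
  assumes la: "\<And>i. i \<in> {1..k} \<Longrightarrow> 0 < la i"
  shows "integrable (Pi\<^sub>M {1..k} (\<lambda>_. lborel)) (beta_kernel k la R)"
proof (rule integrableI_nonneg)
  have "(\<integral>\<^sup>+b. ennreal (beta_kernel k la R b) \<partial>Pi\<^sub>M {1..k} (\<lambda>_. lborel)) \<le> ennreal (\<Prod>i=1..k. sqrt (pi
      * la i))"
    by (rule nn_integral_beta_kernel_le) (rule la)
  then show "(\<integral>\<^sup>+b. ennreal (beta_kernel k la R b) \<partial>Pi\<^sub>M {1..k} (\<lambda>_. lborel)) < \<infinity>"
    by (rule order.strict_trans1) simp
qed (auto simp: beta_kernel_nonneg)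

lemma nn_integral_beta_kernel:
  assumes la: "\<And>i. i \<in> {1..k} \<Longrightarrow> 0 < la i"
  shows "(\<integral>\<^sup>+b. ennreal (beta_kernel k la R b) \<partial>Pi\<^sub>M {1..k} (\<lambda>_. lborel))
    = ennreal (\<integral>b. beta_kernel k la R b \<partial>Pi\<^sub>M {1..k} (\<lambda>_. lborel))"
  by (rule nn_integral_eq_integral, rule beta_kernel_integrable, rule la) (auto simp:
      beta_kernel_nonneg)

lemma beta_prior_nonneg: "0 \<le> beta_prior k la R b"
  unfolding beta_prior_def by (intro divide_nonneg_nonneg integral_nonneg_AE) (auto simp:
      beta_kernel_nonneg)

lemma borel_measurable_beta_prior [measurable]:
  "beta_prior k la R \<in> borel_measurable (Pi\<^sub>M {1..k} (\<lambda>_. lborel))"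
  unfolding beta_prior_def[abs_def] by measurable

text \<open>An inequality because the normaliser \<open>Z\<close> may vanish for an arbitrary
  radius; division by zero then makes the prior identically zero.\<close>

lemma nn_integral_beta_prior_le_1:
  assumes la: "\<And>i. i \<in> {1..k} \<Longrightarrow> 0 < la i"
  shows "(\<integral>\<^sup>+b. ennreal (beta_prior k la R b) \<partial>Pi\<^sub>M {1..k} (\<lambda>_. lborel)) \<le> 1"
proof -
  let ?P = "Pi\<^sub>M {1..k} (\<lambda>_. lborel :: real measure)"
  define Z where "Z = (\<integral>b. beta_kernel k la R b \<partial>?P)"
  have Zeq: "(\<integral>\<^sup>+b. ennreal (beta_kernel k la R b) \<partial>?P) = ennreal Z"
    unfolding Z_def by (rule nn_integral_beta_kernel) (rule la)
  have Z: "0 \<le> Z" unfolding Z_def by (intro integral_nonneg_AE) (auto simp: beta_kernel_nonneg)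
  have "(\<integral>\<^sup>+b. ennreal (beta_prior k la R b) \<partial>Pi\<^sub>M {1..k} (\<lambda>_. lborel))
      = (\<integral>\<^sup>+b. ennreal (1 / Z) * ennreal (beta_kernel k la R b) \<partial>Pi\<^sub>M {1..k} (\<lambda>_. lborel))"
    using Z by (simp add: beta_prior_def Z_def[symmetric] ennreal_mult'[symmetric] beta_kernel_nonneg)
  also have "\<dots> = ennreal (1 / Z) * ennreal Z"
    by (simp add: nn_integral_cmult Zeq)
  also have "\<dots> \<le> 1" using Z by (cases "Z = 0") (auto simp: ennreal_mult'[symmetric])
  finally show ?thesis .
qed

text \<open>Rescaling by \<open>\<surd>2\<close> compares \<open>exp (-Q/2)\<close> on the truncation region with \<open>exp (-Q)\<close>; the region
  shrinks in the right direction, so the truncation costs nothing.\<close>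

lemma beta_prior_tail:
  assumes la: "\<And>i. i \<in> {1..k} \<Longrightarrow> 0 < la i"
  shows "(\<integral>\<^sup>+b. ennreal (beta_prior k la R b) * indicator {b. t < prior_form k la b} b \<partial>Pi\<^sub>M {1..k}
      (\<lambda>_. lborel))
    \<le> ennreal (exp (- (t / 2)) * sqrt 2 ^ k)"
proof -
  let ?P = "Pi\<^sub>M {1..k} (\<lambda>_. lborel :: real measure)"
  define Z where "Z = (\<integral>b. beta_kernel k la R b \<partial>?P)"
  have Zeq: "(\<integral>\<^sup>+b. ennreal (beta_kernel k la R b) \<partial>?P) = ennreal Z"
    unfolding Z_def by (rule nn_integral_beta_kernel) (rule la)
  have Z: "0 \<le> Z" unfolding Z_def by (intro integral_nonneg_AE) (auto simp: beta_kernel_nonneg)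
  define I where "I = (\<lambda>b. if ereal (sqrt (\<Sum>i=1..k. la i * (b i)\<^sup>2)) \<le> R then 1 else (0::real))"
  define g where "g = (\<lambda>b. exp (- (prior_form k la b / 2)) * I b)"
  have gm: "(\<lambda>b. ennreal (g b)) \<in> borel_measurable ?P"
    unfolding g_def I_def prior_form_def by measurable
  have "(\<integral>\<^sup>+b. ennreal (g b) \<partial>?P) = ennreal (sqrt 2 ^ card {1..k}) * (\<integral>\<^sup>+b. ennreal (g (\<lambda>i\<in>{1..k}.
      sqrt 2 * b i)) \<partial>?P)"
    by (rule nn_integral_PiM_lborel_scale[OF _ _ gm]) auto
  also have "\<dots> \<le> ennreal (sqrt 2 ^ k) * (\<integral>\<^sup>+b. ennreal (beta_kernel k la R b) \<partial>?P)"
  proof -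
    have "g (\<lambda>i\<in>{1..k}. sqrt 2 * b i) \<le> beta_kernel k la R b" for b
    proof -
      have "prior_form k la (\<lambda>i\<in>{1..k}. sqrt 2 * b i) = 2 * prior_form k la b"
        unfolding prior_form_def sum_distrib_left by (intro sum.cong) (auto simp: power_mult_distrib)
      moreover have "I (\<lambda>i\<in>{1..k}. sqrt 2 * b i) \<le> I b"
      proof -
        have "sqrt (\<Sum>i=1..k. la i * (b i)\<^sup>2) \<le> sqrt (\<Sum>i=1..k. la i * ((\<lambda>i\<in>{1..k}. sqrt 2 * b i) i)\<^sup>2)"
          using la by (intro real_sqrt_le_mono sum_mono) (auto simp: power_mult_distrib
              mult_left_mono less_imp_le)
        then show ?thesis unfolding I_def
          by (auto intro: order_trans[rotated])
      qed
      ultimately show ?thesis by (simp add: g_def beta_kernel_eq I_def)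
    qed
    then show ?thesis by (intro mult_mono nn_integral_mono ennreal_leI) auto
  qed
  finally have gint: "(\<integral>\<^sup>+b. ennreal (g b) \<partial>?P) \<le> ennreal (sqrt 2 ^ k * Z)"
    using Z by (simp add: Zeq ennreal_mult')
  have "(\<integral>\<^sup>+b. ennreal (beta_prior k la R b) * indicator {b. t < prior_form k la b} b \<partial>?P)
      \<le> (\<integral>\<^sup>+b. ennreal (exp (- (t / 2)) / Z) * ennreal (g b) \<partial>?P)"
  proof (rule nn_integral_mono)
    fix b
    have "beta_prior k la R b \<le> exp (- (t / 2)) / Z * g b" if "t < prior_form k la b"
    proof -
      have "exp (- prior_form k la b) \<le> exp (- (t / 2)) * exp (- (prior_form k la b / 2))"
        using that by (simp flip: exp_add)
      then have "exp (- prior_form k la b) * I b \<le> exp (- (t / 2)) * exp (- (prior_form k la b / 2))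
          * I b"
        by (intro mult_right_mono) (auto simp: I_def)
      then have "beta_kernel k la R b \<le> exp (- (t / 2)) * g b"
        by (simp add: beta_kernel_eq I_def g_def mult.assoc)
      then show ?thesis using Z by (simp add: beta_prior_def Z_def[symmetric] divide_right_mono)
    qed
    then show "ennreal (beta_prior k la R b) * indicator {b. t < prior_form k la b} b
      \<le> ennreal (exp (- (t / 2)) / Z) * ennreal (g b)"
      using Z by (auto simp: indicator_def ennreal_mult'[symmetric] intro!: ennreal_leI)
  qed
  also have "\<dots> = ennreal (exp (- (t / 2)) / Z) * (\<integral>\<^sup>+b. ennreal (g b) \<partial>?P)"
    by (rule nn_integral_cmult[OF gm])
  also have "\<dots> \<le> ennreal (exp (- (t / 2)) / Z) * ennreal (sqrt 2 ^ k * Z)"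
    using gint by (intro mult_left_mono) auto
  also have "\<dots> \<le> ennreal (exp (- (t / 2)) * sqrt 2 ^ k)"
    using Z by (cases "Z = 0") (auto simp: ennreal_mult'[symmetric])
  finally show ?thesis .
qed

text \<open>On the box the kernel is at least exp (- q), the box has volume the product of the 2 r
  i, and dropping the truncation bounds the normaliser by the full Gaussian integral. The box also
  shows the normaliser to be positive, without which the prior would be zero by convention.\<close>

lemma beta_prior_box:
  assumes la: "\<And>i. i \<in> {1..k} \<Longrightarrow> 0 < la i" and r: "\<And>i. i \<in> {1..k} \<Longrightarrow> 0 < r i"
    and box: "\<And>b. (\<And>i. i \<in> {1..k} \<Longrightarrow> \<bar>b i - c i\<bar> \<le> r i) \<Longrightarrow>
      prior_form k la b \<le> q \<and> ereal (sqrt (\<Sum>i=1..k. la i * (b i)\<^sup>2)) \<le> R"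
  shows "ennreal (exp (- q) * (\<Prod>i=1..k. 2 * r i / sqrt (pi * la i)))
    \<le> (\<integral>\<^sup>+b. ennreal (beta_prior k la R b) * indicator (Pi\<^sub>E {1..k} (\<lambda>i. {c i - r i..c i + r i})) b
        \<partial>Pi\<^sub>M {1..k} (\<lambda>_. lborel))"
proof -
  let ?P = "Pi\<^sub>M {1..k} (\<lambda>_. lborel :: real measure)"
  let ?B = "Pi\<^sub>E {1..k} (\<lambda>i. {c i - r i..c i + r i})"
  interpret product_sigma_finite "\<lambda>_ :: nat. lborel :: real measure" by (rule
      product_sigma_finite_lborel)
  define Z where "Z = (\<integral>b. beta_kernel k la R b \<partial>?P)"
  have Zeq: "(\<integral>\<^sup>+b. ennreal (beta_kernel k la R b) \<partial>?P) = ennreal Z"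
    unfolding Z_def by (rule nn_integral_beta_kernel) (rule la)
  define W where "W = (\<Prod>i=1..k. sqrt (pi * la i))"
  define V where "V = (\<Prod>i=1..k. 2 * r i)"
  have W: "0 < W" unfolding W_def using la by (intro prod_pos) auto
  have V: "0 < V" unfolding V_def using r by (intro prod_pos) auto
  have B: "?B \<in> sets ?P" by (intro sets_PiM_I_finite) auto
  have emB: "emeasure ?P ?B = ennreal V"
  proof -
    have "emeasure ?P ?B = (\<Prod>i=1..k. ennreal (2 * r i))"
      using r by (subst emeasure_PiM) (auto intro!: prod.cong simp: less_imp_le)
    also have "\<dots> = ennreal V" unfolding V_def using r by (intro prod_ennreal) (auto simp: less_imp_le)
    finally show ?thesis .
  qed
  have low: "exp (- q) \<le> beta_kernel k la R b" if "b \<in> ?B" for b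
  proof -
    have "\<bar>b i - c i\<bar> \<le> r i" if "i \<in> {1..k}" for i
      using PiE_mem[OF \<open>b \<in> ?B\<close> that] by (simp add: abs_le_iff)
    from box[OF this] show ?thesis by (simp add: beta_kernel_eq)
  qed
  have "ennreal (exp (- q)) * ennreal V = (\<integral>\<^sup>+b. ennreal (exp (- q)) * indicator ?B b \<partial>?P)"
    using B by (simp add: nn_integral_cmult_indicator emB)
  also have "\<dots> \<le> (\<integral>\<^sup>+b. ennreal (beta_kernel k la R b) \<partial>?P)"
    using low by (intro nn_integral_mono) (auto simp: indicator_def intro!: ennreal_leI)
  also have "\<dots> = ennreal Z" by (rule Zeq)
  finally have "ennreal (exp (- q) * V) \<le> ennreal Z" by (simp add: ennreal_mult')
  moreover have "0 < exp (- q) * V" using V by simp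
  ultimately have Z: "0 < Z" by (metis ennreal_le_iff2 linorder_not_less order.strict_trans1)
  have ZW: "Z \<le> W"
  proof -
    have "(\<integral>\<^sup>+b. ennreal (beta_kernel k la R b) \<partial>?P) \<le> ennreal W"
      unfolding W_def by (rule nn_integral_beta_kernel_le) (rule la)
    then have "ennreal Z \<le> ennreal W" by (simp add: Zeq)
    then show ?thesis using W by (simp add: ennreal_le_iff2)
  qed
  have "exp (- q) * (\<Prod>i=1..k. 2 * r i / sqrt (pi * la i)) = exp (- q) / W * V"
    by (simp add: prod_dividef V_def W_def)
  then have "ennreal (exp (- q) * (\<Prod>i=1..k. 2 * r i / sqrt (pi * la i))) = ennreal (exp (- q) / W) *
      emeasure ?P ?B"
    using V W by (simp add: emB ennreal_mult'[symmetric])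
  also have "\<dots> = (\<integral>\<^sup>+b. ennreal (exp (- q) / W) * indicator ?B b \<partial>?P)"
    using B by (simp add: nn_integral_cmult_indicator)
  also have "\<dots> \<le> (\<integral>\<^sup>+b. ennreal (beta_prior k la R b) * indicator ?B b \<partial>?P)"
  proof (rule nn_integral_mono)
    fix b
    show "ennreal (exp (- q) / W) * indicator ?B b \<le> ennreal (beta_prior k la R b) * indicator ?B b"
    proof (cases "b \<in> ?B")
      case True
      have "exp (- q) / W \<le> exp (- q) / Z" using Z ZW by (intro divide_left_mono) auto
      also have "\<dots> \<le> beta_kernel k la R b / Z" using low[OF True] Z by (intro divide_right_mono) auto
      finally show ?thesis using True by (auto simp: beta_prior_def Z_def[symmetric] intro!:
          ennreal_leI)
    qed simp
  qed
  finally show ?thesis .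
qed

section \<open>Bounds for the unnormalised posterior\<close>

lemma k_prior_nonneg: "0 \<le> k_prior L U f k"
  unfolding k_prior_def by (intro divide_nonneg_nonneg sum_nonneg) auto

lemma k_prior_sum:
  assumes "L \<le> U"
  shows "(\<Sum>k=L..U. k_prior L U f k) = 1"
proof -
  have "0 < (\<Sum>k=L..U. exp (f k))" using assms by (intro sum_pos) auto
  then show ?thesis unfolding k_prior_def by (simp add: sum_divide_distrib[symmetric])
qed

text \<open>The hypothesis on the likelihood separates two kinds of parameters. Where the prior form
  is at most t, the likelihood is small relative to \<open>Lr\<close>. Elsewhere it may exceed
  \<open>Lr\<close> by exp E2, and the prior tail pays for this. The prior of k sums to one, so only
  the largest dimension U is left.\<close>

lemma post_mass_upper:
  assumes la: "\<And>i. i \<in> {1..U} \<Longrightarrow> 0 < la i" and LU: "L \<le> U" and xi: "0 < xi"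
    and CI: "(\<integral>\<^sup>+s. ennreal (inv_gauss_density eta xi s) * indicator {0<..} s \<partial>lborel) \<le> ennreal CI"
      "0 \<le> CI" and Lr: "0 \<le> Lr"
    and lik: "\<And>k b s2. k \<in> {L..U} \<Longrightarrow> 0 < s2 \<Longrightarrow> (T_embed p k v b, s2) \<in> B \<Longrightarrow>
      likelihood2 n p d (T_embed p k v b) s2
        \<le> Lr * (exp (- E1) + exp E2 * (if t < prior_form k la b then 1 else 0))"
  shows "post_mass n p R L U f eta xi la v d B
    \<le> ennreal (CI * Lr * (exp (- E1) + exp (E2 - t / 2) * sqrt 2 ^ U))"
proof -
  define H where "H = exp (- E1) + exp (E2 - t / 2) * sqrt 2 ^ U"
  have H: "0 \<le> H" unfolding H_def by simp
  let ?g = "inv_gauss_density eta xi"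
  have gm: "(\<lambda>s. ennreal (?g s) * indicator {0<..} s) \<in> borel_measurable lborel" by measurable
  have kterm: "(\<integral>\<^sup>+b. (\<integral>\<^sup>+s2\<in>{0<..}.
          ennreal (beta_prior k la R b * k_prior L U f k * inv_gauss_density eta xi s2 *
                   likelihood2 n p d (T_embed p k v b) s2) *
          indicator B (T_embed p k v b, s2) \<partial>lborel) \<partial>(Pi\<^sub>M {1..k} (\<lambda>_. lborel)))
      \<le> ennreal (k_prior L U f k) * ennreal (CI * Lr * H)" if k: "k \<in> {L..U}" for k
  proof -
    let ?P = "Pi\<^sub>M {1..k} (\<lambda>_. lborel :: real measure)"
    let ?I = "\<lambda>b. if t < prior_form k la b then 1 else (0::real)"
    have lak: "\<And>i. i \<in> {1..k} \<Longrightarrow> 0 < la i" using la k by auto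
    define J where "J = (\<lambda>b. ennreal (k_prior L U f k * Lr) *
      (ennreal (exp (- E1)) * ennreal (beta_prior k la R b)
       + ennreal (exp E2) * (ennreal (beta_prior k la R b) * indicator {b. t < prior_form k la b} b)))"
    have inner: "(\<integral>\<^sup>+s2\<in>{0<..}.
          ennreal (beta_prior k la R b * k_prior L U f k * ?g s2 *
                   likelihood2 n p d (T_embed p k v b) s2) *
          indicator B (T_embed p k v b, s2) \<partial>lborel) \<le> J b * ennreal CI" for b
    proof -
      have "(\<integral>\<^sup>+s2\<in>{0<..}.
          ennreal (beta_prior k la R b * k_prior L U f k * ?g s2 *
                   likelihood2 n p d (T_embed p k v b) s2) *
          indicator B (T_embed p k v b, s2) \<partial>lborel)
        \<le> (\<integral>\<^sup>+s2. J b * (ennreal (?g s2) * indicator {0<..} s2) \<partial>lborel)"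
      proof (rule nn_integral_mono)
        fix s2 :: real
        show "ennreal (beta_prior k la R b * k_prior L U f k * ?g s2 *
              likelihood2 n p d (T_embed p k v b) s2) *
              indicator B (T_embed p k v b, s2) * indicator {0<..} s2
            \<le> J b * (ennreal (?g s2) * indicator {0<..} s2)"
        proof (cases "0 < s2 \<and> (T_embed p k v b, s2) \<in> B")
          case True
          have g0: "0 \<le> ?g s2" using True xi by (auto intro: inv_gauss_density_nonneg)
          have "beta_prior k la R b * k_prior L U f k * ?g s2 * likelihood2 n p d (T_embed p k v b) s2
              \<le> beta_prior k la R b * k_prior L U f k * ?g s2 * (Lr * (exp (- E1) + exp E2 * ?I b))"
            using lik[OF k] True g0
            by (intro mult_left_mono mult_nonneg_nonneg beta_prior_nonneg k_prior_nonneg) auto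
          also have "\<dots> = (k_prior L U f k * Lr * (exp (- E1) * beta_prior k la R b + exp E2 *
              (beta_prior k la R b * ?I b))) * ?g s2"
            by (simp add: algebra_simps)
          also have "ennreal \<dots> = J b * ennreal (?g s2)"
            unfolding J_def using Lr g0
            by (auto simp: ennreal_mult' ennreal_plus beta_prior_nonneg k_prior_nonneg)
          finally have "ennreal (beta_prior k la R b * k_prior L U f k * ?g s2 *
              likelihood2 n p d (T_embed p k v b) s2) \<le> J b * ennreal (?g s2)"
            by (simp add: ennreal_leI)
          then show ?thesis using True by simp
        qed auto
      qed
      also have "\<dots> = J b * (\<integral>\<^sup>+s2. ennreal (?g s2) * indicator {0<..} s2 \<partial>lborel)"
        by (rule nn_integral_cmult[OF gm])
      also have "\<dots> \<le> J b * ennreal CI" by (intro mult_left_mono CI) auto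
      finally show ?thesis .
    qed
    have prior1: "(\<integral>\<^sup>+b. ennreal (beta_prior k la R b) \<partial>?P) \<le> 1"
      by (rule nn_integral_beta_prior_le_1) (rule lak)
    have prior2: "(\<integral>\<^sup>+b. ennreal (beta_prior k la R b) * indicator {b. t < prior_form k la b} b \<partial>?P)
        \<le> ennreal (exp (- (t / 2)) * sqrt 2 ^ k)"
      by (rule beta_prior_tail) (rule lak)
    have im: "(\<lambda>b. ennreal (beta_prior k la R b) * indicator {b. t < prior_form k la b} b) \<in>
        borel_measurable ?P"
    proof -
      have "(\<lambda>b. ennreal (beta_prior k la R b) * (if t < prior_form k la b then 1 else 0)) \<in>
          borel_measurable ?P"
        by measurable
      then show ?thesis by (simp add: indicator_def)
    qed
    have JCI: "(\<integral>\<^sup>+b. J b * ennreal CI \<partial>?P) = (\<integral>\<^sup>+b. J b \<partial>?P) * ennreal CI"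
      unfolding J_def using im by (intro nn_integral_multc) measurable
    have "(\<integral>\<^sup>+b. J b \<partial>?P) = ennreal (k_prior L U f k * Lr) *
        (ennreal (exp (- E1)) * (\<integral>\<^sup>+b. ennreal (beta_prior k la R b) \<partial>?P)
         + ennreal (exp E2) * (\<integral>\<^sup>+b. ennreal (beta_prior k la R b) * indicator {b. t < prior_form k
             la b} b \<partial>?P))"
      unfolding J_def using im by (simp add: nn_integral_cmult nn_integral_add)
    also have "\<dots> \<le> ennreal (k_prior L U f k * Lr) *
        (ennreal (exp (- E1)) * 1 + ennreal (exp E2) * ennreal (exp (- (t / 2)) * sqrt 2 ^ k))"
      by (intro mult_left_mono add_mono prior1 prior2) auto
    also have "\<dots> \<le> ennreal (k_prior L U f k * Lr * H)"
    proof -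
      have "sqrt 2 ^ k \<le> sqrt 2 ^ U" using k by (intro power_increasing) auto
      then have "exp (- E1) + exp E2 * (exp (- (t / 2)) * sqrt 2 ^ k) \<le> H"
      proof -
        have "exp (E2 - t / 2) = exp E2 * exp (- (t / 2))" by (simp flip: exp_add)
        then show ?thesis unfolding H_def using \<open>sqrt 2 ^ k \<le> sqrt 2 ^ U\<close> by (simp add: mult_left_mono)
      qed
      then have "k_prior L U f k * Lr * (exp (- E1) + exp E2 * (exp (- (t / 2)) * sqrt 2 ^ k)) \<le>
          k_prior L U f k * Lr * H"
        using Lr by (intro mult_left_mono mult_nonneg_nonneg k_prior_nonneg) auto
      then have "ennreal (k_prior L U f k * Lr * (exp (- E1) + exp E2 * (exp (- (t / 2)) * sqrt 2 ^
          k))) \<le> ennreal (k_prior L U f k * Lr * H)"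
        by (rule ennreal_leI)
      then show ?thesis
        using Lr by (simp add: ennreal_mult' ennreal_plus k_prior_nonneg)
    qed
    finally have "(\<integral>\<^sup>+b. J b * ennreal CI \<partial>?P) \<le> ennreal (k_prior L U f k * Lr * H) * ennreal CI"
      unfolding JCI by (rule mult_right_mono) simp
    also have "\<dots> = ennreal (k_prior L U f k) * ennreal (CI * Lr * H)"
      using Lr H CI by (simp add: ennreal_mult'[symmetric] k_prior_nonneg ac_simps)
    finally show ?thesis using inner nn_integral_mono[of ?P _ "\<lambda>b. J b * ennreal CI"]
      by (meson order_trans)
  qed
  have "post_mass n p R L U f eta xi la v d B \<le> (\<Sum>k=L..U. ennreal (k_prior L U f k) * ennreal (CI *
      Lr * H))"
    unfolding post_mass_def by (intro sum_mono kterm)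
  also have "\<dots> = ennreal (CI * Lr * H)"
    by (simp add: sum_distrib_right[symmetric] sum_ennreal k_prior_nonneg k_prior_sum[OF LU])
  finally show ?thesis by (simp add: H_def)
qed

lemma post_mass_lower:
  assumes LU: "L \<le> U" and xi: "0 < xi"
    and A: "A \<in> sets (Pi\<^sub>M {1..L} (\<lambda>_. lborel))"
    and mass: "ennreal q \<le> (\<integral>\<^sup>+b. ennreal (beta_prior L la R b) * indicator A b \<partial>Pi\<^sub>M {1..L} (\<lambda>_.
        lborel))"
    and j: "0 < j0" "j0 \<le> j1" and g: "\<And>s. s \<in> {j0..j1} \<Longrightarrow> g0 \<le> inv_gauss_density eta xi s"
    and nn: "0 \<le> q" "0 \<le> g0" "0 \<le> Lr"
    and lik: "\<And>b s2. b \<in> A \<Longrightarrow> s2 \<in> {j0..j1} \<Longrightarrow> Lr \<le> likelihood2 n p d (T_embed p L v b) s2"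
  shows "ennreal (k_prior L U f L * q * g0 * (j1 - j0) * Lr) \<le> post_mass n p R L U f eta xi la v d UNIV"
proof -
  let ?P = "Pi\<^sub>M {1..L} (\<lambda>_. lborel :: real measure)"
  define c where "c = k_prior L U f L * g0 * Lr"
  have c: "0 \<le> c" unfolding c_def using nn by (intro mult_nonneg_nonneg k_prior_nonneg) auto
  define F where "F = (\<lambda>k. \<integral>\<^sup>+b. (\<integral>\<^sup>+s2\<in>{0<..}.
          ennreal (beta_prior k la R b * k_prior L U f k * inv_gauss_density eta xi s2 *
                   likelihood2 n p d (T_embed p k v b) s2) *
          indicator UNIV (T_embed p k v b, s2) \<partial>lborel) \<partial>(Pi\<^sub>M {1..k} (\<lambda>_. lborel)))"
  have inner: "ennreal (beta_prior L la R b) * indicator A b * ennreal (c * (j1 - j0)) \<le>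
      (\<integral>\<^sup>+s2\<in>{0<..}. ennreal (beta_prior L la R b * k_prior L U f L * inv_gauss_density eta xi s2 *
                   likelihood2 n p d (T_embed p L v b) s2) *
          indicator UNIV (T_embed p L v b, s2) \<partial>lborel)" for b
  proof (cases "b \<in> A")
    case True
    have "ennreal (beta_prior L la R b) * indicator A b * ennreal (c * (j1 - j0))
        = ennreal (beta_prior L la R b * c) * emeasure lborel {j0..j1}"
      using True c j by (simp add: ennreal_mult' beta_prior_nonneg mult.assoc)
    also have "\<dots> = (\<integral>\<^sup>+s2. ennreal (beta_prior L la R b * c) * indicator {j0..j1} s2 \<partial>lborel)"
      by (rule nn_integral_cmult_indicator[symmetric]) simp
    also have "\<dots> \<le> (\<integral>\<^sup>+s2\<in>{0<..}. ennreal (beta_prior L la R b * k_prior L U f L * inv_gauss_density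
        eta xi s2 *
                   likelihood2 n p d (T_embed p L v b) s2) *
          indicator UNIV (T_embed p L v b, s2) \<partial>lborel)"
    proof (rule nn_integral_mono)
      fix s2 :: real
      have "beta_prior L la R b * c \<le> beta_prior L la R b * k_prior L U f L * inv_gauss_density eta
          xi s2 *
          likelihood2 n p d (T_embed p L v b) s2" if s: "s2 \<in> {j0..j1}"
      proof -
        have "g0 * Lr \<le> inv_gauss_density eta xi s2 * likelihood2 n p d (T_embed p L v b) s2"
          using g[OF s] lik[OF True s] nn by (intro mult_mono) auto
        then have "(beta_prior L la R b * k_prior L U f L) * (g0 * Lr)
          \<le> (beta_prior L la R b * k_prior L U f L) * (inv_gauss_density eta xi s2 * likelihood2 n p
              d (T_embed p L v b) s2)"
          by (intro mult_left_mono mult_nonneg_nonneg beta_prior_nonneg k_prior_nonneg)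
        then show ?thesis by (simp add: c_def mult.assoc)
      qed
      then show "ennreal (beta_prior L la R b * c) * indicator {j0..j1} s2
        \<le> ennreal (beta_prior L la R b * k_prior L U f L * inv_gauss_density eta xi s2 *
              likelihood2 n p d (T_embed p L v b) s2) *
          indicator UNIV (T_embed p L v b, s2) * indicator {0<..} s2"
        using j by (auto simp: indicator_def intro!: ennreal_leI)
    qed
    finally show ?thesis .
  qed simp
  have "ennreal (k_prior L U f L * q * g0 * (j1 - j0) * Lr) = ennreal q * ennreal (c * (j1 - j0))"
    using c j nn by (simp add: ennreal_mult'[symmetric] c_def ac_simps)
  also have "\<dots> \<le> (\<integral>\<^sup>+b. ennreal (beta_prior L la R b) * indicator A b \<partial>?P) * ennreal (c * (j1 - j0))"
    by (intro mult_right_mono mass) simp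
  also have "\<dots> = (\<integral>\<^sup>+b. ennreal (beta_prior L la R b) * indicator A b * ennreal (c * (j1 - j0)) \<partial>?P)"
    by (intro nn_integral_multc[symmetric] borel_measurable_times_ennreal borel_measurable_indicator A)
      measurable
  also have "\<dots> \<le> F L" unfolding F_def by (intro nn_integral_mono inner)
  also have "\<dots> \<le> (\<Sum>k=L..U. F k)" using LU by (intro member_le_sum) auto
  also have "\<dots> = post_mass n p R L U f eta xi la v d UNIV" unfolding post_mass_def F_def ..
  finally show ?thesis .
qed

lemma posterior_le:
  assumes "post_mass n p R L U f eta xi la v d B \<le> ennreal x"
    and "ennreal y \<le> post_mass n p R L U f eta xi la v d UNIV" and "0 \<le> x" "0 < y"
  shows "posterior n p R L U f eta xi la v d B \<le> x / y"
proof -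
  have "post_mass n p R L U f eta xi la v d B / post_mass n p R L U f eta xi la v d UNIV \<le> ennreal x
      / ennreal y"
  proof (rule divide_le_posI_ennreal)
    show "0 < post_mass n p R L U f eta xi la v d UNIV"
      using assms(2,4) by (meson ennreal_less_zero_iff order.strict_trans2)
    have "ennreal x = ennreal y * (ennreal x / ennreal y)"
      using assms(3,4) by (simp add: divide_ennreal ennreal_mult'[symmetric])
    also have "\<dots> \<le> post_mass n p R L U f eta xi la v d UNIV * (ennreal x / ennreal y)"
      by (intro mult_right_mono assms) simp
    finally show "post_mass n p R L U f eta xi la v d B \<le> post_mass n p R L U f eta xi la v d UNIV *
        (ennreal x / ennreal y)"
      using assms(1) by (rule order_trans[rotated])
  qed
  also have "\<dots> = ennreal (x / y)" using assms by (simp add: divide_ennreal)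
  finally show ?thesis unfolding posterior_def
    using assms enn2real_mono[of _ "ennreal (x / y)"] by simp
qed

section \<open>Geometry of the split sample\<close>

lemma square_sum3: "(x + y - z)\<^sup>2 \<le> 3 * (x\<^sup>2 + y\<^sup>2 + z\<^sup>2)" for x y z :: real
proof -
  have "0 \<le> (x - y)\<^sup>2 + (x + z)\<^sup>2 + (y + z)\<^sup>2" by simp
  then show ?thesis by (simp add: power2_eq_square algebra_simps)
qed

lemma square_sum2: "(x - z)\<^sup>2 \<le> 2 * (x\<^sup>2 + z\<^sup>2)" for x z :: real
proof -
  have "0 \<le> (x + z)\<^sup>2" by simp
  then show ?thesis by (simp add: power2_eq_square algebra_simps)
qed

text \<open>\<open>S\<close>, \<open>lam\<close>, \<open>w\<close> are the population covariance and its eigensystem, \<open>S1\<close>, \<open>la\<close>, \<open>v\<close> those of the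
  first half of the sample.\<close>

locale half_geometry =
  fixes n p L U :: nat and S S1 :: rmat and lam la :: rvec and w v :: "nat \<Rightarrow> rvec"
    and theta bstar :: rvec and eps delta K :: real
  defines "bstar \<equiv> \<lambda>l. theta l - (\<Sum>i=1..L. dotp p theta (v i) * v i l)"
  assumes n: "1 \<le> n" and LU: "1 \<le> L" "L \<le> U" "U < p"
    and esS: "eigensystem p S lam w" and lam_nonneg: "\<And>i. i \<in> {1..p} \<Longrightarrow> 0 \<le> lam i"
    and lam_K: "\<And>i. i \<in> {1..p} \<Longrightarrow> lam i \<le> K" and K: "1 \<le> K"
    and es1: "eigensystem p S1 la v" and la_U: "0 < la U"
    and S1_nonneg: "\<And>u. 0 \<le> quad_form p S1 u"
    and close1: "\<And>u. \<bar>quad_form p S1 u - quad_form p S u\<bar> \<le> delta * dotp p u u"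
    and delta: "0 \<le> delta" "8 * delta \<le> lam (L + 1)"
    and lam_sq: "real n * (lam (L + 1))\<^sup>2 \<le> 1"
    and theta_tail: "4 * dotp p theta theta * lam (L + 1) \<le> eps\<^sup>2"
    and U_eps: "real U \<le> real n * eps\<^sup>2"
begin

lemma on: "i \<in> {1..p} \<Longrightarrow> j \<in> {1..p} \<Longrightarrow> dotp p (v i) (v j) = (if i = j then 1 else 0)"
  by (rule eigensystem_orthonormal[OF es1])

lemma la_pos: "i \<in> {1..U} \<Longrightarrow> 0 < la i"
  using eigensystem_mono[OF es1, of i U] la_U LU by auto

lemma lam_tail_nonneg: "0 \<le> lam (L + 1)"
  using lam_nonneg LU by auto

lemma la_le: "i \<in> {1..p} \<Longrightarrow> la i \<le> lam i + delta"
  using close1 by (intro Weyl_inequality[OF es1 esS]) (auto simp: abs_le_iff algebra_simps)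

lemma lam_le: "i \<in> {1..p} \<Longrightarrow> lam i \<le> la i + delta"
  using close1 by (intro Weyl_inequality[OF esS es1]) (auto simp: abs_le_iff algebra_simps)

lemma la_tail: assumes "i \<in> {L+1..p}" shows "la i \<le> 9 / 8 * lam (L + 1)"
proof -
  have "la i \<le> la (L + 1)" by (rule eigensystem_mono[OF es1]) (use assms in auto)
  also have "\<dots> \<le> lam (L + 1) + delta" by (rule la_le) (use LU in auto)
  finally show ?thesis using delta by linarith
qed

lemma delta_le_lam: assumes "i \<in> {1..L}" shows "8 * delta \<le> lam i"
proof -
  have "lam (L + 1) \<le> lam i" by (rule eigensystem_mono[OF esS]) (use assms LU in auto)
  then show ?thesis using delta by linarith
qed

text \<open>On the leading directions the eigenvalues are at least lam (L + 1) \<ge> 8 delta, so the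
  additive error delta is a relative one there. Nothing similar holds beyond L, which is why head
  and tail are treated apart.\<close>

lemma la_head: assumes "i \<in> {1..L}" shows "7 / 8 * lam i \<le> la i"
  using lam_le[of i] delta_le_lam[OF assms] assms LU by auto

lemma delta_K: "8 * delta \<le> K"
  using delta lam_K[of "L + 1"] LU by auto

lemma la_K: "i \<in> {1..p} \<Longrightarrow> la i \<le> 9 / 8 * K"
  using la_le[of i] lam_K[of i] delta_K by auto

lemma norm_coords: "dotp p u u = (\<Sum>i=1..p. (dotp p u (v i))\<^sup>2)"
  unfolding power2_eq_square by (rule orthonormal_Parseval) (rule on)

lemma span_coord:
  assumes "I \<subseteq> {1..p}" "j \<in> {1..p}"
  shows "dotp p (\<lambda>l. \<Sum>i\<in>I. c i * v i l) (v j) = (if j \<in> I then c j else 0)"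
proof -
  have "finite I" using assms(1) finite_subset by blast
  have "dotp p (\<lambda>l. \<Sum>i\<in>I. c i * v i l) (v j) = (\<Sum>i\<in>I. if i = j then c i else 0)"
    unfolding dotp_sum_left by (intro sum.cong) (use assms in \<open>auto simp: on\<close>)
  then show ?thesis using \<open>finite I\<close> by simp
qed

lemma span_norm:
  assumes "I \<subseteq> {1..p}"
  shows "dotp p (\<lambda>l. \<Sum>i\<in>I. c i * v i l) (\<lambda>l. \<Sum>i\<in>I. c i * v i l) = (\<Sum>i\<in>I. (c i)\<^sup>2)"
proof -
  have "dotp p (\<lambda>l. \<Sum>i\<in>I. c i * v i l) (\<lambda>l. \<Sum>i\<in>I. c i * v i l) = (\<Sum>j=1..p. if j \<in> I then (c j)\<^sup>2 else 0)"
    unfolding norm_coords[of "\<lambda>l. \<Sum>i\<in>I. c i * v i l"]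
    by (intro sum.cong refl) (simp add: span_coord[OF assms])
  also have "\<dots> = (\<Sum>j\<in>I. (c j)\<^sup>2)"
    using assms by (simp add: sum.inter_restrict[symmetric] Int_absorb1)
  finally show ?thesis .
qed

lemma quad_S_nonneg: "0 \<le> quad_form p S u"
  unfolding eigensystem_quad_form[OF esS] by (intro sum_nonneg mult_nonneg_nonneg) (auto simp:
      lam_nonneg)

lemma quad_S_le_K: "quad_form p S u \<le> K * dotp p u u"
proof -
  have "dotp p u u = (\<Sum>i=1..p. (dotp p u (w i))\<^sup>2)"
    unfolding power2_eq_square by (rule orthonormal_Parseval) (rule eigensystem_orthonormal[OF esS])
  then show ?thesis unfolding eigensystem_quad_form[OF esS]
    by (auto simp: sum_distrib_left lam_K intro!: sum_mono mult_right_mono)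
qed

lemma quad_S_3:
  assumes "\<And>l. l \<in> {1..p} \<Longrightarrow> h l = a l + b l - c l"
  shows "quad_form p S h \<le> 3 * (quad_form p S a + quad_form p S b + quad_form p S c)"
proof -
  have "dotp p h x = dotp p a x + dotp p b x - dotp p c x" for x
  proof -
    have "dotp p h x = dotp p (\<lambda>l. (a l + b l) - c l) x" by (rule dotp_cong) (use assms in auto)
    then show ?thesis by (simp add: dotp_diff_left dotp_add_left)
  qed
  then have "quad_form p S h = (\<Sum>i=1..p. lam i * (dotp p a (w i) + dotp p b (w i) - dotp p c (w i))\<^sup>2)"
    unfolding eigensystem_quad_form[OF esS] by simp
  also have "\<dots> \<le> (\<Sum>i=1..p. lam i * (3 * ((dotp p a (w i))\<^sup>2 + (dotp p b (w i))\<^sup>2 + (dotp p c (w i))\<^sup>2)))"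
    by (intro sum_mono mult_left_mono square_sum3) (auto simp: lam_nonneg)
  also have "\<dots> = 3 * (quad_form p S a + quad_form p S b + quad_form p S c)"
    unfolding eigensystem_quad_form[OF esS]
    by (simp add: sum_distrib_left sum.distrib[symmetric] algebra_simps)
  finally show ?thesis .
qed

text \<open>Orthogonality refers to the sample eigenvectors, the form to the population: 9/8 comes
  from the sample eigenvalues beyond L and 1/8 from exchanging the two covariances.\<close>

lemma quad_S_tail:
  assumes "\<And>i. i \<in> {1..L} \<Longrightarrow> dotp p u (v i) = 0"
  shows "quad_form p S u \<le> 10 / 8 * lam (L + 1) * dotp p u u"
proof -
  have "quad_form p S1 u \<le> 9 / 8 * lam (L + 1) * dotp p u u"
    unfolding eigensystem_quad_form[OF es1] norm_coords[of u] sum_distrib_left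
  proof (rule sum_mono)
    fix i assume i: "i \<in> {1..p}"
    show "la i * (dotp p u (v i))\<^sup>2 \<le> 9 / 8 * lam (L + 1) * (dotp p u (v i))\<^sup>2"
    proof (cases "i \<le> L")
      case False
      with la_tail[of i] i show ?thesis by (intro mult_right_mono) auto
    qed (use i assms in auto)
  qed
  moreover have "delta * dotp p u u \<le> 1 / 8 * lam (L + 1) * dotp p u u"
    using delta by (intro mult_right_mono dotp_self_nonneg) auto
  ultimately show ?thesis using close1[of u] by (simp add: abs_le_iff algebra_simps)
qed

text \<open>\<open>bstar\<close> is the part of the true parameter outside the span of the first L
  sample eigenvectors, hence out of reach of every candidate with k = L. It is the bias of the model
  and has to be small in both norms.\<close>

lemma bstar_coord: "j \<in> {1..p} \<Longrightarrow> dotp p bstar (v j) = (if j \<le> L then 0 else dotp p theta (v j))"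
  unfolding bstar_def dotp_diff_left using LU by (subst span_coord) auto

lemma bstar_norm: "dotp p bstar bstar \<le> dotp p theta theta"
  unfolding norm_coords[of bstar] norm_coords[of theta]
  by (intro sum_mono) (simp add: bstar_coord)

lemma bstar_small: "lam (L + 1) * dotp p bstar bstar \<le> eps\<^sup>2 / 4"
proof -
  have "lam (L + 1) * dotp p bstar bstar \<le> lam (L + 1) * dotp p theta theta"
    by (intro mult_left_mono bstar_norm lam_tail_nonneg)
  then show ?thesis using theta_tail by (simp add: algebra_simps)
qed

lemma quad_S_bstar: "quad_form p S bstar \<le> eps\<^sup>2"
proof -
  have "quad_form p S bstar \<le> 10 / 8 * lam (L + 1) * dotp p bstar bstar"
    by (rule quad_S_tail) (use LU in \<open>auto simp: bstar_coord\<close>)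
  moreover have "0 \<le> eps\<^sup>2" by simp
  ultimately show ?thesis using bstar_small by linarith
qed

end

text \<open>\<open>X i\<close> are the covariates of the second half. The last three assumptions control their mean:
  \<open>close2\<close> is about the centred covariance, whereas the likelihood involves the uncentred one.\<close>

locale split_geometry = half_geometry n p L U S S1 lam la w v theta bstar eps delta K
  for n p L U :: nat and S S1 :: rmat and lam la :: rvec and w v :: "nat \<Rightarrow> rvec"
    and theta bstar :: rvec and eps delta K :: real +
  fixes X :: "nat \<Rightarrow> rvec" and xbar :: rvec and NN :: "rvec \<Rightarrow> real"
  defines "xbar \<equiv> \<lambda>j. 2 / real n * (\<Sum>i=n div 2 + 1..n. X i j)"
    and "NN \<equiv> \<lambda>u. 2 / real n * (\<Sum>i=n div 2 + 1..n. (dotp p (X i) u)\<^sup>2)"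
  assumes close2: "\<And>u. \<bar>NN u - (dotp p xbar u)\<^sup>2 - quad_form p S u\<bar> \<le> delta * dotp p u u"
    and mean_bstar: "(dotp p xbar bstar)\<^sup>2 \<le> eps\<^sup>2"
    and mean_head: "(\<Sum>i=1..L. la i * (dotp p xbar (v i))\<^sup>2) \<le> real n"
    and mean_tail: "(\<Sum>i=L+1..U. la i * (dotp p xbar (v i))\<^sup>2) \<le> 1 / real n"
begin

lemma NN_nonneg: "0 \<le> NN u"
  unfolding NN_def by (intro mult_nonneg_nonneg sum_nonneg) auto

lemma NN_cong: "(\<And>l. l \<in> {1..p} \<Longrightarrow> h l = a l) \<Longrightarrow> NN h = NN a"
  unfolding NN_def by (intro arg_cong2[where f="(*)"] sum.cong refl arg_cong[where f="\<lambda>x. x\<^sup>2"]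
      dotp_cong) auto

lemma NN_3:
  assumes "\<And>l. l \<in> {1..p} \<Longrightarrow> a l = h l + c l - b l"
  shows "NN a \<le> 3 * (NN h + NN c + NN b)"
proof -
  have "NN a = NN (\<lambda>l. (h l + c l) - b l)" by (rule NN_cong) (use assms in auto)
  also have "\<dots> \<le> 2 / real n * (\<Sum>i=n div 2 + 1..n. 3 * ((dotp p (X i) h)\<^sup>2 + (dotp p (X i) c)\<^sup>2 + (dotp
      p (X i) b)\<^sup>2))"
    unfolding NN_def dotp_diff_right dotp_add_right by (intro mult_left_mono sum_mono square_sum3) auto
  also have "\<dots> = 3 * (NN h + NN c + NN b)"
    unfolding NN_def sum_distrib_left[symmetric] sum.distrib by (simp add: algebra_simps)
  finally show ?thesis .
qed

lemma NN_2:
  assumes "\<And>l. l \<in> {1..p} \<Longrightarrow> a l = h l - b l"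
  shows "NN a \<le> 2 * (NN h + NN b)"
proof -
  have "NN a = NN (\<lambda>l. h l - b l)" by (rule NN_cong) (use assms in auto)
  also have "\<dots> \<le> 2 / real n * (\<Sum>i=n div 2 + 1..n. 2 * ((dotp p (X i) h)\<^sup>2 + (dotp p (X i) b)\<^sup>2))"
    unfolding NN_def dotp_diff_right by (intro mult_left_mono sum_mono square_sum2) auto
  also have "\<dots> = 2 * (NN h + NN b)"
    unfolding NN_def sum_distrib_left[symmetric] sum.distrib by (simp add: algebra_simps)
  finally show ?thesis .
qed

lemma NN_le: "NN u \<le> quad_form p S u + delta * dotp p u u + (dotp p xbar u)\<^sup>2"
  using close2[of u] by (simp add: abs_le_iff)

lemma NN_tail:
  assumes "\<And>i. i \<in> {1..L} \<Longrightarrow> dotp p u (v i) = 0"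
  shows "NN u \<le> 11 / 8 * lam (L + 1) * dotp p u u + (dotp p xbar u)\<^sup>2"
proof -
  have "delta * dotp p u u \<le> 1 / 8 * lam (L + 1) * dotp p u u"
    using delta by (intro mult_right_mono dotp_self_nonneg) auto
  then show ?thesis using NN_le[of u] quad_S_tail[OF assms] by (simp add: algebra_simps)
qed

text \<open>On the leading directions the sample eigenvalues are at least 7 delta, so delta |u|^2 is
  at most a sixth of the population form and can be absorbed. The mean can only increase
  \<open>NN\<close>, hence it helps in this direction.\<close>

lemma quad_S_head:
  assumes "\<And>i. i \<in> {L+1..p} \<Longrightarrow> dotp p u (v i) = 0"
  shows "quad_form p S u \<le> 2 * NN u"
proof -
  have "7 * delta * dotp p u u \<le> quad_form p S1 u"
    unfolding eigensystem_quad_form[OF es1] norm_coords[of u] sum_distrib_left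
  proof (rule sum_mono)
    fix i assume i: "i \<in> {1..p}"
    show "7 * delta * (dotp p u (v i))\<^sup>2 \<le> la i * (dotp p u (v i))\<^sup>2"
    proof (cases "i \<le> L")
      case True
      with la_head[of i] delta_le_lam[of i] i show ?thesis by (intro mult_right_mono) auto
    qed (use i assms in auto)
  qed
  then have "6 * (delta * dotp p u u) \<le> quad_form p S u"
    using close1[of u] by (simp add: abs_le_iff)
  moreover have "quad_form p S u \<le> NN u + delta * dotp p u u"
    using close2[of u] zero_le_power2[of "dotp p xbar u"] unfolding abs_le_iff by linarith
  moreover have "0 \<le> delta * dotp p u u" using delta dotp_self_nonneg by simp
  ultimately show ?thesis using NN_nonneg[of u] by linarith
qed

lemma NN_bstar: "NN bstar \<le> 2 * eps\<^sup>2"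
proof -
  have "NN bstar \<le> 11 / 8 * lam (L + 1) * dotp p bstar bstar + (dotp p xbar bstar)\<^sup>2"
    by (rule NN_tail) (use LU in \<open>auto simp: bstar_coord\<close>)
  moreover have "0 \<le> eps\<^sup>2" by simp
  ultimately show ?thesis using bstar_small mean_bstar by linarith
qed

text \<open>Cauchy--Schwarz in the metric given by the prior precision.\<close>

lemma mean_span_le:
  assumes I: "I \<subseteq> {1..U}"
  shows "(dotp p xbar (\<lambda>l. \<Sum>i\<in>I. c i * v i l))\<^sup>2
    \<le> (\<Sum>i\<in>I. (c i)\<^sup>2 / la i) * (\<Sum>i\<in>I. la i * (dotp p xbar (v i))\<^sup>2)"
proof -
  have pos: "0 < la i" if "i \<in> I" for i using la_pos that I by auto
  have "dotp p xbar (\<lambda>l. \<Sum>i\<in>I. c i * v i l) = (\<Sum>i\<in>I. (c i / sqrt (la i)) * (sqrt (la i) * dotp p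
      xbar (v i)))"
    unfolding dotp_sum_right using pos by (intro sum.cong refl) (auto simp: less_imp_neq[symmetric])
  also have "\<dots>\<^sup>2 \<le> (\<Sum>i\<in>I. (c i / sqrt (la i))\<^sup>2) * (\<Sum>i\<in>I. (sqrt (la i) * dotp p xbar (v i))\<^sup>2)"
    by (rule Cauchy_Schwarz_ineq_sum)
  also have "\<dots> = (\<Sum>i\<in>I. (c i)\<^sup>2 / la i) * (\<Sum>i\<in>I. la i * (dotp p xbar (v i))\<^sup>2)"
    using pos by (intro arg_cong2[where f="(*)"] sum.cong refl)
      (auto simp: power_divide power_mult_distrib less_imp_le)
  finally show ?thesis .
qed

text \<open>The three parts are controlled by different means: the error in the first L coordinates
  by the likelihood, the candidate's own tail by the prior, and \<open>bstar\<close> by the rate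
  conditions.\<close>

lemma T_embed_decomp:
  assumes k: "k \<in> {L..U}" and l: "l \<in> {1..p}"
  shows "T_embed p k v b l - theta l
    = (\<Sum>i=1..L. (b i - dotp p theta (v i)) * v i l) + (\<Sum>i=L+1..k. b i * v i l) - bstar l"
proof -
  have "{1..k} = {1..L} \<union> {L+1..k}" using k by auto
  then have "(\<Sum>i=1..k. b i * v i l) = (\<Sum>i=1..L. b i * v i l) + (\<Sum>i=L+1..k. b i * v i l)"
    by (simp add: sum.union_disjoint ivl_disj_int)
  then show ?thesis using l
    by (simp add: T_embed_def bstar_def left_diff_distrib sum_subtractf)
qed

text \<open>The likelihood controls \<open>NN\<close> of the whole error, but the two norms are
  comparable only on the leading directions. So the tail \<open>c\<close> and \<open>bstar\<close>
  are first removed in the empirical norm, the head \<open>a\<close> is transferred by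
  \<open>quad_S_head\<close>, and all parts are added up again in the population norm.\<close>

lemma population_norm_bound:
  assumes k: "k \<in> {L..U}" and pf: "prior_form k la b \<le> C * (real n * eps\<^sup>2)" and C: "0 \<le> C"
    and NNh: "NN (\<lambda>l. T_embed p k v b l - theta l) \<le> B * eps\<^sup>2"
  shows "quad_form p S (\<lambda>l. T_embed p k v b l - theta l) \<le> (18 * B + 60 * C + 39) * eps\<^sup>2"
proof -
  define h where "h = (\<lambda>l. T_embed p k v b l - theta l)"
  define a where "a = (\<lambda>l. \<Sum>i=1..L. (b i - dotp p theta (v i)) * v i l)"
  define c where "c = (\<lambda>l. \<Sum>i=L+1..k. b i * v i l)"
  define x where "x = lam (L + 1)"
  have dec: "h l = a l + c l - bstar l" if "l \<in> {1..p}" for l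
    using T_embed_decomp[OF k that] by (simp add: h_def a_def c_def)
  have sub: "{L+1..k} \<subseteq> {1..p}" "{L+1..k} \<subseteq> {1..U}" "{1..L} \<subseteq> {1..p}" using k LU by auto
  have pfc: "(\<Sum>i=L+1..k. (b i)\<^sup>2 / la i) \<le> C * (real n * eps\<^sup>2)"
  proof -
    have "(\<Sum>i=L+1..k. (b i)\<^sup>2 / la i) \<le> prior_form k la b"
      unfolding prior_form_def using k la_pos by (intro sum_mono2) (auto simp: less_imp_le)
    with pf show ?thesis by simp
  qed
  have normc: "dotp p c c \<le> 9 / 8 * x * (C * (real n * eps\<^sup>2))"
  proof -
    have "dotp p c c = (\<Sum>i=L+1..k. la i * ((b i)\<^sup>2 / la i))"
      unfolding c_def span_norm[OF sub(1)] using la_pos sub(2) by (intro sum.cong refl) (auto simp: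
          less_imp_neq[symmetric] subset_eq)
    also have "\<dots> \<le> (\<Sum>i=L+1..k. 9 / 8 * x * ((b i)\<^sup>2 / la i))"
      using la_pos la_tail sub k LU by (intro sum_mono mult_right_mono) (auto simp: x_def less_imp_le)
    also have "\<dots> = 9 / 8 * x * (\<Sum>i=L+1..k. (b i)\<^sup>2 / la i)" by (simp add: sum_distrib_left)
    also have "\<dots> \<le> 9 / 8 * x * (C * (real n * eps\<^sup>2))"
      using pfc lam_tail_nonneg by (intro mult_left_mono) (auto simp: x_def)
    finally show ?thesis .
  qed
  \<comment> \<open>One factor lam (L + 1) comes from the prior precision in \<open>normc\<close>,
    the second from the covariance on the tail; their product is compensated by n * lam (L + 1)^2
    \<le> 1.\<close>
  have xc: "x * dotp p c c \<le> 9 / 8 * (C * eps\<^sup>2)"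
  proof -
    have "x * dotp p c c \<le> x * (9 / 8 * x * (C * (real n * eps\<^sup>2)))"
      using normc lam_tail_nonneg by (intro mult_left_mono) (auto simp: x_def)
    also have "\<dots> = 9 / 8 * (C * eps\<^sup>2) * (real n * x\<^sup>2)" by (simp add: power2_eq_square)
    also have "\<dots> \<le> 9 / 8 * (C * eps\<^sup>2) * 1"
      using lam_sq C by (intro mult_left_mono) (auto simp: x_def)
    finally show ?thesis by simp
  qed
  have c0: "dotp p c (v i) = 0" if "i \<in> {1..L}" for i
    unfolding c_def using that LU by (subst span_coord[OF sub(1)]) auto
  have a0: "dotp p a (v i) = 0" if "i \<in> {L+1..p}" for i
    unfolding a_def using that LU by (subst span_coord[OF sub(3)]) auto
  have Ce: "0 \<le> C * eps\<^sup>2" using C by simp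
  have Sc: "quad_form p S c \<le> 2 * (C * eps\<^sup>2)"
    using quad_S_tail[OF c0] xc Ce by (simp add: x_def)
  have mc: "(dotp p xbar c)\<^sup>2 \<le> C * eps\<^sup>2"
  proof -
    have "(dotp p xbar c)\<^sup>2 \<le> (\<Sum>i=L+1..k. (b i)\<^sup>2 / la i) * (\<Sum>i=L+1..k. la i * (dotp p xbar (v i))\<^sup>2)"
      unfolding c_def by (rule mean_span_le[OF sub(2)])
    also have "\<dots> \<le> (C * (real n * eps\<^sup>2)) * (1 / real n)"
    proof (rule mult_mono[OF pfc])
      have "(\<Sum>i=L+1..k. la i * (dotp p xbar (v i))\<^sup>2) \<le> (\<Sum>i=L+1..U. la i * (dotp p xbar (v i))\<^sup>2)"
        using k la_pos by (intro sum_mono2) (auto simp: less_imp_le)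
      then show "(\<Sum>i=L+1..k. la i * (dotp p xbar (v i))\<^sup>2) \<le> 1 / real n" using mean_tail by linarith
      show "0 \<le> (\<Sum>i=L+1..k. la i * (dotp p xbar (v i))\<^sup>2)"
        using k la_pos by (intro sum_nonneg) (auto simp: less_imp_le)
    qed (use C in auto)
    also have "\<dots> = C * eps\<^sup>2" using n by simp
    finally show ?thesis .
  qed
  have Nc: "NN c \<le> 3 * (C * eps\<^sup>2)"
    using NN_tail[OF c0] xc mc Ce by (simp add: x_def)
  have "NN a \<le> 3 * (NN h + NN bstar + NN c)"
    by (rule NN_3) (use dec in auto)
  also have "\<dots> \<le> 3 * (B * eps\<^sup>2 + 2 * eps\<^sup>2 + 3 * (C * eps\<^sup>2))"
    using NNh NN_bstar Nc by (simp add: h_def)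
  finally have Na: "NN a \<le> 3 * (B * eps\<^sup>2 + 2 * eps\<^sup>2 + 3 * (C * eps\<^sup>2))" .
  have "quad_form p S h \<le> 3 * (quad_form p S a + quad_form p S c + quad_form p S bstar)"
    by (rule quad_S_3[OF dec])
  also have "\<dots> \<le> 3 * (2 * (3 * (B * eps\<^sup>2 + 2 * eps\<^sup>2 + 3 * (C * eps\<^sup>2))) + 2 * (C * eps\<^sup>2) + eps\<^sup>2)"
    using quad_S_head[OF a0] Na Sc quad_S_bstar by (intro mult_left_mono add_mono) auto
  also have "\<dots> = (18 * B + 60 * C + 39) * eps\<^sup>2" by (simp add: algebra_simps)
  finally show ?thesis by (simp add: h_def)
qed

section \<open>Coefficients in a small box around those of the true parameter\<close>

context
  fixes b :: rvec
  assumes box: "\<And>i. i \<in> {1..L} \<Longrightarrow> \<bar>b i - dotp p theta (v i)\<bar> \<le> sqrt (la i) / real n"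
begin

text \<open>The radius is proportional to the prior standard deviation, so each coordinate costs a
  factor of order 1 / n in prior mass and all of them together exp (- L ln n), which the last term
  of the bias bound allows. At the same time the deviations have prior form at most L / n^2.\<close>

lemma box_sq: assumes "i \<in> {1..L}" shows "(b i - dotp p theta (v i))\<^sup>2 \<le> la i / (real n)\<^sup>2"
proof -
  have "(b i - dotp p theta (v i))\<^sup>2 = \<bar>b i - dotp p theta (v i)\<bar>\<^sup>2" by simp
  also have "\<dots> \<le> (sqrt (la i) / real n)\<^sup>2" by (intro power_mono box assms) simp
  also have "\<dots> = la i / (real n)\<^sup>2" using la_pos[of i] assms LU by (simp add: power_divide less_imp_le)
  finally show ?thesis .
qed

lemma box_sum: "(\<Sum>i=1..L. (b i - dotp p theta (v i))\<^sup>2 / la i) \<le> real L / (real n)\<^sup>2"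
proof -
  have "(\<Sum>i=1..L. (b i - dotp p theta (v i))\<^sup>2 / la i) \<le> (\<Sum>i=1..L. 1 / (real n)\<^sup>2)"
  proof (rule sum_mono)
    fix i assume i: "i \<in> {1..L}"
    then have "0 < la i" using la_pos LU by auto
    then show "(b i - dotp p theta (v i))\<^sup>2 / la i \<le> 1 / (real n)\<^sup>2"
      using box_sq[OF i] by (simp add: field_simps)
  qed
  then show ?thesis by simp
qed

lemma L_over_n: "real L / real n \<le> eps\<^sup>2" "real L / (real n)\<^sup>2 \<le> eps\<^sup>2"
proof -
  have "real L \<le> real n * eps\<^sup>2" using U_eps LU by linarith
  then show 1: "real L / real n \<le> eps\<^sup>2" using n by (simp add: field_simps)
  have "real L / (real n)\<^sup>2 = real L / real n / real n" by (simp add: power2_eq_square)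
  also have "\<dots> \<le> real L / real n" using n by (simp add: divide_le_eq mult_le_cancel_left1)
  finally show "real L / (real n)\<^sup>2 \<le> eps\<^sup>2" using 1 by linarith
qed

text \<open>The head error is so small in the box that the crude eigenvalue bound K suffices. The
  mean of the covariates may be as large as n in the prior metric (\<open>mean_head\<close>), but
  Cauchy-Schwarz multiplies it by L / n^2. What remains is the bias \<open>bstar\<close>.\<close>

lemma box_NN: "NN (\<lambda>l. T_embed p L v b l - theta l) \<le> (8 * K\<^sup>2 + 6) * eps\<^sup>2"
proof -
  define a where "a = (\<lambda>l. \<Sum>i=1..L. (b i - dotp p theta (v i)) * v i l)"
  have dec: "T_embed p L v b l - theta l = a l - bstar l" if "l \<in> {1..p}" for l
    using T_embed_decomp[of L l b] that LU by (simp add: a_def)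
  have sub: "{1..L} \<subseteq> {1..p}" "{1..L} \<subseteq> {1..U}" using LU by auto
  have "dotp p a a \<le> (\<Sum>i=1..L. 9 / 8 * K / (real n)\<^sup>2)"
    unfolding a_def span_norm[OF sub(1)]
  proof (rule sum_mono)
    fix i assume i: "i \<in> {1..L}"
    have "la i / (real n)\<^sup>2 \<le> 9 / 8 * K / (real n)\<^sup>2"
      by (intro divide_right_mono la_K) (use i LU in auto)
    with box_sq[OF i] show "(b i - dotp p theta (v i))\<^sup>2 \<le> 9 / 8 * K / (real n)\<^sup>2" by linarith
  qed
  also have "\<dots> = 9 / 8 * K * (real L / (real n)\<^sup>2)" by simp
  also have "\<dots> \<le> 9 / 8 * K * eps\<^sup>2" using L_over_n K by (intro mult_left_mono) auto
  finally have na: "dotp p a a \<le> 9 / 8 * K * eps\<^sup>2" .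
  have "quad_form p S a + delta * dotp p a a \<le> 9 / 8 * K * dotp p a a"
  proof -
    have "delta * dotp p a a \<le> K / 8 * dotp p a a"
      using delta_K by (intro mult_right_mono dotp_self_nonneg) auto
    then show ?thesis using quad_S_le_K[of a] by (simp add: algebra_simps)
  qed
  also have "\<dots> \<le> 9 / 8 * K * (9 / 8 * K * eps\<^sup>2)" using na K by (intro mult_left_mono) auto
  also have "\<dots> = 81 / 64 * (K\<^sup>2 * eps\<^sup>2)" by (simp add: power2_eq_square)
  finally have 1: "quad_form p S a + delta * dotp p a a \<le> 81 / 64 * (K\<^sup>2 * eps\<^sup>2)" .
  have "(dotp p xbar a)\<^sup>2 \<le> (\<Sum>i=1..L. (b i - dotp p theta (v i))\<^sup>2 / la i) * (\<Sum>i=1..L. la i * (dotp p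
      xbar (v i))\<^sup>2)"
    unfolding a_def by (rule mean_span_le[OF sub(2)])
  also have "\<dots> \<le> (real L / (real n)\<^sup>2) * real n"
  proof (rule mult_mono[OF box_sum mean_head])
    show "0 \<le> (\<Sum>i=1..L. la i * (dotp p xbar (v i))\<^sup>2)"
      using la_pos LU by (intro sum_nonneg) (auto simp: less_imp_le)
  qed simp
  also have "\<dots> = real L / real n" using n by (simp add: power2_eq_square)
  finally have 2: "(dotp p xbar a)\<^sup>2 \<le> eps\<^sup>2" using L_over_n by linarith
  have "NN (\<lambda>l. T_embed p L v b l - theta l) \<le> 2 * (NN a + NN bstar)"
    by (rule NN_2[OF dec])
  also have "\<dots> \<le> 2 * (81 / 64 * (K\<^sup>2 * eps\<^sup>2) + eps\<^sup>2 + 2 * eps\<^sup>2)"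
    using NN_le[of a] 1 2 NN_bstar by argo
  also have "\<dots> \<le> (8 * K\<^sup>2 + 6) * eps\<^sup>2"
  proof -
    have "0 \<le> K\<^sup>2 * eps\<^sup>2" by simp
    then show ?thesis by (simp add: algebra_simps)
  qed
  finally show ?thesis .
qed

lemma theta_coord_le: "i \<in> {1..p} \<Longrightarrow> (dotp p theta (v i))\<^sup>2 \<le> dotp p theta theta"
  unfolding norm_coords[of theta] by (intro member_le_sum) auto

text \<open>16/7 is 2 * 8/7: the 2 from splitting b i into the true coordinate and the deviation,
  the 8/7 from \<open>la_head\<close>. Bounding each coordinate by the whole norm of theta produces
  exactly the middle term of the bias bound.\<close>

lemma box_prior_form:
  assumes "dotp p theta theta * (\<Sum>i=1..L. 1 / lam i) \<le> y"
  shows "prior_form L la b \<le> 16 / 7 * y + 2 * eps\<^sup>2"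
proof -
  have "prior_form L la b \<le> (\<Sum>i=1..L. 2 * ((dotp p theta (v i))\<^sup>2 / la i) + 2 * ((b i - dotp p theta
      (v i))\<^sup>2 / la i))"
    unfolding prior_form_def
  proof (rule sum_mono)
    fix i assume i: "i \<in> {1..L}"
    then have la: "0 < la i" using la_pos LU by auto
    have "(b i)\<^sup>2 \<le> 2 * ((dotp p theta (v i))\<^sup>2 + (b i - dotp p theta (v i))\<^sup>2)"
      using square_sum2[of "dotp p theta (v i)" "dotp p theta (v i) - b i"]
      by (simp add: power2_commute)
    then have "(b i)\<^sup>2 / la i \<le> 2 * ((dotp p theta (v i))\<^sup>2 + (b i - dotp p theta (v i))\<^sup>2) / la i"
      using la by (intro divide_right_mono) auto
    then show "(b i)\<^sup>2 / la i \<le> 2 * ((dotp p theta (v i))\<^sup>2 / la i) + 2 * ((b i - dotp p theta (v i))\<^sup>2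
        / la i)"
      by (simp add: add_divide_distrib)
  qed
  also have "\<dots> = 2 * (\<Sum>i=1..L. (dotp p theta (v i))\<^sup>2 / la i) + 2 * (\<Sum>i=1..L. (b i - dotp p theta (v
      i))\<^sup>2 / la i)"
    by (simp add: sum.distrib sum_distrib_left)
  finally have pf: "prior_form L la b
    \<le> 2 * (\<Sum>i=1..L. (dotp p theta (v i))\<^sup>2 / la i) + 2 * (\<Sum>i=1..L. (b i - dotp p theta (v i))\<^sup>2 / la i)" .
  have "(\<Sum>i=1..L. (dotp p theta (v i))\<^sup>2 / la i) \<le> (\<Sum>i=1..L. dotp p theta theta * (8 / 7 * (1 / lam i)))"
  proof (rule sum_mono)
    fix i assume i: "i \<in> {1..L}"
    then have la: "0 < la i" using la_pos LU by auto
    \<comment> \<open>If \<open>lam i\<close> vanished, so would \<open>delta\<close>, and then the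
      positive \<open>la i\<close> as well.\<close>
    have lam: "0 < lam i" using delta_le_lam[OF i] la_le[of i] la i LU delta(1) by auto
    have "1 / la i \<le> 8 / 7 * (1 / lam i)" using la_head[OF i] la lam by (simp add: field_simps)
    then have "(dotp p theta (v i))\<^sup>2 * (1 / la i) \<le> dotp p theta theta * (8 / 7 * (1 / lam i))"
      using la i LU by (intro mult_mono theta_coord_le) (auto intro: dotp_self_nonneg)
    then show "(dotp p theta (v i))\<^sup>2 / la i \<le> dotp p theta theta * (8 / 7 * (1 / lam i))" by simp
  qed
  also have "\<dots> = 8 / 7 * (dotp p theta theta * (\<Sum>i=1..L. 1 / lam i))"
    by (simp add: sum_distrib_left algebra_simps)
  finally show ?thesis using pf assms box_sum L_over_n(2) by argo
qed

text \<open>The factor 2 comes from splitting squares; the margin between the norm of the true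
  parameter and the radius R is there to absorb it. The sum over the first L directions is a part of
  the sample quadratic form at theta.\<close>

lemma box_truncation:
  "(\<Sum>i=1..L. la i * (b i)\<^sup>2) \<le> 2 * (quad_form p S theta + delta * dotp p theta theta) + 4 * K\<^sup>2 * eps\<^sup>2"
proof -
  have "(\<Sum>i=1..L. la i * (b i)\<^sup>2) \<le> (\<Sum>i=1..L. 2 * (la i * (dotp p theta (v i))\<^sup>2) + 2 * (81 / 64 * K\<^sup>2
      * (1 / (real n)\<^sup>2)))"
  proof (rule sum_mono)
    fix i assume i: "i \<in> {1..L}"
    then have la: "0 < la i" using la_pos LU by auto
    have "(b i)\<^sup>2 \<le> 2 * ((dotp p theta (v i))\<^sup>2 + (b i - dotp p theta (v i))\<^sup>2)"
      using square_sum2[of "dotp p theta (v i)" "dotp p theta (v i) - b i"]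
      by (simp add: power2_commute)
    also have "\<dots> \<le> 2 * ((dotp p theta (v i))\<^sup>2 + la i / (real n)\<^sup>2)" using box_sq[OF i] by simp
    finally have "la i * (b i)\<^sup>2 \<le> la i * (2 * ((dotp p theta (v i))\<^sup>2 + la i / (real n)\<^sup>2))"
      using la by (intro mult_left_mono) auto
    also have "\<dots> = 2 * (la i * (dotp p theta (v i))\<^sup>2) + 2 * ((la i)\<^sup>2 * (1 / (real n)\<^sup>2))"
      by (simp add: algebra_simps power2_eq_square)
    also have "(la i)\<^sup>2 * (1 / (real n)\<^sup>2) \<le> 81 / 64 * K\<^sup>2 * (1 / (real n)\<^sup>2)"
    proof (rule mult_right_mono)
      have "(la i)\<^sup>2 \<le> (9 / 8 * K)\<^sup>2" using la la_K[of i] i LU by (intro power_mono) auto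
      then show "(la i)\<^sup>2 \<le> 81 / 64 * K\<^sup>2" by (simp add: power_mult_distrib power2_eq_square)
    qed simp
    finally show "la i * (b i)\<^sup>2 \<le> 2 * (la i * (dotp p theta (v i))\<^sup>2) + 2 * (81 / 64 * K\<^sup>2 * (1 /
        (real n)\<^sup>2))" by simp
  qed
  also have "\<dots> = 2 * (\<Sum>i=1..L. la i * (dotp p theta (v i))\<^sup>2) + 162 / 64 * K\<^sup>2 * (real L / (real n)\<^sup>2)"
    by (simp add: sum.distrib sum_distrib_left)
  also have "\<dots> \<le> 2 * (quad_form p S theta + delta * dotp p theta theta) + 4 * K\<^sup>2 * eps\<^sup>2"
  proof (rule add_mono)
    have q1: "quad_form p S1 theta \<le> quad_form p S theta + delta * dotp p theta theta"
      using close1[of theta] by (simp add: abs_le_iff)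
    have split: "quad_form p S1 theta = (\<Sum>i=1..L. la i * (dotp p theta (v i))\<^sup>2) + (\<Sum>i=L+1..p. la i *
        (dotp p theta (v i))\<^sup>2)"
    proof -
      have "{1..p} = {1..L} \<union> {L+1..p}" using LU by auto
      then show ?thesis unfolding eigensystem_quad_form[OF es1] by (simp add: sum.union_disjoint
          ivl_disj_int)
    qed
    show "2 * (\<Sum>i=1..L. la i * (dotp p theta (v i))\<^sup>2) \<le> 2 * (quad_form p S theta + delta * dotp p
        theta theta)"
    proof -
      have "0 \<le> (\<Sum>i=L+1..p. la i * (dotp p theta (v i))\<^sup>2)"
        using S1_nonneg eigensystem_eigenvalue[OF es1] by (intro sum_nonneg mult_nonneg_nonneg) auto
      then show ?thesis using q1 split by argo
    qed
    have "162 / 64 * K\<^sup>2 * (real L / (real n)\<^sup>2) \<le> 4 * K\<^sup>2 * eps\<^sup>2"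
      using L_over_n by (intro mult_mono) auto
    then show "162 / 64 * K\<^sup>2 * (real L / (real n)\<^sup>2) \<le> 4 * K\<^sup>2 * eps\<^sup>2" .
  qed
  finally show ?thesis .
qed

end

end

section \<open>Posterior concentration for typical data\<close>

text \<open>The arithmetic-geometric mean inequality in two weightings. The second spends only half
  of b and serves when b is a large prediction error that must survive the interaction with the
  noise.\<close>

lemma two_mult_le_of_square_le:
  fixes x a b :: real
  assumes "x\<^sup>2 \<le> a * b" "0 \<le> a" "0 \<le> b"
  shows "2 * \<bar>x\<bar> \<le> a + b" "2 * \<bar>x\<bar> \<le> 2 * a + b / 2"
proof -
  have "(2 * \<bar>x\<bar>)\<^sup>2 \<le> 4 * (a * b)" using assms(1) by (simp add: power_mult_distrib)
  moreover have "4 * (a * b) \<le> (a + b)\<^sup>2"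
    using zero_le_power2[of "a - b"] by (simp add: power2_eq_square algebra_simps)
  moreover have "4 * (a * b) \<le> (2 * a + b / 2)\<^sup>2"
    using zero_le_power2[of "2 * a - b / 2"] by (simp add: power2_eq_square algebra_simps)
  ultimately have "(2 * \<bar>x\<bar>)\<^sup>2 \<le> (a + b)\<^sup>2" "(2 * \<bar>x\<bar>)\<^sup>2 \<le> (2 * a + b / 2)\<^sup>2" by linarith+
  from power2_le_imp_le[OF this(1)] power2_le_imp_le[OF this(2)]
  show "2 * \<bar>x\<bar> \<le> a + b" "2 * \<bar>x\<bar> \<le> 2 * a + b / 2"
    using assms(2,3) by auto
qed

text \<open>The normalising constant of the posterior costs a factor \<open>exp (- denom_rate * n * eps\<^sup>2)\<close>; the
  summand \<open>9\<close> collects the priors of \<open>k\<close>, of the coefficients and of the variance.\<close>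

definition denom_rate :: "real \<Rightarrow> real \<Rightarrow> real" where
  "denom_rate sd K = 9 + 2 / sd ^ 4 + (12 * sd\<^sup>2 + 2 * (4 * K\<^sup>2 + 3)) / (2 * sd\<^sup>2)"

text \<open>The first clause bounds the correlation of the noise with the error vectors of all
  candidates at once. The 12 is 4 * 3: \<open>projection_tail_bound\<close> is applied with t = 3 n
  eps^2, because the span of the error vectors has dimension at most U + 1 \<le> 2 n eps^2.\<close>

definition typical_noise ::
  "nat \<Rightarrow> nat \<Rightarrow> nat \<Rightarrow> nat \<Rightarrow> (nat \<Rightarrow> rvec) \<Rightarrow> (nat \<Rightarrow> rvec) \<Rightarrow> rvec \<Rightarrow> real \<Rightarrow> real \<Rightarrow> (nat \<Rightarrow> real) \<Rightarrow> bool" where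
  "typical_noise n p L U v X theta sd eps e \<longleftrightarrow>
    (\<forall>k\<in>{L..U}. \<forall>b. (\<Sum>i=n div 2 + 1..n. e i * dotp p (X i) (\<lambda>l. T_embed p k v b l - theta l))\<^sup>2
      \<le> 12 * sd\<^sup>2 * (real n * eps\<^sup>2) *
        (\<Sum>i=n div 2 + 1..n. (dotp p (X i) (\<lambda>l. T_embed p k v b l - theta l))\<^sup>2)) \<and>
    \<bar>(\<Sum>i=n div 2 + 1..n. (e i)\<^sup>2) - real n / 2 * sd\<^sup>2\<bar> \<le> real n / 2 * eps"

text \<open>Nothing is random here: data, noise and eigensystems are given and only assumed typical.
  All prior factors of the normalising constant are bounded below by exponentials in
  \<open>nu\<close>, so that their product is one as well.\<close>

locale split_posterior = split_geometry n p L U S S1 lam la w v theta bstar eps delta K X xbar NN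
  for n p L U :: nat and S S1 :: rmat and lam la :: rvec and w v :: "nat \<Rightarrow> rvec"
    and theta bstar :: rvec and eps delta K :: real
    and X :: "nat \<Rightarrow> rvec" and xbar :: rvec and NN :: "rvec \<Rightarrow> real" +
  fixes d :: dataset and e :: "nat \<Rightarrow> real" and sigma eta xi CI g0 nu :: real
    and R :: ereal and f :: "nat \<Rightarrow> real"
  defines "nu \<equiv> real n * eps\<^sup>2"
  assumes even: "even n" and sigma: "0 < sigma" and eps: "0 < eps" "eps \<le> sigma\<^sup>2 / 4" "eps \<le> 1 / 12"
    and data: "\<And>i. i \<in> {n div 2 + 1..n} \<Longrightarrow> fst (d i) = dotp p (X i) theta + e i"
      "\<And>i. i \<in> {n div 2 + 1..n} \<Longrightarrow> snd (d i) = X i"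
    and noise: "typical_noise n p L U v X theta sigma eps e"
    and nu: "1 \<le> nu"
    and kprior: "exp (- nu) \<le> k_prior L U f L"
    and L_log: "real L * ln (real n) \<le> nu"
    and eps_exp: "exp (- nu) \<le> eps"
    and theta_lam: "dotp p theta theta * (\<Sum>i=1..L. 1 / lam i) \<le> nu"
    and trunc: "ereal (sqrt (2 * (quad_form p S theta + delta * dotp p theta theta) + 4 * K\<^sup>2 *
        eps\<^sup>2)) \<le> R"
    and eta: "0 < eta" and xi: "0 < xi"
    and CI: "(\<integral>\<^sup>+s. ennreal (inv_gauss_density eta xi s) * indicator {0<..} s \<partial>lborel) \<le> ennreal CI"
        "0 < CI"
    and g0: "\<And>s. s \<in> {sigma\<^sup>2..sigma\<^sup>2 + 1} \<Longrightarrow> g0 \<le> inv_gauss_density eta xi s" "exp (- nu) \<le> g0"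
begin

definition "m = real n / 2"
definition "SS = (\<Sum>i=n div 2 + 1..n. (e i)\<^sup>2)"
definition "s = SS / m"
definition "N u = (\<Sum>i=n div 2 + 1..n. (dotp p (X i) u)\<^sup>2)"
definition "cross u = (\<Sum>i=n div 2 + 1..n. e i * dotp p (X i) u)"
text \<open>The likelihood of the true coefficients at the empirical noise variance
  \<open>s\<close>, which maximises it over the variance. It depends on the data but cancels in the
  posterior.\<close>

definition "ref = exp (- (m / 2) * (ln (2 * pi * s) + 1))"

lemma card_D: "real (card {n div 2 + 1..n}) = m"
  using even by (auto simp: m_def elim!: evenE)

lemma m_pos: "0 < m"
  using n by (simp add: m_def)

lemma nu_m: "nu = 2 * m * eps\<^sup>2"
  by (simp add: nu_def m_def)

lemma s_bounds: "\<bar>s - sigma\<^sup>2\<bar> \<le> eps" "3 / 4 * sigma\<^sup>2 \<le> s" "s \<le> 5 / 4 * sigma\<^sup>2" "0 < s"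
proof -
  have "\<bar>SS - m * sigma\<^sup>2\<bar> \<le> m * eps"
    using noise by (simp add: typical_noise_def SS_def m_def)
  moreover have "s - sigma\<^sup>2 = (SS - m * sigma\<^sup>2) / m" using m_pos by (simp add: s_def
      diff_divide_distrib)
  ultimately show 1: "\<bar>s - sigma\<^sup>2\<bar> \<le> eps" using m_pos by (simp add: abs_div divide_le_eq mult.commute)
  have "0 < sigma\<^sup>2" using sigma by simp
  with 1 eps show "3 / 4 * sigma\<^sup>2 \<le> s" "s \<le> 5 / 4 * sigma\<^sup>2" "0 < s" by (auto simp: abs_le_iff)
qed

lemma SS_eq: "SS = m * s"
  using m_pos by (simp add: s_def)

lemma N_NN: "N u = m * NN u"
  using n by (simp add: N_def NN_def m_def)

lemma N_nonneg: "0 \<le> N u"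
  unfolding N_def by (intro sum_nonneg) auto

lemma cross_le:
  assumes "k \<in> {L..U}"
  shows "(cross (\<lambda>l. T_embed p k v b l - theta l))\<^sup>2 \<le> (12 * sigma\<^sup>2 * nu) * N (\<lambda>l. T_embed p k v b l
      - theta l)"
  using noise assms unfolding typical_noise_def cross_def N_def nu_def by blast

text \<open>Expanding around \<open>s\<close> instead of sigma^2 leaves no fluctuation of the noise
  norm: the variance enters through \<open>rate_fn\<close> and through the denominator of the
  prediction terms only.\<close>

lemma likelihood_eq:
  fixes \<theta> :: rvec
  assumes s2: "0 < s2"
  defines "h \<equiv> \<lambda>l. \<theta> l - theta l"
  shows "likelihood2 n p d \<theta> s2 = ref * exp (- (m / 2) * rate_fn (s2 / s) - (N h - 2 * cross h) / (2
      * s2))"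
proof -
  have "(\<Sum>i=n div 2 + 1..n. (fst (d i) - dotp p (snd (d i)) \<theta>)\<^sup>2) = (\<Sum>i=n div 2 + 1..n. (e i - dotp p
      (X i) h)\<^sup>2)"
    by (intro sum.cong refl) (simp add: data h_def dotp_diff_right algebra_simps)
  also have "\<dots> = SS + (N h - 2 * cross h)"
    unfolding SS_def N_def cross_def
    by (simp add: power2_diff sum.distrib sum_subtractf sum_distrib_left algebra_simps)
  finally have rss: "(\<Sum>i=n div 2 + 1..n. (fst (d i) - dotp p (snd (d i)) \<theta>)\<^sup>2) = m * s + (N h - 2 *
      cross h)"
    by (simp add: SS_eq)
  have ln1: "ln (2 * pi * s2) = ln (2 * pi) + ln s2" "ln (2 * pi * s) = ln (2 * pi) + ln s"
    using s2 s_bounds(4) by (simp_all add: ln_mult)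
  have rf: "rate_fn (s2 / s) = ln s2 - ln s + s / s2 - 1"
    using s2 s_bounds(4) by (simp add: rate_fn_def ln_div)
  have "- (m / 2) * ln (2 * pi * s2) - (m * s + (N h - 2 * cross h)) / (2 * s2)
      = - (m / 2) * (ln (2 * pi * s) + 1) + (- (m / 2) * rate_fn (s2 / s) - (N h - 2 * cross h) / (2
          * s2))"
    unfolding ln1 rf using s2 by (simp add: field_simps)
  then show ?thesis
    unfolding likelihood2_eq[OF s2] card_D rss ref_def by (simp only: exp_add)
qed

lemma ref_pos: "0 < ref" by (simp add: ref_def)

text \<open>Whatever the candidate, fitting the noise gains at most 12 sigma^2 nu before division by
  2 s2. Half of the variance loss absorbs the division by a small s2, at the price of 16 nu, where
  16 is 12 divided by the lower bound 3/4 for s / sigma^2.\<close>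

lemma likelihood_upper:
  assumes k: "k \<in> {L..U}" and s2: "0 < s2"
  shows "likelihood2 n p d (T_embed p k v b) s2 \<le> ref * exp (- (m / 4) * rate_fn (s2 / s) + 16 * nu)"
proof -
  define h where "h = (\<lambda>l. T_embed p k v b l - theta l)"
  have "2 * \<bar>cross h\<bar> \<le> 12 * sigma\<^sup>2 * nu + N h"
    using two_mult_le_of_square_le(1)[OF cross_le[OF k, of b]] nu by (simp add: h_def N_nonneg)
  then have low: "- (N h - 2 * cross h) \<le> 12 * sigma\<^sup>2 * nu" by linarith
  define kap where "kap = 12 * sigma\<^sup>2 * nu / (m * s)"
  have sp: "0 < s" by (rule s_bounds)
  have sig: "0 < sigma\<^sup>2" using sigma by simp
  have skap: "m * kap \<le> 16 * nu"
  proof -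
    have "m * kap = 12 * sigma\<^sup>2 * nu / s" using m_pos by (simp add: kap_def)
    also have "\<dots> \<le> 12 * sigma\<^sup>2 * nu / (3 / 4 * sigma\<^sup>2)"
      using nu sig mult_pos_pos[OF sp, of "3 / 4 * sigma\<^sup>2"]
      by (intro divide_left_mono[OF s_bounds(2)]) auto
    also have "\<dots> = 16 * nu" using sig by simp
    finally show ?thesis .
  qed
  \<comment> \<open>Origin of eps \<le> 1/12: it gives 32 eps^2 \<le> 32/144 < 1/4, the range of
    \<open>rate_fn_minus_inverse\<close>.\<close>
  have kap4: "kap \<le> 1 / 4"
  proof -
    have "m * kap \<le> m * (32 * eps\<^sup>2)" using skap by (simp add: nu_m)
    then have "kap \<le> 32 * eps\<^sup>2" using m_pos by simp
    moreover have "eps\<^sup>2 \<le> (1 / 12)\<^sup>2" using eps by (intro power_mono) auto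
    ultimately show ?thesis by (simp add: power2_eq_square)
  qed
  have kap0: "0 \<le> kap" unfolding kap_def using nu m_pos sp by simp
  have r: "0 < s2 / s" using s2 sp by simp
  have "- (N h - 2 * cross h) / (2 * s2) \<le> 12 * sigma\<^sup>2 * nu / (2 * s2)"
    using low s2 by (intro divide_right_mono) auto
  also have "\<dots> = (m / 2) * (kap / (s2 / s))"
    using m_pos sp s2 by (simp add: kap_def field_simps)
  finally have "- (m / 2) * rate_fn (s2 / s) - (N h - 2 * cross h) / (2 * s2)
      \<le> (m / 2) * (- (rate_fn (s2 / s) - kap / (s2 / s)))"
    by (simp only: minus_divide_left[symmetric] right_diff_distrib minus_diff_eq) argo
  also have "\<dots> \<le> (m / 2) * (- (rate_fn (s2 / s) / 2 - 2 * kap))"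
    using rate_fn_minus_inverse[OF r kap0 kap4] m_pos by (intro mult_left_mono) auto
  also have "\<dots> = - (m / 4) * rate_fn (s2 / s) + m * kap" by (simp add: algebra_simps)
  also have "\<dots> \<le> - (m / 4) * rate_fn (s2 / s) + 16 * nu" using skap by simp
  finally show ?thesis
    unfolding likelihood_eq[OF s2] h_def using ref_pos by (intro mult_left_mono) auto
qed

lemma likelihood_upper_any:
  assumes "k \<in> {L..U}" and "0 < s2"
  shows "likelihood2 n p d (T_embed p k v b) s2 \<le> ref * exp (16 * nu)"
proof -
  have "0 \<le> m / 4 * rate_fn (s2 / s)"
    using assms s_bounds(4) m_pos by (intro mult_nonneg_nonneg rate_fn_nonneg) auto
  then have "ref * exp (- (m / 4) * rate_fn (s2 / s) + 16 * nu) \<le> ref * exp (16 * nu)"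
    using ref_pos by (intro mult_left_mono) auto
  with likelihood_upper[OF assms] show ?thesis by (rule order_trans)
qed

lemma likelihood_upper_variance:
  assumes k: "k \<in> {L..U}" and s2: "0 < s2" and bad: "C1 * eps < \<bar>s2 - sigma\<^sup>2\<bar>"
    and C1: "1 \<le> C1" "(C1 - 1) * eps \<le> 5 / 4 * sigma\<^sup>2" "512 * sigma ^ 4 * (D + 17) \<le> (C1 - 1)\<^sup>2"
  shows "likelihood2 n p d (T_embed p k v b) s2 \<le> ref * exp (- ((D + 1) * nu))"
proof -
  \<comment> \<open>One eps is spent on replacing sigma^2 by \<open>s\<close>, and 5/4 sigma^2 is
    the upper bound of \<open>s\<close>, so t is a lower bound for the relative error of s2.\<close>
  define t where "t = (C1 - 1) * eps / (5 / 4 * sigma\<^sup>2)"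
  have sig: "0 < sigma\<^sup>2" using sigma by simp
  have t: "0 \<le> t" "t \<le> 1" using C1 eps sig by (auto simp: t_def)
  have sp: "0 < s" by (rule s_bounds)
  have "(C1 - 1) * eps \<le> \<bar>s2 - s\<bar>" using bad s_bounds(1) by (simp add: algebra_simps)
  moreover have "\<bar>s2 / s - 1\<bar> = \<bar>s2 - s\<bar> / s" using sp by (simp add: field_simps abs_div_pos[symmetric])
  moreover have "t \<le> (C1 - 1) * eps / s"
    unfolding t_def using s_bounds C1 eps sig by (intro divide_left_mono) auto
  ultimately have "t \<le> \<bar>s2 / s - 1\<bar>"
    using sp divide_right_mono[of "(C1 - 1) * eps" "\<bar>s2 - s\<bar>" s] by simp
  from rate_fn_away[OF _ t this] have "t\<^sup>2 / 16 \<le> rate_fn (s2 / s)" using s2 sp by simp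
  then have "m / 4 * (t\<^sup>2 / 16) \<le> m / 4 * rate_fn (s2 / s)" using m_pos by (intro mult_left_mono) auto
  \<comment> \<open>17 = 1 + 16: the 16 pays for the fitted noise, the 1 is the gain over the
    normalising constant.\<close>
  moreover have "(D + 17) * nu \<le> m / 4 * (t\<^sup>2 / 16)"
  proof -
    have "m / 4 * (t\<^sup>2 / 16) = nu * ((C1 - 1)\<^sup>2 / (200 * sigma ^ 4))"
      using sig by (simp add: t_def nu_m power_divide power_mult_distrib)
    moreover have "D + 17 \<le> (C1 - 1)\<^sup>2 / (512 * sigma ^ 4)" using C1(3) sigma by (simp add: field_simps)
    moreover have "(C1 - 1)\<^sup>2 / (512 * sigma ^ 4) \<le> (C1 - 1)\<^sup>2 / (200 * sigma ^ 4)"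
      using sigma by (intro divide_left_mono) auto
    ultimately have "nu * (D + 17) \<le> m / 4 * (t\<^sup>2 / 16)"
      using nu mult_left_mono[of "D + 17" "(C1 - 1)\<^sup>2 / (200 * sigma ^ 4)" nu] by argo
    then show ?thesis by (simp only: mult.commute)
  qed
  ultimately have "- (m / 4) * rate_fn (s2 / s) + 16 * nu \<le> - ((D + 1) * nu)"
    by (simp add: algebra_simps)
  then have "ref * exp (- (m / 4) * rate_fn (s2 / s) + 16 * nu) \<le> ref * exp (- ((D + 1) * nu))"
    using ref_pos by (intro mult_left_mono) auto
  with likelihood_upper[OF k s2] show ?thesis by (rule order_trans)
qed

text \<open>The prediction error is divided by 2 s2, so the variance has to be bounded above; larger
  ones fall under \<open>likelihood_upper_variance\<close>. Half of the prediction error survives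
  the interaction with the noise, whose cost of 24 sigma^2 nu is the 48 sigma^2 in the hypothesis on
  B.\<close>

lemma likelihood_upper_norm:
  assumes k: "k \<in> {L..U}" and s2: "0 < s2" "s2 \<le> 2 * sigma\<^sup>2"
    and bad: "B * nu \<le> N (\<lambda>l. T_embed p k v b l - theta l)"
    and B: "8 * sigma\<^sup>2 * (D + 1) + 48 * sigma\<^sup>2 \<le> B" "0 \<le> D"
  shows "likelihood2 n p d (T_embed p k v b) s2 \<le> ref * exp (- ((D + 1) * nu))"
proof -
  define h where "h = (\<lambda>l. T_embed p k v b l - theta l)"
  have sig: "0 < sigma\<^sup>2" using sigma by simp
  have "2 * \<bar>cross h\<bar> \<le> 2 * (12 * sigma\<^sup>2 * nu) + N h / 2"
    using two_mult_le_of_square_le(2)[OF cross_le[OF k, of b]] nu by (simp add: h_def N_nonneg)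
  then have "N h / 2 - 24 * sigma\<^sup>2 * nu \<le> N h - 2 * cross h" by linarith
  moreover have "(4 * sigma\<^sup>2 * (D + 1) + 24 * sigma\<^sup>2) * nu \<le> B / 2 * nu"
    using B nu by (intro mult_right_mono) auto
  moreover have "B / 2 * nu \<le> N h / 2" using bad by (simp add: h_def)
  ultimately have low: "4 * sigma\<^sup>2 * (D + 1) * nu \<le> N h - 2 * cross h" by (simp add: algebra_simps)
  have "(D + 1) * nu \<le> (N h - 2 * cross h) / (2 * s2)"
  proof -
    have "(D + 1) * nu = (4 * sigma\<^sup>2 * (D + 1) * nu) / (4 * sigma\<^sup>2)" using sig by simp
    also have "\<dots> \<le> (4 * sigma\<^sup>2 * (D + 1) * nu) / (2 * s2)"
      using s2 sig B nu by (intro divide_left_mono) auto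
    also have "\<dots> \<le> (N h - 2 * cross h) / (2 * s2)" using low s2 by (intro divide_right_mono) auto
    finally show ?thesis .
  qed
  moreover have "0 \<le> m / 2 * rate_fn (s2 / s)"
    using s2 s_bounds(4) m_pos by (intro mult_nonneg_nonneg rate_fn_nonneg) auto
  ultimately show ?thesis
    unfolding likelihood_eq[OF s2(1)] using ref_pos by (intro mult_left_mono) (auto simp: h_def)
qed

text \<open>The two fractions of \<open>denom_rate\<close> arise here: 2 / sigma^4 from the
  quadratic upper bound of the rate with |s2 - s| \<le> 2 eps, the other from the prediction error
  in the box. The window of variances starts at sigma^2, so that the denominators are at least
  sigma^2.\<close>

lemma likelihood_lower:
  assumes box: "\<And>i. i \<in> {1..L} \<Longrightarrow> \<bar>b i - dotp p theta (v i)\<bar> \<le> sqrt (la i) / real n"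
    and s2: "s2 \<in> {sigma\<^sup>2..sigma\<^sup>2 + eps}"
  shows "ref * exp (- ((denom_rate sigma K - 9) * nu)) \<le> likelihood2 n p d (T_embed p L v b) s2"
proof -
  define h where "h = (\<lambda>l. T_embed p L v b l - theta l)"
  have sig: "0 < sigma\<^sup>2" using sigma by simp
  have "sigma\<^sup>2 \<le> s2" using s2 by simp
  then have s2p: "0 < s2" "sigma\<^sup>2 \<le> s2" using order.strict_trans2[OF sig] by auto
  have L: "L \<in> {L..U}" using LU by simp
  have "N h \<le> m * ((8 * K\<^sup>2 + 6) * eps\<^sup>2)"
    unfolding N_NN h_def using box_NN[OF box] m_pos by (intro mult_left_mono) auto
  also have "\<dots> = (4 * K\<^sup>2 + 3) * nu" by (simp add: nu_m algebra_simps)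
  finally have Nh: "N h \<le> (4 * K\<^sup>2 + 3) * nu" .
  have "2 * \<bar>cross h\<bar> \<le> 12 * sigma\<^sup>2 * nu + N h"
    using two_mult_le_of_square_le(1)[OF cross_le[OF L, of b]] nu by (simp add: h_def N_nonneg)
  then have "N h - 2 * cross h \<le> 12 * sigma\<^sup>2 * nu + 2 * N h" by linarith
  also have "\<dots> \<le> (12 * sigma\<^sup>2 + 2 * (4 * K\<^sup>2 + 3)) * nu" using Nh by (simp add: algebra_simps)
  finally have up: "N h - 2 * cross h \<le> (12 * sigma\<^sup>2 + 2 * (4 * K\<^sup>2 + 3)) * nu" .
  have A2: "0 \<le> (12 * sigma\<^sup>2 + 2 * (4 * K\<^sup>2 + 3)) * nu" using nu by (intro mult_nonneg_nonneg) auto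
  have 1: "(N h - 2 * cross h) / (2 * s2) \<le> (12 * sigma\<^sup>2 + 2 * (4 * K\<^sup>2 + 3)) / (2 * sigma\<^sup>2) * nu"
  proof -
    have "(N h - 2 * cross h) / (2 * s2) \<le> (12 * sigma\<^sup>2 + 2 * (4 * K\<^sup>2 + 3)) * nu / (2 * s2)"
      using up s2p by (intro divide_right_mono) auto
    also have "\<dots> \<le> (12 * sigma\<^sup>2 + 2 * (4 * K\<^sup>2 + 3)) * nu / (2 * sigma\<^sup>2)"
      using A2 s2p(2) mult_pos_pos[OF s2p(1) sig] by (intro divide_left_mono) auto
    finally show ?thesis by simp
  qed
  have 2: "m / 2 * rate_fn (s2 / s) \<le> 2 / sigma ^ 4 * nu"
  proof -
    have sp: "0 < s" by (rule s_bounds)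
    have "rate_fn (s2 / s) \<le> (s2 / s - 1)\<^sup>2 / (s2 / s)" using s2p sp by (intro rate_fn_upper) auto
    also have "\<dots> = (s2 - s)\<^sup>2 / (s * s2)"
    proof -
      have "s2 / s - 1 = (s2 - s) / s" using sp by (simp add: field_simps)
      then show ?thesis using sp s2p by (simp add: power2_eq_square)
    qed
    also have "\<dots> \<le> (2 * eps)\<^sup>2 / (3 / 4 * sigma\<^sup>2 * sigma\<^sup>2)"
    proof (rule frac_le)
      have "\<bar>s2 - s\<bar> \<le> 2 * eps" using s2 s_bounds(1) by (auto simp: abs_le_iff)
      then have "\<bar>s2 - s\<bar>\<^sup>2 \<le> (2 * eps)\<^sup>2" by (rule power_mono) simp
      then show "(s2 - s)\<^sup>2 \<le> (2 * eps)\<^sup>2" by simp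
      show "3 / 4 * sigma\<^sup>2 * sigma\<^sup>2 \<le> s * s2" using s_bounds s2p sig by (intro mult_mono) auto
    qed (use sig in auto)
    also have "\<dots> = 16 / 3 * eps\<^sup>2 / sigma ^ 4" by (simp add: power2_eq_square power4_eq_xxxx)
    finally have "m / 2 * rate_fn (s2 / s) \<le> m / 2 * (16 / 3 * eps\<^sup>2 / sigma ^ 4)"
      using m_pos by (intro mult_left_mono) auto
    also have "\<dots> = 4 / 3 / sigma ^ 4 * nu" by (simp add: nu_m)
    also have "\<dots> \<le> 2 / sigma ^ 4 * nu" using nu sigma by (intro mult_right_mono divide_right_mono) auto
    finally show ?thesis .
  qed
  have "- ((denom_rate sigma K - 9) * nu) \<le> - (m / 2) * rate_fn (s2 / s) - (N h - 2 * cross h) / (2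
      * s2)"
    using 1 2 by (simp add: denom_rate_def distrib_right)
  then show ?thesis unfolding likelihood_eq[OF s2p(1)] h_def using ref_pos by (intro mult_left_mono)
      auto
qed

lemma post_mass_denominator:
  "ennreal (ref * exp (- (denom_rate sigma K * nu))) \<le> post_mass n p R L U f eta xi la v d UNIV"
proof -
  define r where "r = (\<lambda>i. sqrt (la i) / real n)"
  define c where "c = (\<lambda>i. dotp p theta (v i))"
  define A where "A = Pi\<^sub>E {1..L} (\<lambda>i. {c i - r i..c i + r i})"
  define q0 where "q0 = 16 / 7 * nu + 2 * eps\<^sup>2"
  have lap: "0 < la i" if "i \<in> {1..L}" for i using la_pos that LU by auto
  have AB: "\<bar>b i - c i\<bar> \<le> r i" if "b \<in> A" "i \<in> {1..L}" for b i
    using PiE_mem[OF that[unfolded A_def]] by (simp add: abs_le_iff)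
  have n1: "1 \<le> real n" using n by simp
  have mass: "ennreal (exp (- q0) * (\<Prod>i=1..L. 2 * r i / sqrt (pi * la i)))
    \<le> (\<integral>\<^sup>+b. ennreal (beta_prior L la R b) * indicator A b \<partial>Pi\<^sub>M {1..L} (\<lambda>_. lborel))"
    unfolding A_def
  proof (rule beta_prior_box)
    fix b assume b: "\<And>i. i \<in> {1..L} \<Longrightarrow> \<bar>b i - c i\<bar> \<le> r i"
    have box: "\<And>i. i \<in> {1..L} \<Longrightarrow> \<bar>b i - dotp p theta (v i)\<bar> \<le> sqrt (la i) / real n"
      using b by (simp add: c_def r_def)
    have "prior_form L la b \<le> q0" unfolding q0_def by (rule box_prior_form[OF box theta_lam])
    moreover have "ereal (sqrt (\<Sum>i=1..L. la i * (b i)\<^sup>2)) \<le> R"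
      using box_truncation[OF box] trunc by (meson ereal_less_eq(3) order_trans real_sqrt_le_mono)
    ultimately show "prior_form L la b \<le> q0 \<and> ereal (sqrt (\<Sum>i=1..L. la i * (b i)\<^sup>2)) \<le> R" ..
  qed (use lap n1 in \<open>auto simp: r_def\<close>)
  \<comment> \<open>Each factor is 2 / (sqrt pi * n), at least 1 / n because pi < 4; the product is
    then at least exp (- L ln n).\<close>
  have prod: "exp (- nu) \<le> (\<Prod>i=1..L. 2 * r i / sqrt (pi * la i))"
  proof -
    have "exp (- nu) \<le> exp (- (real L * ln (real n)))" using L_log by simp
    also have "\<dots> = (\<Prod>i=1..L. 1 / real n)"
    proof -
      have "exp (- (real L * ln (real n))) = inverse (exp (ln (real n)) ^ L)"
        by (simp add: exp_minus exp_of_nat_mult)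
      then show ?thesis using n1 by (simp add: power_one_over inverse_eq_divide)
    qed
    also have "\<dots> \<le> (\<Prod>i=1..L. 2 * r i / sqrt (pi * la i))"
    proof (rule prod_mono)
      fix i assume i: "i \<in> {1..L}"
      have "sqrt pi \<le> sqrt 4" using pi_less_4 by (intro real_sqrt_le_mono) simp
      then have "sqrt pi \<le> 2" by simp
      then have "1 \<le> 2 / sqrt pi" by simp
      then have "1 / real n \<le> 2 / sqrt pi / real n" using n1 by (intro divide_right_mono) auto
      also have "\<dots> = 2 * r i / sqrt (pi * la i)"
        using lap[OF i] n1 by (simp add: r_def real_sqrt_mult)
      finally show "0 \<le> 1 / real n \<and> 1 / real n \<le> 2 * r i / sqrt (pi * la i)" by simp
    qed
    finally show ?thesis .
  qed
  define q where "q = exp (- q0) * (\<Prod>i=1..L. 2 * r i / sqrt (pi * la i))"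
  have q: "exp (- (6 * nu)) \<le> q"
  proof -
    have "eps\<^sup>2 \<le> 1" using eps by (intro power_le_one) auto
    then have "q0 \<le> 5 * nu" using nu by (simp add: q0_def)
    then have "exp (- (5 * nu)) * exp (- nu) \<le> q" unfolding q_def using prod by (intro mult_mono) auto
    then show ?thesis by (simp flip: exp_add)
  qed
  have e9: "sigma\<^sup>2 + eps - sigma\<^sup>2 = eps" by simp
  \<comment> \<open>The summand 9 is 1 + 6 + 1 + 1, for the prior of k, the box, the density
    \<open>g0\<close> and the window length eps. Of the 6 for the box, 5 bound the prior form and 1
    is the volume ratio.\<close>
  have "ref * exp (- (denom_rate sigma K * nu))
      = exp (- nu) * exp (- (6 * nu)) * exp (- nu) * exp (- nu) * (ref * exp (- ((denom_rate sigma K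
          - 9) * nu)))"
    by (simp add: algebra_simps flip: exp_add)
  also have "\<dots> \<le> k_prior L U f L * q * g0 * (sigma\<^sup>2 + eps - sigma\<^sup>2) * (ref * exp (- ((denom_rate
      sigma K - 9) * nu)))"
    unfolding e9
    using kprior q g0(2) eps_exp ref_pos
    by (intro mult_mono mult_nonneg_nonneg) (auto intro: order_trans[OF exp_ge_zero])
  finally have "ennreal (ref * exp (- (denom_rate sigma K * nu)))
    \<le> ennreal (k_prior L U f L * q * g0 * (sigma\<^sup>2 + eps - sigma\<^sup>2) * (ref * exp (- ((denom_rate sigma
        K - 9) * nu))))"
    by (rule ennreal_leI)
  also have "\<dots> \<le> post_mass n p R L U f eta xi la v d UNIV"
  proof (rule post_mass_lower[OF LU(2) xi])
    show "A \<in> sets (Pi\<^sub>M {1..L} (\<lambda>_. lborel))" unfolding A_def by (intro sets_PiM_I_finite) auto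
    show "ennreal q \<le> (\<integral>\<^sup>+b. ennreal (beta_prior L la R b) * indicator A b \<partial>Pi\<^sub>M {1..L} (\<lambda>_. lborel))"
      using mass by (simp add: q_def)
    show "0 < sigma\<^sup>2" using sigma by simp
    show "sigma\<^sup>2 \<le> sigma\<^sup>2 + eps" using eps by simp
    show "g0 \<le> inv_gauss_density eta xi s" if "s \<in> {sigma\<^sup>2..sigma\<^sup>2 + eps}" for s
      using g0(1)[of s] that eps by auto
    show "0 \<le> q" using q by (rule order_trans[OF exp_ge_zero])
    show "0 \<le> g0" using g0(2) by (rule order_trans[OF exp_ge_zero])
    show "0 \<le> ref * exp (- ((denom_rate sigma K - 9) * nu))" using ref_pos by simp
    show "ref * exp (- ((denom_rate sigma K - 9) * nu)) \<le> likelihood2 n p d (T_embed p L v b) s2"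
      if "b \<in> A" "s2 \<in> {sigma\<^sup>2..sigma\<^sup>2 + eps}" for b s2
      using AB[OF that(1)] that(2) by (intro likelihood_lower) (auto simp: c_def r_def)
  qed
  finally show ?thesis .
qed

text \<open>Each parameter in Z has a wrong variance, a large prediction error or a large prior
  form, and each defect costs exp (- (D + 1) nu) against exp (- D nu) for the normalising constant.
  The threshold 2 (D + 18) is twice D + 1 + 16 + 1: the gain, the fitted noise and the factor sqrt 2
  ^ U \<le> exp nu; the 2 undoes the halved exponent in the prior tail.\<close>

lemma posterior_bound:
  assumes C1: "1 \<le> C1" "C1 * eps \<le> sigma\<^sup>2" "512 * sigma ^ 4 * (denom_rate sigma K + 17) \<le> (C1 - 1)\<^sup>2"
    and B: "8 * sigma\<^sup>2 * (denom_rate sigma K + 1) + 48 * sigma\<^sup>2 \<le> B"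
    and C3: "2 * (denom_rate sigma K + 18) \<le> C3"
    and Z: "\<And>k b s2. k \<in> {L..U} \<Longrightarrow> 0 < s2 \<Longrightarrow> (T_embed p k v b, s2) \<in> Z \<Longrightarrow>
      C1 * eps < \<bar>s2 - sigma\<^sup>2\<bar> \<or> B * nu \<le> N (\<lambda>l. T_embed p k v b l - theta l) \<or> C3 * nu < prior_form
          k la b"
  shows "posterior n p R L U f eta xi la v d Z \<le> 2 * CI * exp (- nu)"
proof -
  define D where "D = denom_rate sigma K"
  have sig: "0 < sigma\<^sup>2" using sigma by simp
  have D: "0 \<le> D" unfolding D_def denom_rate_def using sigma by (intro add_nonneg_nonneg
      divide_nonneg_nonneg) auto
  have num: "post_mass n p R L U f eta xi la v d Z
      \<le> ennreal (CI * ref * (exp (- ((D + 1) * nu)) + exp (16 * nu - C3 * nu / 2) * sqrt 2 ^ U))"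
  proof (rule post_mass_upper[OF _ LU(2) xi CI(1)])
    show "\<And>i. i \<in> {1..U} \<Longrightarrow> 0 < la i" by (rule la_pos)
    show "0 \<le> CI" "0 \<le> ref" using CI ref_pos by auto
    fix k b s2 assume k: "k \<in> {L..U}" and s2: "0 < s2" and z: "(T_embed p k v b, s2) \<in> Z"
    let ?l = "likelihood2 n p d (T_embed p k v b) s2"
    show "?l \<le> ref * (exp (- ((D + 1) * nu)) + exp (16 * nu) * (if C3 * nu < prior_form k la b then
        1 else 0))"
    proof (cases "C3 * nu < prior_form k la b")
      case True
      have "?l \<le> ref * exp (16 * nu)" by (rule likelihood_upper_any[OF k s2])
      also have "\<dots> \<le> ref * (exp (- ((D + 1) * nu)) + exp (16 * nu))"
        using ref_pos by (intro mult_left_mono) auto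
      finally show ?thesis using True by simp
    next
      case False
      have "?l \<le> ref * exp (- ((D + 1) * nu))"
      proof (cases "C1 * eps < \<bar>s2 - sigma\<^sup>2\<bar>")
        case True
        have "(C1 - 1) * eps \<le> 5 / 4 * sigma\<^sup>2" unfolding left_diff_distrib using C1(2) eps(1) sig by
            argo
        then show ?thesis using True C1 by (intro likelihood_upper_variance[OF k s2]) (auto simp: D_def)
      next
        case F2: False
        then have "s2 \<le> 2 * sigma\<^sup>2" using C1(2) by (simp add: abs_if split: if_splits)
        moreover have "B * nu \<le> N (\<lambda>l. T_embed p k v b l - theta l)" using Z[OF k s2 z] False F2 by
            blast
        ultimately show ?thesis using B D by (intro likelihood_upper_norm[OF k s2]) (auto simp: D_def)
      qed
      then show ?thesis using False by simp
    qed
  qed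
  have tail: "exp (16 * nu - C3 * nu / 2) * sqrt 2 ^ U \<le> exp (- ((D + 1) * nu))"
  proof -
    have "sqrt 2 \<le> sqrt (2\<^sup>2)" by (rule real_sqrt_le_mono) simp
    also have "\<dots> \<le> exp (1::real)" using exp_ge_add_one_self[of "1::real"] by simp
    finally have "sqrt 2 ^ U \<le> exp (1::real) ^ U" by (intro power_mono) auto
    also have "\<dots> = exp (real U)" by (simp flip: exp_of_nat_mult)
    also have "\<dots> \<le> exp nu" using U_eps by (simp add: nu_def)
    finally have "exp (16 * nu - C3 * nu / 2) * sqrt 2 ^ U \<le> exp (16 * nu - C3 * nu / 2) * exp nu"
      by (intro mult_left_mono) auto
    also have "\<dots> = exp (17 * nu - C3 * nu / 2)" by (simp flip: exp_add)
    also have "\<dots> \<le> exp (- ((D + 1) * nu))"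
    proof -
      have "2 * (D + 18) * nu \<le> C3 * nu" using C3 nu by (intro mult_right_mono) (auto simp: D_def)
      then show ?thesis by (simp add: algebra_simps)
    qed
    finally show ?thesis .
  qed
  have "CI * ref * (exp (- ((D + 1) * nu)) + exp (16 * nu - C3 * nu / 2) * sqrt 2 ^ U)
      \<le> CI * ref * (2 * exp (- ((D + 1) * nu)))"
    using tail CI ref_pos by (intro mult_left_mono) auto
  then have num': "post_mass n p R L U f eta xi la v d Z \<le> ennreal (CI * ref * (2 * exp (- ((D + 1)
      * nu))))"
    using num by (meson ennreal_leI order_trans)
  have "posterior n p R L U f eta xi la v d Z
      \<le> CI * ref * (2 * exp (- ((D + 1) * nu))) / (ref * exp (- (D * nu)))"
    by (rule posterior_le[OF num']) (use post_mass_denominator CI ref_pos in \<open>auto simp: D_def\<close>)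
  also have "\<dots> = 2 * CI * (exp (- ((D + 1) * nu)) / exp (- (D * nu)))" using ref_pos by simp
  also have "exp (- ((D + 1) * nu)) / exp (- (D * nu)) = exp (- nu)"
    by (simp add: algebra_simps flip: exp_diff)
  finally show ?thesis .
qed

lemma posterior_variance:
  assumes C1: "1 \<le> C1" "C1 * eps \<le> sigma\<^sup>2" "512 * sigma ^ 4 * (denom_rate sigma K + 17) \<le> (C1 - 1)\<^sup>2"
  shows "posterior n p R L U f eta xi la v d (UNIV \<times> {s2. C1 * eps < \<bar>s2 - sigma\<^sup>2\<bar>}) \<le> 2 * CI * exp
      (- nu)"
  by (rule posterior_bound[OF C1 order_refl order_refl]) auto

lemma posterior_norm:
  assumes C1: "1 \<le> C1" "C1 * eps \<le> sigma\<^sup>2" "512 * sigma ^ 4 * (denom_rate sigma K + 17) \<le> (C1 - 1)\<^sup>2"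
    and B: "8 * sigma\<^sup>2 * (denom_rate sigma K + 1) + 48 * sigma\<^sup>2 \<le> B"
    and C3: "2 * (denom_rate sigma K + 18) \<le> C3"
    and C: "0 \<le> C" "36 * B + 60 * C3 + 39 \<le> C\<^sup>2"
  shows "posterior n p R L U f eta xi la v d ({\<theta>. C * eps < mat_norm p S (\<lambda>j. \<theta> j - theta j)} \<times> UNIV)
    \<le> 2 * CI * exp (- nu)"
proof (rule posterior_bound[OF C1 B C3])
  fix k b and s2 :: real assume k: "k \<in> {L..U}"
    and z: "(T_embed p k v b, s2) \<in> {\<theta>. C * eps < mat_norm p S (\<lambda>j. \<theta> j - theta j)} \<times> UNIV"
  have C3n: "0 \<le> C3"
  proof -
    have "0 \<le> denom_rate sigma K" unfolding denom_rate_def using sigma by (intro add_nonneg_nonneg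
        divide_nonneg_nonneg) auto
    with C3 show ?thesis by argo
  qed
  show "C1 * eps < \<bar>s2 - sigma\<^sup>2\<bar> \<or> B * nu \<le> N (\<lambda>l. T_embed p k v b l - theta l) \<or> C3 * nu <
      prior_form k la b"
  proof (rule ccontr)
    assume neg: "\<not> (C1 * eps < \<bar>s2 - sigma\<^sup>2\<bar> \<or> B * nu \<le> N (\<lambda>l. T_embed p k v b l - theta l) \<or> C3 *
        nu < prior_form k la b)"
    \<comment> \<open>Since N is m * NN while nu is 2 m eps^2, the bound B for N becomes 2 B for NN;
      hence the 36 in place of 18 in the constant.\<close>
    then have "m * NN (\<lambda>l. T_embed p k v b l - theta l) \<le> m * (2 * B * eps\<^sup>2)"
      by (simp add: N_NN nu_m algebra_simps)
    then have "NN (\<lambda>l. T_embed p k v b l - theta l) \<le> 2 * B * eps\<^sup>2" using m_pos by simp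
    moreover have "prior_form k la b \<le> C3 * (real n * eps\<^sup>2)" using neg by (simp add: nu_def)
    ultimately have "quad_form p S (\<lambda>l. T_embed p k v b l - theta l) \<le> (18 * (2 * B) + 60 * C3 + 39)
        * eps\<^sup>2"
      using k C3n by (intro population_norm_bound) auto
    also have "\<dots> \<le> C\<^sup>2 * eps\<^sup>2" using C by (intro mult_right_mono) auto
    also have "\<dots> = (C * eps)\<^sup>2" by (simp add: power_mult_distrib)
    finally have "mat_norm p S (\<lambda>l. T_embed p k v b l - theta l) \<le> C * eps"
      unfolding mat_norm_def using C eps by (intro real_le_lsqrt) (auto simp: quad_S_nonneg)
    with z show False by simp
  qed
qed

end

section \<open>Typical noise and typical covariates\<close>

text \<open>As functions of the observation, all error vectors lie in the span of U + 1 fixed ones,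
  the images of v 1, ..., v U and of theta. An orthonormal basis of that span serves every k and b,
  and Cauchy-Schwarz in this basis replaces a supremum over candidates.\<close>

lemma typical_noise_of_projection:
  fixes v X :: "nat \<Rightarrow> rvec"
  assumes D: "D = {n div 2 + 1..n}"
  shows "\<exists>r u. r \<le> U + 1 \<and>
    (\<forall>k<r. \<forall>l<r. (\<Sum>i\<in>D. u k i * u l i) = (if k = l then 1 else (0::real))) \<and>
    (\<forall>k\<le>U. \<forall>b e. (\<Sum>i\<in>D. e i * dotp p (X i) (\<lambda>l. T_embed p k v b l - theta l))\<^sup>2
      \<le> (\<Sum>q<r. (\<Sum>i\<in>D. e i * u q i)\<^sup>2) * (\<Sum>i\<in>D. (dotp p (X i) (\<lambda>l. T_embed p k v b l - theta l))\<^sup>2))"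
proof -
  define g where "g = (\<lambda>j i. if j < U then dotp p (X i) (v (j + 1)) else dotp p (X i) theta)"
  have fin: "finite D" by (simp add: D)
  obtain r u c where ru: "r \<le> U + 1"
    "\<And>k l. k < r \<Longrightarrow> l < r \<Longrightarrow> (\<Sum>i\<in>D. u k i * u l i) = (if k = l then 1 else (0::real))"
    "\<And>j i. j < U + 1 \<Longrightarrow> i \<in> D \<Longrightarrow> g j i = (\<Sum>q<r. c j q * u q i)"
    using Gram_Schmidt[OF fin, of "U + 1" g] by blast
  have "(\<Sum>i\<in>D. e i * dotp p (X i) (\<lambda>l. T_embed p k v b l - theta l))\<^sup>2
      \<le> (\<Sum>q<r. (\<Sum>i\<in>D. e i * u q i)\<^sup>2) * (\<Sum>i\<in>D. (dotp p (X i) (\<lambda>l. T_embed p k v b l - theta l))\<^sup>2)"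
    if k: "k \<le> U" for k b e
  proof -
    \<comment> \<open>Coordinates of the error in the generators \<open>g\<close>: eigenvector j + 1
      sits at index j, and theta, with coefficient -1, at index U. As k \<le> U, the two ranges do
      not meet.\<close>
    define a where "a = (\<lambda>j. if j < k then b (j + 1) else if j = U then - 1 else (0::real))"
    define z where "z = (\<lambda>q. \<Sum>j<U + 1. a j * c j q)"
    define h where "h = (\<lambda>i. dotp p (X i) (\<lambda>l. T_embed p k v b l - theta l))"
    have h: "h i = (\<Sum>q<r. z q * u q i)" if i: "i \<in> D" for i
    proof -
      have "dotp p (X i) (T_embed p k v b) = dotp p (X i) (\<lambda>l. \<Sum>j=1..k. b j * v j l)"
        by (rule dotp_cong) (auto simp: T_embed_def)
      also have "\<dots> = (\<Sum>j=1..k. b j * dotp p (X i) (v j))" by (rule dotp_sum_right)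
      also have "\<dots> = (\<Sum>j<k. b (j + 1) * dotp p (X i) (v (j + 1)))"
        by (rule sum.reindex_bij_witness[of _ "\<lambda>j. j + 1" "\<lambda>j. j - 1"]) auto
      also have "\<dots> = (\<Sum>j<U. a j * g j i)"
        using k by (intro sum.mono_neutral_cong_left) (auto simp: a_def g_def)
      finally have "dotp p (X i) (T_embed p k v b) = (\<Sum>j<U. a j * g j i)" .
      then have "h i = (\<Sum>j<U. a j * g j i) + a U * g U i"
        using k by (simp add: h_def dotp_diff_right a_def g_def)
      also have "\<dots> = (\<Sum>j<U + 1. a j * g j i)"
        unfolding Suc_eq_plus1[symmetric] sum.lessThan_Suc ..
      also have "\<dots> = (\<Sum>j<U + 1. a j * (\<Sum>q<r. c j q * u q i))"
        using ru(3) i by (intro sum.cong) auto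
      also have "\<dots> = (\<Sum>q<r. z q * u q i)"
        unfolding z_def sum_distrib_left sum_distrib_right by (subst sum.swap) (simp add: mult.assoc)
      finally show ?thesis .
    qed
    have hh: "(\<Sum>i\<in>D. (h i)\<^sup>2) = (\<Sum>q<r. (z q)\<^sup>2)"
    proof -
      have "(\<Sum>i\<in>D. (h i)\<^sup>2) = (\<Sum>i\<in>D. \<Sum>k<r. \<Sum>l<r. z k * z l * (u k i * u l i))"
        by (intro sum.cong refl) (simp add: h power2_eq_square sum_product ac_simps)
      also have "\<dots> = (\<Sum>k<r. \<Sum>l<r. \<Sum>i\<in>D. z k * z l * (u k i * u l i))"
        by (subst sum.swap) (simp add: sum.swap[of _ D])
      also have "\<dots> = (\<Sum>k<r. \<Sum>l<r. if l = k then z k * z l else 0)"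
        unfolding sum_distrib_left[symmetric] by (intro sum.cong refl) (auto simp: ru(2))
      also have "\<dots> = (\<Sum>k<r. (z k)\<^sup>2)"
        by (intro sum.cong refl) (simp add: power2_eq_square)
      finally show ?thesis .
    qed
    have "(\<Sum>i\<in>D. e i * h i) = (\<Sum>i\<in>D. e i * (\<Sum>q<r. z q * u q i))"
      by (intro sum.cong refl) (simp add: h)
    also have "\<dots> = (\<Sum>q<r. (\<Sum>i\<in>D. e i * u q i) * z q)"
      unfolding sum_distrib_left sum_distrib_right by (subst sum.swap) (simp add: ac_simps)
    finally show ?thesis
      using Cauchy_Schwarz_ineq_sum[of "\<lambda>q. \<Sum>i\<in>D. e i * u q i" z "{..<r}"] hh by (simp add: h_def)
  qed
  with ru(1,2) show ?thesis by blast
qed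

text \<open>\<open>typical_noise\<close> quantifies over all real coefficient vectors, so instead of
  its own probability a measurable exceptional set is given, the union of two explicit
  events.\<close>

lemma typical_noise_prob:
  fixes v X :: "nat \<Rightarrow> rvec" and sd eps :: real
  assumes n: "even n" and sd: "0 < sd" and eps: "0 < eps" "eps \<le> sd\<^sup>2"
    and U: "real U \<le> real n * eps\<^sup>2" and nu: "1 \<le> real n * eps\<^sup>2"
  shows "\<exists>B\<in>sets (Pi\<^sub>M {n div 2 + 1..n} (\<lambda>_. normal_law sd)).
    (\<forall>e\<in>space (Pi\<^sub>M {n div 2 + 1..n} (\<lambda>_. normal_law sd)) - B. typical_noise n p L U v X theta sd eps
        e) \<and>
    emeasure (Pi\<^sub>M {n div 2 + 1..n} (\<lambda>_. normal_law sd)) B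
      \<le> ennreal (exp (- (real n * eps\<^sup>2)) + 2 * exp (- (real n * eps\<^sup>2 / (32 * sd ^ 4))))"
proof -
  let ?D = "{n div 2 + 1..n}"
  let ?E = "Pi\<^sub>M ?D (\<lambda>_. normal_law sd)"
  obtain r and u :: "nat \<Rightarrow> nat \<Rightarrow> real" where ru: "r \<le> U + 1"
    "\<And>k l. k < r \<Longrightarrow> l < r \<Longrightarrow> (\<Sum>i\<in>?D. u k i * u l i) = (if k = l then 1 else 0)"
    "\<And>k b e. k \<le> U \<Longrightarrow> (\<Sum>i\<in>?D. e i * dotp p (X i) (\<lambda>l. T_embed p k v b l - theta l))\<^sup>2
      \<le> (\<Sum>q<r. (\<Sum>i\<in>?D. e i * u q i)\<^sup>2) * (\<Sum>i\<in>?D. (dotp p (X i) (\<lambda>l. T_embed p k v b l - theta l))\<^sup>2)"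
    using typical_noise_of_projection[OF refl, of U n p X v theta] by blast
  define nu where "nu = real n * eps\<^sup>2"
  define B1 where "B1 = {e \<in> space ?E. 4 * sd\<^sup>2 * (3 * nu) < (\<Sum>q<r. (\<Sum>i\<in>?D. e i * u q i)\<^sup>2)}"
  define B2 where "B2 = {e \<in> space ?E.
    real (card ?D) * eps < \<bar>(\<Sum>i\<in>?D. (e i)\<^sup>2) - real (card ?D) * sd\<^sup>2\<bar>}"
  have card: "real (card ?D) = real n / 2" using n by (auto elim!: evenE)
  have B1: "B1 \<in> sets ?E" unfolding B1_def by measurable
  have B2: "B2 \<in> sets ?E" unfolding B2_def by measurable
  have "emeasure ?E B1 \<le> ennreal (exp (real r - 3 * nu))"
    unfolding B1_def using ru(2) by (intro projection_tail_bound[OF sd]) auto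
  also have "\<dots> \<le> ennreal (exp (- nu))"
    using ru(1) U nu by (intro ennreal_leI) (simp add: nu_def)
  finally have e1: "emeasure ?E B1 \<le> ennreal (exp (- nu))" .
  have "emeasure ?E B2 \<le> ennreal (2 * exp (- (real (card ?D) * (eps / sd\<^sup>2)\<^sup>2 / 16)))"
    unfolding B2_def by (rule sum_squares_deviation[OF sd _ eps]) simp
  also have "real (card ?D) * (eps / sd\<^sup>2)\<^sup>2 / 16 = nu / (32 * sd ^ 4)"
    unfolding card nu_def by (simp add: power_divide)
  finally have e2: "emeasure ?E B2 \<le> ennreal (2 * exp (- (nu / (32 * sd ^ 4))))" .
  have "emeasure ?E (B1 \<union> B2) \<le> emeasure ?E B1 + emeasure ?E B2"
    by (rule emeasure_subadditive[OF B1 B2])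
  also have "\<dots> \<le> ennreal (exp (- nu)) + ennreal (2 * exp (- (nu / (32 * sd ^ 4))))"
    by (intro add_mono e1 e2)
  also have "\<dots> = ennreal (exp (- nu) + 2 * exp (- (nu / (32 * sd ^ 4))))" by (simp add: ennreal_plus)
  finally have meas: "emeasure ?E (B1 \<union> B2) \<le> ennreal (exp (- nu) + 2 * exp (- (nu / (32 * sd ^ 4))))" .
  have "typical_noise n p L U v X theta sd eps e" if e: "e \<in> space ?E - (B1 \<union> B2)" for e
    unfolding typical_noise_def
  proof (intro conjI ballI allI)
    fix k b assume k: "k \<in> {L..U}"
    let ?N = "\<Sum>i\<in>?D. (dotp p (X i) (\<lambda>l. T_embed p k v b l - theta l))\<^sup>2"
    have "(\<Sum>i\<in>?D. e i * dotp p (X i) (\<lambda>l. T_embed p k v b l - theta l))\<^sup>2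
        \<le> (\<Sum>q<r. (\<Sum>i\<in>?D. e i * u q i)\<^sup>2) * ?N"
      using ru(3) k by auto
    also have "\<dots> \<le> (12 * sd\<^sup>2 * (real n * eps\<^sup>2)) * ?N"
      using e by (intro mult_right_mono sum_nonneg) (auto simp: B1_def nu_def not_less algebra_simps)
    finally show "(\<Sum>i\<in>?D. e i * dotp p (X i) (\<lambda>l. T_embed p k v b l - theta l))\<^sup>2
        \<le> 12 * sd\<^sup>2 * (real n * eps\<^sup>2) * ?N" .
  next
    show "\<bar>(\<Sum>i\<in>?D. (e i)\<^sup>2) - real n / 2 * sd\<^sup>2\<bar> \<le> real n / 2 * eps"
      using e unfolding B2_def card by (auto simp: not_less)
  qed
  with meas B1 B2 show ?thesis unfolding nu_def by (intro bexI[of _ "B1 \<union> B2"]) auto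
qed

section \<open>Moments of the mean covariate of the second half\<close>

context
  fixes p :: nat and Q :: "rvec measure"
  assumes Q: "prob_space Q" and sQ: "sets Q = sets (vec_space p)"
    and int: "\<And>i j. i \<in> {1..p} \<Longrightarrow> j \<in> {1..p} \<Longrightarrow> integrable Q (\<lambda>x. x i * x j)"
    and mean: "\<And>j. j \<in> {1..p} \<Longrightarrow> (\<integral>x. x j \<partial>Q) = 0"
begin

lemma coord_measurable: "j \<in> {1..p} \<Longrightarrow> (\<lambda>x. x j) \<in> borel_measurable Q"
  unfolding measurable_cong_sets[OF sQ refl] vec_space_def by simp

lemma dotp_measurable: "(\<lambda>x. dotp p x u) \<in> borel_measurable Q"
  unfolding dotp_def using coord_measurable by (intro borel_measurable_sum borel_measurable_times) auto

text \<open>The integral of a non-integrable function is zero by convention, so the mean-zero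
  hypothesis acquires its meaning only with this.\<close>

lemma coord_integrable: assumes "j \<in> {1..p}" shows "integrable Q (\<lambda>x. x j)"
proof -
  interpret prob_space Q by (rule Q)
  show ?thesis
    by (rule square_integrable_imp_integrable)
      (use int[OF assms assms] coord_measurable[OF assms] in \<open>auto simp: power2_eq_square\<close>)
qed

lemma dotp_integrable: "integrable Q (\<lambda>x. dotp p x u)" "(\<integral>x. dotp p x u \<partial>Q) = 0"
proof -
  show "integrable Q (\<lambda>x. dotp p x u)"
    unfolding dotp_def using coord_integrable by (intro Bochner_Integration.integrable_sum
        integrable_mult_left) auto
  show "(\<integral>x. dotp p x u \<partial>Q) = 0"
    unfolding dotp_def using coord_integrable mean
    by (subst Bochner_Integration.integral_sum) (auto intro!: integrable_mult_left sum.neutral)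
qed

lemma dotp_second_moment:
  "integrable Q (\<lambda>x. (dotp p x u)\<^sup>2)" "(\<integral>x. (dotp p x u)\<^sup>2 \<partial>Q) = quad_form p (second_moment Q) u"
proof -
  have sq: "(dotp p x u)\<^sup>2 = (\<Sum>i=1..p. \<Sum>j=1..p. (u i * u j) * (x i * x j))" for x
    by (simp add: dotp_def power2_eq_square sum_product ac_simps)
  show "integrable Q (\<lambda>x. (dotp p x u)\<^sup>2)"
    unfolding sq using int by (intro Bochner_Integration.integrable_sum integrable_mult_right) auto
  have "(\<integral>x. (dotp p x u)\<^sup>2 \<partial>Q) = (\<Sum>i=1..p. \<Sum>j=1..p. (u i * u j) * (\<integral>x. x i * x j \<partial>Q))"
  proof -
    have "(\<integral>x. (dotp p x u)\<^sup>2 \<partial>Q) = (\<Sum>i=1..p. \<integral>x. (\<Sum>j=1..p. (u i * u j) * (x i * x j)) \<partial>Q)"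
      unfolding sq using int
      by (intro Bochner_Integration.integral_sum Bochner_Integration.integrable_sum
          integrable_mult_right) auto
    also have "\<dots> = (\<Sum>i=1..p. \<Sum>j=1..p. \<integral>x. (u i * u j) * (x i * x j) \<partial>Q)"
      using int by (intro sum.cong refl Bochner_Integration.integral_sum integrable_mult_right) auto
    finally show ?thesis by simp
  qed
  also have "\<dots> = quad_form p (second_moment Q) u"
    by (simp add: quad_form_def dotp_def matvec_def second_moment_def sum_distrib_left ac_simps)
  finally show "(\<integral>x. (dotp p x u)\<^sup>2 \<partial>Q) = quad_form p (second_moment Q) u" .
qed

lemma second_moment_nonneg: "0 \<le> quad_form p (second_moment Q) u"
  unfolding dotp_second_moment(2)[symmetric] by (intro integral_nonneg_AE) auto

lemma sample_mean_dotp_measurable: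
  "(\<lambda>x. dotp p (\<lambda>j. 2 / real n * (\<Sum>i=n div 2 + 1..n. x i j)) u)
    \<in> borel_measurable (Pi\<^sub>M {n div 2 + 1..n} (\<lambda>_. Q))"
proof -
  have "dotp p (\<lambda>j. 2 / real n * (\<Sum>i=n div 2 + 1..n. x i j)) u
      = (\<Sum>i=n div 2 + 1..n. 2 / real n * dotp p (x i) u)" for x :: "nat \<Rightarrow> rvec"
    unfolding sum_distrib_left by (rule dotp_sum_left)
  then show ?thesis using dotp_measurable by simp measurable
qed

lemma sample_mean_second_moment:
  assumes n: "even n" "0 < n"
  shows "(\<integral>\<^sup>+x. ennreal ((dotp p (\<lambda>j. 2 / real n * (\<Sum>i=n div 2 + 1..n. x i j)) u)\<^sup>2) \<partial>Pi\<^sub>M {n div 2 +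
      1..n} (\<lambda>_. Q))
    = ennreal (2 / real n * quad_form p (second_moment Q) u)"
proof -
  let ?D = "{n div 2 + 1..n}"
  have card: "real (card ?D) = real n / 2" using n by (auto elim!: evenE)
  have eq: "(dotp p (\<lambda>j. 2 / real n * (\<Sum>i\<in>?D. x i j)) u)\<^sup>2 = (2 / real n)\<^sup>2 * (\<Sum>i\<in>?D. dotp p (x i)
      u)\<^sup>2" for x :: "nat \<Rightarrow> rvec"
  proof -
    have "dotp p (\<lambda>j. \<Sum>i\<in>?D. 2 / real n * x i j) u = (\<Sum>i\<in>?D. 2 / real n * dotp p (x i) u)"
      by (rule dotp_sum_left)
    then have "dotp p (\<lambda>j. 2 / real n * (\<Sum>i\<in>?D. x i j)) u = 2 / real n * (\<Sum>i\<in>?D. dotp p (x i) u)"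
      by (simp only: sum_distrib_left)
    then show ?thesis by (simp only: power_mult_distrib)
  qed
  have m: "(\<lambda>x. ennreal ((\<Sum>i\<in>?D. dotp p (x i) u)\<^sup>2)) \<in> borel_measurable (Pi\<^sub>M ?D (\<lambda>_. Q))"
    using dotp_measurable by measurable
  have "(\<integral>\<^sup>+x. ennreal ((dotp p (\<lambda>j. 2 / real n * (\<Sum>i=n div 2 + 1..n. x i j)) u)\<^sup>2) \<partial>Pi\<^sub>M ?D (\<lambda>_. Q))
      = (\<integral>\<^sup>+x. ennreal ((2 / real n)\<^sup>2) * ennreal ((\<Sum>i\<in>?D. dotp p (x i) u)\<^sup>2) \<partial>Pi\<^sub>M ?D (\<lambda>_. Q))"
    unfolding eq by (simp add: ennreal_mult')
  also have "\<dots> = ennreal ((2 / real n)\<^sup>2) * ennreal (real n / 2 * quad_form p (second_moment Q) u)"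
  proof -
    have "(\<integral>\<^sup>+x. ennreal ((\<Sum>i\<in>?D. dotp p (x i) u)\<^sup>2) \<partial>Pi\<^sub>M ?D (\<lambda>_. Q))
        = ennreal (real n / 2 * quad_form p (second_moment Q) u)"
      unfolding card[symmetric] dotp_second_moment(2)[symmetric]
      by (rule nn_integral_square_sum_iid[OF Q _ dotp_second_moment(1) dotp_integrable]) simp
    then show ?thesis by (simp only: nn_integral_cmult[OF m])
  qed
  also have "\<dots> = ennreal (2 / real n * quad_form p (second_moment Q) u)"
    using n second_moment_nonneg by (simp add: ennreal_mult'[symmetric] power2_eq_square)
  finally show ?thesis .
qed

end

text \<open>The three mean conditions of \<open>split_geometry\<close>, each divided by its
  threshold, are added; if one fails the sum exceeds 1, so one use of Markov's inequality covers
  all. The mean has second moment 2 / n times the population form: the first two conditions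
  contribute O(1 / n), and the third 4 U / n \<le> 4 eps^2, by n * lam (L + 1)^2 \<le> 1.\<close>

lemma (in half_geometry) mean_terms_bound:
  fixes Q :: "rvec measure"
  assumes even: "even n" and eps: "0 < eps" and Ln: "L \<le> n"
    and Q: "prob_space Q" and sQ: "sets Q = sets (vec_space p)"
    and int: "\<And>i j. i \<in> {1..p} \<Longrightarrow> j \<in> {1..p} \<Longrightarrow> integrable Q (\<lambda>x. x i * x j)"
    and mean: "\<And>j. j \<in> {1..p} \<Longrightarrow> (\<integral>x. x j \<partial>Q) = 0"
    and S: "S = second_moment Q"
  defines "mn \<equiv> \<lambda>(x :: nat \<Rightarrow> rvec) j. 2 / real n * (\<Sum>i=n div 2 + 1..n. x i j)"
  shows "(\<integral>\<^sup>+x. ennreal ((dotp p (mn x) bstar)\<^sup>2 / eps\<^sup>2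
      + (\<Sum>i=1..L. la i * (dotp p (mn x) (v i))\<^sup>2) / real n
      + real n * (\<Sum>i=L+1..U. la i * (dotp p (mn x) (v i))\<^sup>2)) \<partial>Pi\<^sub>M {n div 2 + 1..n} (\<lambda>_. Q))
    \<le> ennreal ((2 + 4 * K\<^sup>2) / real n + 4 * eps\<^sup>2)"
proof -
  let ?P = "Pi\<^sub>M {n div 2 + 1..n} (\<lambda>_. Q)"
  have n0: "0 < n" using n by simp
  have mm: "(\<lambda>x. (dotp p (mn x) u)\<^sup>2) \<in> borel_measurable ?P" for u
    unfolding mn_def by (intro borel_measurable_power sample_mean_dotp_measurable[OF Q sQ int mean])
  have val: "(\<integral>\<^sup>+x. ennreal ((dotp p (mn x) u)\<^sup>2) \<partial>?P) = ennreal (2 / real n * quad_form p S u)" for u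
    unfolding mn_def S by (rule sample_mean_second_moment[OF Q sQ int mean even n0])
  have cm: "(\<integral>\<^sup>+x. ennreal (c * (dotp p (mn x) u)\<^sup>2) \<partial>?P) = ennreal (c * (2 / real n * quad_form p S u))"
    if "0 \<le> c" for c u
  proof -
    have "(\<integral>\<^sup>+x. ennreal (c * (dotp p (mn x) u)\<^sup>2) \<partial>?P) = (\<integral>\<^sup>+x. ennreal c * ennreal ((dotp p (mn x)
        u)\<^sup>2) \<partial>?P)"
      using that by (simp add: ennreal_mult')
    also have "\<dots> = ennreal c * ennreal (2 / real n * quad_form p S u)"
      unfolding val[symmetric]
      by (intro nn_integral_cmult measurable_compose[OF mm[of u] measurable_ennreal])
    finally show ?thesis using that by (simp only: ennreal_mult'[symmetric])
  qed
  define T where "T = quad_form p S bstar / eps\<^sup>2 + (\<Sum>i=1..L. la i * quad_form p S (v i)) / real n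
    + real n * (\<Sum>i=L+1..U. la i * quad_form p S (v i))"
  define c where "c = (\<lambda>i. if i \<le> L then la i / real n else real n * la i)"
  have c0: "0 \<le> c i" if "i \<in> {1..U}" for i
    using that la_pos[OF that] by (auto simp: c_def less_imp_le)
  have ivl: "{1..U} = {1..L} \<union> {L+1..U}" using LU by auto
  have expand: "a1 / eps\<^sup>2 + (\<Sum>i=1..L. la i * g i) / real n + real n * (\<Sum>i=L+1..U. la i * g i)
      = (1 / eps\<^sup>2) * a1 + (\<Sum>i=1..U. c i * g i)" for a1 and g :: "nat \<Rightarrow> real"
    unfolding ivl by (subst sum.union_disjoint) (auto simp: c_def sum_divide_distrib
        sum_distrib_left mult.assoc)
  have "(\<integral>\<^sup>+x. ennreal ((dotp p (mn x) bstar)\<^sup>2 / eps\<^sup>2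
      + (\<Sum>i=1..L. la i * (dotp p (mn x) (v i))\<^sup>2) / real n
      + real n * (\<Sum>i=L+1..U. la i * (dotp p (mn x) (v i))\<^sup>2)) \<partial>?P)
    = (\<integral>\<^sup>+x. ennreal ((1 / eps\<^sup>2) * (dotp p (mn x) bstar)\<^sup>2) + (\<Sum>i=1..U. ennreal (c i * (dotp p (mn x)
        (v i))\<^sup>2)) \<partial>?P)"
    unfolding expand
    by (intro nn_integral_cong, subst sum_ennreal) (auto intro!: ennreal_plus sum_nonneg c0
        mult_nonneg_nonneg)
  also have "\<dots> = ennreal ((1 / eps\<^sup>2) * (2 / real n * quad_form p S bstar))
      + (\<Sum>i=1..U. ennreal (c i * (2 / real n * quad_form p S (v i))))"
  proof -
    have "(\<integral>\<^sup>+x. (\<Sum>i=1..U. ennreal (c i * (dotp p (mn x) (v i))\<^sup>2)) \<partial>?P)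
        = (\<Sum>i=1..U. ennreal (c i * (2 / real n * quad_form p S (v i))))"
      using mm c0 by (subst nn_integral_sum) (auto simp: cm)
    moreover have "(\<integral>\<^sup>+x. ennreal ((1 / eps\<^sup>2) * (dotp p (mn x) bstar)\<^sup>2) \<partial>?P)
        = ennreal ((1 / eps\<^sup>2) * (2 / real n * quad_form p S bstar))" by (rule cm) simp
    ultimately show ?thesis using mm by (subst nn_integral_add) auto
  qed
  also have "\<dots> = ennreal ((1 / eps\<^sup>2) * (2 / real n * quad_form p S bstar)
      + (\<Sum>i=1..U. c i * (2 / real n * quad_form p S (v i))))"
    by (subst sum_ennreal)
      (auto intro!: ennreal_plus[symmetric] sum_nonneg c0 mult_nonneg_nonneg divide_nonneg_nonneg
          quad_S_nonneg)
  also have "(1 / eps\<^sup>2) * (2 / real n * quad_form p S bstar) + (\<Sum>i=1..U. c i * (2 / real n *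
      quad_form p S (v i)))
      = 2 / real n * T"
    unfolding T_def expand by (simp add: distrib_left sum_distrib_left ac_simps)
  also have "\<dots> \<le> (2 + 4 * K\<^sup>2) / real n + 4 * eps\<^sup>2"
  proof -
    have vn: "dotp p (v i) (v i) = 1" if "i \<in> {1..p}" for i using on[OF that that] by simp
    have "quad_form p S bstar / eps\<^sup>2 \<le> 1" using quad_S_bstar eps by simp
    moreover have "(\<Sum>i=1..L. la i * quad_form p S (v i)) / real n \<le> 2 * K\<^sup>2"
    proof -
      have "(\<Sum>i=1..L. la i * quad_form p S (v i)) \<le> (\<Sum>i=1..L. 9 / 8 * K * (K * 1))"
      proof (rule sum_mono)
        fix i assume i: "i \<in> {1..L}"
        then have ip: "i \<in> {1..p}" using LU by auto
        show "la i * quad_form p S (v i) \<le> 9 / 8 * K * (K * 1)"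
          using la_K[OF ip] quad_S_le_K[of "v i"] vn[OF ip] K quad_S_nonneg by (intro mult_mono) auto
      qed
      also have "\<dots> = real L * (9 / 8 * K\<^sup>2)" by (simp add: power2_eq_square)
      also have "\<dots> \<le> real n * (2 * K\<^sup>2)"
      proof (rule mult_mono)
        show "real L \<le> real n" using Ln by simp
      qed auto
      finally show ?thesis using n0 by (simp add: field_simps)
    qed
    moreover have "real n * (\<Sum>i=L+1..U. la i * quad_form p S (v i)) \<le> 2 * real U"
    proof -
      define x where "x = lam (L + 1)"
      have "(\<Sum>i=L+1..U. la i * quad_form p S (v i)) \<le> (\<Sum>i=L+1..U. 9 / 8 * x * (10 / 8 * x))"
      proof (rule sum_mono)
        fix i assume i: "i \<in> {L+1..U}"
        then have ip: "i \<in> {1..p}" "i \<in> {L+1..p}" using LU by auto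
        have "quad_form p S (v i) \<le> 10 / 8 * lam (L + 1) * dotp p (v i) (v i)"
          using i LU by (intro quad_S_tail) (auto simp: on)
        then show "la i * quad_form p S (v i) \<le> 9 / 8 * x * (10 / 8 * x)"
          using la_tail[OF ip(2)] vn[OF ip(1)] quad_S_nonneg lam_tail_nonneg
          by (intro mult_mono) (auto simp: x_def)
      qed
      also have "\<dots> = real (U - L) * (90 / 64 * x\<^sup>2)" by (simp add: power2_eq_square)
      also have "\<dots> \<le> real U * (2 * x\<^sup>2)" by (intro mult_mono) auto
      finally have "real n * (\<Sum>i=L+1..U. la i * quad_form p S (v i)) \<le> real n * (real U * (2 * x\<^sup>2))"
        by (intro mult_left_mono) auto
      also have "\<dots> = 2 * real U * (real n * x\<^sup>2)" by simp
      also have "\<dots> \<le> 2 * real U * 1" using lam_sq by (intro mult_left_mono) (auto simp: x_def)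
      finally show ?thesis by simp
    qed
    ultimately have "T \<le> 1 + 2 * K\<^sup>2 + 2 * real U" by (simp add: T_def)
    then have "2 / real n * T \<le> 2 / real n * (1 + 2 * K\<^sup>2 + 2 * real U)" by (intro mult_left_mono) auto
    also have "\<dots> = (2 + 4 * K\<^sup>2) / real n + 4 * (real U / real n)" by (simp add: add_divide_distrib
        distrib_left)
    also have "real U / real n \<le> eps\<^sup>2" using U_eps n0 by (simp add: field_simps)
    finally show ?thesis by simp
  qed
  finally show ?thesis by (simp add: ennreal_leI)
qed

section \<open>The law of the data\<close>

lemma obs_map_measurable:
  assumes sQ: "sets Q = sets (vec_space p)"
  shows "(\<lambda>(x, e). (dotp p x theta + e, x)) \<in> Q \<Otimes>\<^sub>M normal_law sd \<rightarrow>\<^sub>M obs_space p"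
proof -
  have id: "(\<lambda>x. x) \<in> Q \<rightarrow>\<^sub>M vec_space p"
    by (subst measurable_cong_sets[OF sQ refl]) simp
  have "(\<lambda>x. dotp p x theta) \<in> borel_measurable (vec_space p)"
    unfolding dotp_def vec_space_def by measurable
  then have [measurable]: "(\<lambda>x. dotp p x theta) \<in> borel_measurable Q"
    by (subst measurable_cong_sets[OF sQ refl])
  have fst[measurable]: "fst \<in> Q \<Otimes>\<^sub>M normal_law sd \<rightarrow>\<^sub>M vec_space p"
    using measurable_compose[OF measurable_fst id, of "normal_law sd"] by simp
  have "(\<lambda>z. (dotp p (fst z) theta + snd z, fst z)) \<in> Q \<Otimes>\<^sub>M normal_law sd \<rightarrow>\<^sub>M borel \<Otimes>\<^sub>M vec_space p"
    by (intro measurable_Pair borel_measurable_add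
        measurable_compose[OF measurable_fst \<open>(\<lambda>x. dotp p x theta) \<in> borel_measurable Q\<close>]) measurable
  then show ?thesis by (simp add: obs_space_def split_beta')
qed

lemma sets_obs_law: "sets (obs_law p Q theta sd) = sets (obs_space p)"
  by (simp add: obs_law_def)

lemma space_obs_law: "space (obs_law p Q theta sd) = space (obs_space p)"
  by (simp add: obs_law_def)

lemma prob_space_obs_law:
  assumes Q: "prob_space Q" and sQ: "sets Q = sets (vec_space p)" and sd: "0 < sd"
  shows "prob_space (obs_law p Q theta sd)"
proof -
  interpret Q: prob_space Q by fact
  interpret N: prob_space "normal_law sd" by (rule prob_space_normal_law[OF sd])
  interpret P: pair_prob_space Q "normal_law sd" ..
  show ?thesis unfolding obs_law_def by (rule P.P.prob_space_distr[OF obs_map_measurable[OF sQ]])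
qed

lemma prob_space_data_law:
  assumes "prob_space Q" "sets Q = sets (vec_space p)" "0 < sd"
  shows "prob_space (data_law n p Q theta sd)"
  unfolding data_law_def by (intro prob_space_PiM prob_space_obs_law assms)

lemma sets_data_law: "sets (data_law n p Q theta sd) = sets (Pi\<^sub>M {1..n} (\<lambda>_. obs_space p))"
  unfolding data_law_def by (intro sets_PiM_cong refl sets_obs_law)

text \<open>The order of integration is that of conditioning: the first half fixes the eigenvectors,
  the covariates of the second half fix the span of the error vectors, and the noise is then an
  independent Gaussian vector.\<close>

lemma nn_integral_data_law:
  assumes Q: "prob_space Q" and sQ: "sets Q = sets (vec_space p)" and sd: "0 < sd"
    and F: "F \<in> borel_measurable (data_law n p Q theta sd)"
  defines "D1 \<equiv> {1..n div 2}" and "D2 \<equiv> {n div 2 + 1..n}"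
  shows "(\<integral>\<^sup>+d. F d \<partial>data_law n p Q theta sd) =
    (\<integral>\<^sup>+d1. \<integral>\<^sup>+x. \<integral>\<^sup>+e. F (merge D1 D2 (d1, \<lambda>i\<in>D2. (dotp p (x i) theta + e i, x i)))
      \<partial>Pi\<^sub>M D2 (\<lambda>_. normal_law sd) \<partial>Pi\<^sub>M D2 (\<lambda>_. Q) \<partial>Pi\<^sub>M D1 (\<lambda>_. obs_law p Q theta sd))"
proof -
  let ?O = "obs_law p Q theta sd"
  interpret O: product_sigma_finite "\<lambda>_ :: nat. ?O"
    by (rule product_sigma_finite_prob[OF prob_space_obs_law[OF Q sQ sd]])
  interpret N: product_sigma_finite "\<lambda>_ :: nat. normal_law sd"
    by (rule product_sigma_finite_prob[OF prob_space_normal_law[OF sd]])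
  have fin: "finite D1" "finite D2" "D1 \<inter> D2 = {}" and un: "{1..n} = D1 \<union> D2"
    by (auto simp: D1_def D2_def)
  interpret ND: sigma_finite_measure "Pi\<^sub>M D2 (\<lambda>_. normal_law sd)" by (rule N.sigma_finite[OF fin(2)])
  have F': "F \<in> borel_measurable (Pi\<^sub>M (D1 \<union> D2) (\<lambda>_. ?O))"
    using F unfolding data_law_def un .
  let ?P2 = "Pi\<^sub>M D2 (\<lambda>_. Q) \<Otimes>\<^sub>M Pi\<^sub>M D2 (\<lambda>_. normal_law sd)"
  define g where "g = (\<lambda>(x :: nat \<Rightarrow> rvec, e :: nat \<Rightarrow> real). \<lambda>i\<in>D2. (dotp p (x i) theta + e i, x i))"
  have PD2: "Pi\<^sub>M D2 (\<lambda>_. ?O) = distr ?P2 (Pi\<^sub>M D2 (\<lambda>_. obs_space p)) g"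
    using PiM_distr_pair[OF Q prob_space_normal_law[OF sd] fin(2) obs_map_measurable[OF sQ, of theta
        sd]]
    by (simp add: obs_law_def g_def)
  have gm: "g \<in> ?P2 \<rightarrow>\<^sub>M Pi\<^sub>M D2 (\<lambda>_. obs_space p)"
  proof -
    note [measurable] = obs_map_measurable[OF sQ, of theta sd]
    have "(\<lambda>(x, e). \<lambda>i\<in>D2. (\<lambda>(x, e). (dotp p x theta + e, x)) (x i, e i)) \<in> ?P2 \<rightarrow>\<^sub>M Pi\<^sub>M D2 (\<lambda>_.
        obs_space p)"
      by measurable
    then show ?thesis by (simp add: g_def)
  qed
  have "(\<integral>\<^sup>+d. F d \<partial>data_law n p Q theta sd) = (\<integral>\<^sup>+d1. \<integral>\<^sup>+y. F (merge D1 D2 (d1, y)) \<partial>Pi\<^sub>M D2 (\<lambda>_. ?O)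
      \<partial>Pi\<^sub>M D1 (\<lambda>_. ?O))"
    unfolding data_law_def un by (rule O.product_nn_integral_fold[OF fin(3,1,2) F'])
  also have "\<dots> = (\<integral>\<^sup>+d1. \<integral>\<^sup>+x. \<integral>\<^sup>+e. F (merge D1 D2 (d1, \<lambda>i\<in>D2. (dotp p (x i) theta + e i, x i)))
      \<partial>Pi\<^sub>M D2 (\<lambda>_. normal_law sd) \<partial>Pi\<^sub>M D2 (\<lambda>_. Q) \<partial>Pi\<^sub>M D1 (\<lambda>_. ?O))"
  proof (rule nn_integral_cong)
    fix d1 assume d1: "d1 \<in> space (Pi\<^sub>M D1 (\<lambda>_. ?O))"
    have "(\<lambda>y. merge D1 D2 (d1, y)) \<in> Pi\<^sub>M D2 (\<lambda>_. ?O) \<rightarrow>\<^sub>M Pi\<^sub>M (D1 \<union> D2) (\<lambda>_. ?O)"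
      by (rule measurable_compose[OF measurable_Pair1'[OF d1] measurable_merge])
    from measurable_compose[OF this F']
    have "(\<lambda>y. F (merge D1 D2 (d1, y))) \<in> borel_measurable (Pi\<^sub>M D2 (\<lambda>_. ?O))" .
    then have Fm: "(\<lambda>y. F (merge D1 D2 (d1, y))) \<in> borel_measurable (Pi\<^sub>M D2 (\<lambda>_. obs_space p))"
      by (subst (asm) measurable_cong_sets[OF sets_PiM_cong[OF refl sets_obs_law] refl])
    have "(\<integral>\<^sup>+y. F (merge D1 D2 (d1, y)) \<partial>Pi\<^sub>M D2 (\<lambda>_. ?O)) = (\<integral>\<^sup>+z. F (merge D1 D2 (d1, g z)) \<partial>?P2)"
      unfolding PD2 by (rule nn_integral_distr[OF gm]) (use Fm in simp)
    also have "\<dots> = (\<integral>\<^sup>+x. \<integral>\<^sup>+e. F (merge D1 D2 (d1, g (x, e))) \<partial>Pi\<^sub>M D2 (\<lambda>_. normal_law sd) \<partial>Pi\<^sub>M D2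
        (\<lambda>_. Q))"
      by (rule ND.nn_integral_fst[symmetric]) (rule measurable_compose[OF gm Fm])
    finally show "(\<integral>\<^sup>+y. F (merge D1 D2 (d1, y)) \<partial>Pi\<^sub>M D2 (\<lambda>_. ?O))
      = (\<integral>\<^sup>+x. \<integral>\<^sup>+e. F (merge D1 D2 (d1, \<lambda>i\<in>D2. (dotp p (x i) theta + e i, x i)))
      \<partial>Pi\<^sub>M D2 (\<lambda>_. normal_law sd) \<partial>Pi\<^sub>M D2 (\<lambda>_. Q))" by (simp add: g_def)
  qed
  finally show ?thesis .
qed

definition swap_halves :: "nat \<Rightarrow> dataset \<Rightarrow> dataset" where
  "swap_halves n d = (\<lambda>i\<in>{1..n}. d (if i \<le> n div 2 then i + n div 2 else i - n div 2))"

lemma distr_swap_halves: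
  fixes theta :: rvec
  assumes "prob_space Q" "sets Q = sets (vec_space p)" "0 < sd" and n: "even n"
  defines "P \<equiv> data_law n p Q theta sd"
  shows "distr P P (swap_halves n) = P" "swap_halves n \<in> P \<rightarrow>\<^sub>M P"
proof -
  let ?t = "\<lambda>i. if i \<le> n div 2 then i + n div 2 else i - n div 2"
  let ?O = "obs_law p Q theta sd"
  have tin: "?t i \<in> {1..n}" if "i \<in> {1..n}" for i using n that by (auto elim!: evenE)
  have inj: "inj_on ?t {1..n}" using n by (auto simp: inj_on_def elim!: evenE split: if_splits)
  have "distr (Pi\<^sub>M {1..n} (\<lambda>_. ?O)) (Pi\<^sub>M {1..n} (\<lambda>_. ?O)) (\<lambda>d. \<lambda>i\<in>{1..n}. d (?t i)) = Pi\<^sub>M {1..n}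
      (\<lambda>_. ?O)"
    using distr_PiM_reindex[of "{1..n}" "\<lambda>_. ?O" ?t "{1..n}"] prob_space_obs_law[OF assms(1,2,3)]
        inj tin by auto
  then show "distr P P (swap_halves n) = P"
    unfolding P_def data_law_def swap_halves_def[abs_def] .
  show "swap_halves n \<in> P \<rightarrow>\<^sub>M P"
    unfolding P_def data_law_def swap_halves_def[abs_def]
    by (intro measurable_restrict measurable_component_singleton tin)
qed

section \<open>Measurability of the posterior\<close>

lemma measurable_normal_density_compose [measurable (raw)]:
  assumes [measurable]: "f \<in> borel_measurable M" "g \<in> borel_measurable M" "h \<in> borel_measurable M"
  shows "(\<lambda>x. normal_density (f x) (g x) (h x)) \<in> borel_measurable M"
  unfolding normal_density_def by measurable

text \<open>Only the eigenvectors come with a measurability hypothesis. The eigenvalues are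
  recovered from them as values of the sample quadratic form, which \<open>LA\<close> spells out.
  Vectors are functions on all indices, so the set in question must depend on the parameter through
  its first p coordinates; this is the role of B'.\<close>

lemma posterior_measurable:
  fixes vhat :: "dataset \<Rightarrow> nat \<Rightarrow> rvec" and lamhat :: "dataset \<Rightarrow> rvec"
  assumes sM: "sets M = sets (Pi\<^sub>M {1..n} (\<lambda>_. obs_space p))" and U: "U < p"
    and vm: "\<And>i j. i \<in> {1..p} \<Longrightarrow> j \<in> {1..p} \<Longrightarrow> (\<lambda>d. vhat d i j) \<in> borel_measurable (half_space n p)"
    and es: "\<And>d. d \<in> space (half_space n p) \<Longrightarrow> eigensystem p (sample_cov n d) (lamhat d) (vhat d)"
    and B: "\<And>z. B z = B' (restrict (fst z) {1..p}) (snd z)"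
    and B'm: "(\<lambda>z. B' (fst z) (snd z)) \<in> measurable (vec_space p \<Otimes>\<^sub>M borel) (count_space UNIV)"
  shows "(\<lambda>d. posterior n p R L U f eta xi (lamhat (first_half n d)) (vhat (first_half n d)) d
      (Collect B)) \<in> borel_measurable M"
proof -
  have half: "first_half n \<in> M \<rightarrow>\<^sub>M half_space n p"
    unfolding first_half_def[abs_def] half_space_def measurable_cong_sets[OF sM refl]
    by (rule measurable_restrict_subset) auto
  \<comment> \<open>Extension by zero outside the index ranges makes the coordinate functions
    measurable for all indices, so that sums and products over them are measurable without side
    conditions.\<close>
  define X where "X = (\<lambda>i j (d :: dataset). if i \<in> {1..n} \<and> j \<in> {1..p} then snd (d i) j else 0)"
  define Y where "Y = (\<lambda>i (d :: dataset). if i \<in> {1..n} then fst (d i) else 0)"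
  define V where "V = (\<lambda>i j d. if i \<in> {1..p} \<and> j \<in> {1..p} then vhat (first_half n d) i j else 0)"
  have obs: "(\<lambda>d. d i) \<in> M \<rightarrow>\<^sub>M obs_space p" if "i \<in> {1..n}" for i
    unfolding measurable_cong_sets[OF sM refl] using that by (rule measurable_component_singleton)
  have [measurable]: "X i j \<in> borel_measurable M" for i j
  proof (cases "i \<in> {1..n} \<and> j \<in> {1..p}")
    case True
    then have "j \<in> {1..p}" by simp
    then have "(\<lambda>z. snd z j) \<in> borel_measurable (obs_space p)"
      unfolding obs_space_def vec_space_def
      by (intro measurable_compose[OF measurable_snd] measurable_component_singleton)
    from measurable_compose[OF obs this] True show ?thesis by (simp add: X_def)
  next
    case False
    then have "X i j = (\<lambda>_. 0)" by (auto simp: X_def fun_eq_iff)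
    then show ?thesis by simp
  qed
  have [measurable]: "Y i \<in> borel_measurable M" for i
  proof (cases "i \<in> {1..n}")
    case True
    have "fst \<in> borel_measurable (obs_space p)" unfolding obs_space_def by measurable
    from measurable_compose[OF obs this] True show ?thesis by (simp add: Y_def)
  next
    case False
    then have "Y i = (\<lambda>_. 0)" by (auto simp: Y_def fun_eq_iff)
    then show ?thesis by simp
  qed
  have [measurable]: "V i j \<in> borel_measurable M" for i j
  proof (cases "i \<in> {1..p} \<and> j \<in> {1..p}")
    case True
    from measurable_compose[OF half vm] True show ?thesis by (simp add: V_def)
  next
    case False
    then have "V i j = (\<lambda>_. 0)" by (auto simp: V_def fun_eq_iff)
    then show ?thesis by simp
  qed
  define W where "W = (\<lambda>a d. 2 / real n * (\<Sum>i=1..n div 2. X i a d))"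
  define LA where "LA = (\<lambda>i d. \<Sum>a=1..p. V i a d * (\<Sum>b=1..p. (2 / real n *
     (\<Sum>k=1..n div 2. (X k a d - W a d) * (X k b d - W b d))) * V i b d))"
  have [measurable]: "W a \<in> borel_measurable M" for a unfolding W_def by measurable
  have [measurable]: "LA i \<in> borel_measurable M" for i unfolding LA_def by measurable
  have LA: "lamhat (first_half n d) i = LA i d" if d: "d \<in> space M" and i: "i \<in> {1..p}" for d i
  proof -
    have "first_half n d \<in> space (half_space n p)" using measurable_space[OF half d] .
    from eigensystem_eigenvalue[OF es[OF this] i]
    have "lamhat (first_half n d) i = quad_form p (sample_cov n (first_half n d)) (vhat (first_half
        n d) i)" .
    also have "\<dots> = LA i d"
    proof -
      have sx: "snd (first_half n d k) a = X k a d" if "k \<in> {1..n div 2}" "a \<in> {1..p}" for k a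
        using that by (auto simp: first_half_def X_def)
      have sm: "sample_mean n (first_half n d) a = W a d" if "a \<in> {1..p}" for a
        unfolding sample_mean_def W_def using sx that by (intro arg_cong2[where f="(*)"] refl
            sum.cong) auto
      have "sample_cov n (first_half n d) a b = 2 / real n *
          (\<Sum>k=1..n div 2. (X k a d - W a d) * (X k b d - W b d))" if "a \<in> {1..p}" "b \<in> {1..p}" for a b
        unfolding sample_cov_def using sx sm that by (intro arg_cong2[where f="(*)"] refl sum.cong) auto
      then show ?thesis
        unfolding quad_form_def dotp_def matvec_def LA_def using i
        by (intro sum.cong refl arg_cong2[where f="(*)"]) (auto simp: V_def)
    qed
    finally show ?thesis .
  qed
  define kern where "kern = (\<lambda>k d b. exp (- (\<Sum>i=1..k. (b i)\<^sup>2 / LA i d)) *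
    (if ereal (sqrt (\<Sum>i=1..k. LA i d * (b i)\<^sup>2)) \<le> R then 1 else (0::real)))"
  have kern: "beta_kernel k (lamhat (first_half n d)) R b = kern k d b" if "d \<in> space M" "k \<le> U" for
      k d b
  proof -
    have "lamhat (first_half n d) i = LA i d" if "i \<in> {1..k}" for i
      using LA[OF \<open>d \<in> space M\<close>, of i] that \<open>k \<le> U\<close> U by auto
    then have "(\<Sum>i=1..k. (b i)\<^sup>2 / lamhat (first_half n d) i) = (\<Sum>i=1..k. (b i)\<^sup>2 / LA i d)"
      "(\<Sum>i=1..k. lamhat (first_half n d) i * (b i)\<^sup>2) = (\<Sum>i=1..k. LA i d * (b i)\<^sup>2)"
      by (auto intro!: sum.cong)
    then show ?thesis unfolding beta_kernel_eq prior_form_def kern_def by simp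
  qed
  have kern_m: "(\<lambda>(d, b). kern k d b) \<in> borel_measurable (M \<Otimes>\<^sub>M Pi\<^sub>M {1..k} (\<lambda>_. lborel))" for k
    unfolding kern_def by measurable
  define ZZ where "ZZ = (\<lambda>k d. \<integral>b. kern k d b \<partial>Pi\<^sub>M {1..k} (\<lambda>_. lborel))"
  have [measurable]: "ZZ k \<in> borel_measurable M" for k
  proof -
    interpret sigma_finite_measure "Pi\<^sub>M {1..k} (\<lambda>_ :: nat. lborel :: real measure)" by (rule
        sigma_finite_PiM_lborel) simp
    show ?thesis unfolding ZZ_def by (rule borel_measurable_lebesgue_integral[OF kern_m])
  qed
  define TT where "TT = (\<lambda>k d (b :: rvec). \<lambda>j\<in>{1..p}. \<Sum>i=1..k. b i * V i j d)"
  have TT: "T_embed p k (vhat (first_half n d)) b = TT k d b" if "k \<le> U" for k d b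
    unfolding T_embed_def TT_def using that U by (auto simp: V_def fun_eq_iff restrict_def intro!:
        sum.cong)
  define lik where "lik = (\<lambda>k d b s. \<Prod>i=n div 2 + 1..n. normal_density (\<Sum>j=1..p. X i j d * (\<Sum>l=1..k.
      b l * V l j d)) (sqrt s) (Y i d))"
  have lik: "likelihood2 n p d (TT k d b) s = lik k d b s" for k d b s
    unfolding likelihood2_def lik_def dotp_def
    by (intro prod.cong refl arg_cong2[where f="\<lambda>x y. normal_density x (sqrt s) y"] sum.cong) (auto
        simp: X_def Y_def TT_def)
  define G where "G = (\<lambda>C k d b s. ennreal (kern k d b / ZZ k d * k_prior L U f k *
      inv_gauss_density eta xi s * lik k d b s) *
      indicator (Collect C) (TT k d b, s) * indicator {0<..} s)"
  have Gm: "(\<lambda>((d, b), s). G C k d b s) \<in> borel_measurable ((M \<Otimes>\<^sub>M Pi\<^sub>M {1..k} (\<lambda>_. lborel)) \<Otimes>\<^sub>M lborel)"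
    if C: "\<And>z. C z = C' (restrict (fst z) {1..p}) (snd z)"
      and C'm: "(\<lambda>z. C' (fst z) (snd z)) \<in> measurable (vec_space p \<Otimes>\<^sub>M borel) (count_space UNIV)" for
          C C' k
  proof -
    let ?P = "(M \<Otimes>\<^sub>M Pi\<^sub>M {1..k} (\<lambda>_. lborel :: real measure)) \<Otimes>\<^sub>M (lborel :: real measure)"
    have "(\<lambda>x. (TT k (fst (fst x)) (snd (fst x)), snd x)) \<in> ?P \<rightarrow>\<^sub>M vec_space p \<Otimes>\<^sub>M borel"
      unfolding TT_def vec_space_def by measurable
    from measurable_compose[OF this C'm]
    have "(\<lambda>x. C' (TT k (fst (fst x)) (snd (fst x))) (snd x)) \<in> measurable ?P (count_space UNIV)" by
        simp
    moreover have "C (TT k d b, s) = C' (TT k d b) s" for d b s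
      unfolding C by (simp add: TT_def)
    ultimately have [measurable]: "Measurable.pred ?P (\<lambda>x. C (TT k (fst (fst x)) (snd (fst x)), snd x))"
      by (simp add: split_beta' pred_def)
    have [measurable]: "(\<lambda>x. kern k (fst (fst x)) (snd (fst x))) \<in> borel_measurable ?P"
      using measurable_compose[OF measurable_fst kern_m, of k "lborel :: real measure"] by (simp
          add: split_beta')
    have [measurable]: "(\<lambda>x. lik k (fst (fst x)) (snd (fst x)) (snd x)) \<in> borel_measurable ?P"
      unfolding lik_def by measurable
    have ind: "indicator (Collect C) (TT k d b, s) = (if C (TT k d b, s) then 1 else (0 ::
        ennreal))" for d b s
      by (simp add: indicator_def)
    show ?thesis unfolding G_def ind split_beta' by measurable
  qed
  have pm: "post_mass n p R L U f eta xi (lamhat (first_half n d)) (vhat (first_half n d)) d (Collect C)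
      = (\<Sum>k=L..U. \<integral>\<^sup>+b. \<integral>\<^sup>+s. G C k d b s \<partial>lborel \<partial>Pi\<^sub>M {1..k} (\<lambda>_. lborel))" if d: "d \<in> space M" for d C
    unfolding post_mass_def
  proof (intro sum.cong refl nn_integral_cong)
    fix k b s assume "k \<in> {L..U}"
    then have k: "k \<le> U" by simp
    have "(\<integral>b'. beta_kernel k (lamhat (first_half n d)) R b' \<partial>Pi\<^sub>M {1..k} (\<lambda>_. lborel)) = ZZ k d"
      unfolding ZZ_def by (simp add: kern[OF d k])
    then show "ennreal (beta_prior k (lamhat (first_half n d)) R b * k_prior L U f k *
        inv_gauss_density eta xi s *
          likelihood2 n p d (T_embed p k (vhat (first_half n d)) b) s) *
          indicator (Collect C) (T_embed p k (vhat (first_half n d)) b, s) * indicator {0<..} s = G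
              C k d b s"
      by (simp add: G_def beta_prior_def kern[OF d k] TT[OF k] lik)
  qed
  have mass: "(\<lambda>d. \<Sum>k=L..U. \<integral>\<^sup>+b. \<integral>\<^sup>+s. G C k d b s \<partial>lborel \<partial>Pi\<^sub>M {1..k} (\<lambda>_. lborel)) \<in>
      borel_measurable M"
    if C: "\<And>z. C z = C' (restrict (fst z) {1..p}) (snd z)"
      and C'm: "(\<lambda>z. C' (fst z) (snd z)) \<in> measurable (vec_space p \<Otimes>\<^sub>M borel) (count_space UNIV)" for
          C C'
  proof (rule borel_measurable_sum)
    fix k
    interpret sigma_finite_measure "Pi\<^sub>M {1..k} (\<lambda>_ :: nat. lborel :: real measure)" by (rule
        sigma_finite_PiM_lborel) simp
    have "(\<lambda>z. \<integral>\<^sup>+s. G C k (fst z) (snd z) s \<partial>lborel) \<in> borel_measurable (M \<Otimes>\<^sub>M Pi\<^sub>M {1..k} (\<lambda>_. lborel))"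
      by (rule lborel.borel_measurable_nn_integral) (use Gm[OF C C'm, of k] in \<open>simp add: split_beta'\<close>)
    then show "(\<lambda>d. \<integral>\<^sup>+b. \<integral>\<^sup>+s. G C k d b s \<partial>lborel \<partial>Pi\<^sub>M {1..k} (\<lambda>_. lborel)) \<in> borel_measurable M"
      by (intro borel_measurable_nn_integral) (simp add: split_beta')
  qed
  have [measurable]: "(\<lambda>d. post_mass n p R L U f eta xi (lamhat (first_half n d)) (vhat (first_half
      n d)) d (Collect B)) \<in> borel_measurable M"
    using mass[OF B B'm] by (subst measurable_cong[OF pm])
  have "(\<lambda>d. post_mass n p R L U f eta xi (lamhat (first_half n d)) (vhat (first_half n d)) d
      (Collect (\<lambda>_. True))) \<in> borel_measurable M"
    using mass[of "\<lambda>_. True" "\<lambda>_ _. True"] by (subst measurable_cong[OF pm]) auto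
  then have [measurable]: "(\<lambda>d. post_mass n p R L U f eta xi (lamhat (first_half n d)) (vhat
      (first_half n d)) d UNIV) \<in> borel_measurable M"
    by simp
  show ?thesis unfolding posterior_def by measurable
qed

section \<open>A finite-sample deviation bound\<close>

lemma sample_cov_quad_form:
  "quad_form p (sample_cov n d) u = 2 / real n * (\<Sum>i=1..n div 2. (dotp p (snd (d i)) u - dotp p
      (sample_mean n d) u)\<^sup>2)"
proof -
  let ?c = "\<lambda>i a. snd (d i) a - sample_mean n d a"
  have "quad_form p (sample_cov n d) u = (\<Sum>a=1..p. \<Sum>b=1..p. \<Sum>i=1..n div 2. 2 / real n * ((?c i a * u
      a) * (?c i b * u b)))"
    unfolding quad_form_def dotp_def matvec_def sample_cov_def by (simp add: sum_distrib_left
        sum_distrib_right ac_simps)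
  also have "\<dots> = (\<Sum>i=1..n div 2. \<Sum>a=1..p. \<Sum>b=1..p. 2 / real n * ((?c i a * u a) * (?c i b * u b)))"
    by (subst sum.swap[of _ _ "{1..n div 2}"]) (simp add: sum.swap[of _ "{1..n div 2}"])
  also have "\<dots> = (\<Sum>i=1..n div 2. 2 / real n * (dotp p (?c i) u)\<^sup>2)"
    unfolding dotp_def power2_eq_square sum_product unfolding sum_distrib_left ..
  finally show ?thesis by (simp add: dotp_diff_left sum_distrib_left)
qed

lemma sample_cov_quad_form_nonneg: "0 \<le> quad_form p (sample_cov n d) u"
  unfolding sample_cov_quad_form by (intro mult_nonneg_nonneg sum_nonneg) auto

lemma sample_cov_quad_form_uncentred:
  assumes "even n" "0 < n"
  shows "quad_form p (sample_cov n d) u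
    = 2 / real n * (\<Sum>i=1..n div 2. (dotp p (snd (d i)) u)\<^sup>2) - (dotp p (sample_mean n d) u)\<^sup>2"
proof -
  define y where "y = (\<lambda>i. dotp p (snd (d i)) u)"
  define \<mu> where "\<mu> = dotp p (sample_mean n d) u"
  have mu: "\<mu> = 2 / real n * (\<Sum>i=1..n div 2. y i)"
  proof -
    have "sample_mean n d = (\<lambda>a. \<Sum>i=1..n div 2. 2 / real n * snd (d i) a)"
      by (simp add: sample_mean_def sum_distrib_left)
    then show ?thesis unfolding \<mu>_def y_def
      using dotp_sum_left[of p "\<lambda>_. 2 / real n" "\<lambda>i. snd (d i)" "{1..n div 2}" u] by (simp add:
          sum_distrib_left)
  qed
  have half: "real (n div 2) = real n / 2" using assms by (auto elim!: evenE)
  have "2 / real n * (\<Sum>i=1..n div 2. (y i - \<mu>)\<^sup>2)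
      = 2 / real n * (\<Sum>i=1..n div 2. (y i)\<^sup>2) - 2 * \<mu> * (2 / real n * (\<Sum>i=1..n div 2. y i)) + 2 /
          real n * (real (n div 2) * \<mu>\<^sup>2)"
    by (simp add: power2_diff sum.distrib sum_subtractf sum_distrib_left algebra_simps)
  also have "\<dots> = 2 / real n * (\<Sum>i=1..n div 2. (y i)\<^sup>2) - \<mu>\<^sup>2"
    unfolding mu[symmetric] half using assms by (simp add: power2_eq_square)
  finally show ?thesis unfolding sample_cov_quad_form y_def \<mu>_def .
qed

lemma sample_cov_cong:
  assumes "\<And>i. i \<in> {1..n div 2} \<Longrightarrow> d i = d' i"
  shows "sample_cov n d = sample_cov n d'"
proof -
  have "sample_mean n d = sample_mean n d'"
    unfolding sample_mean_def using assms by (auto intro!: sum.cong)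
  then show ?thesis unfolding sample_cov_def using assms by (auto intro!: sum.cong)
qed

text \<open>The sample covariance of the swapped data is an uncentred second moment minus a squared
  mean of the second half, which is the shape of \<open>close2\<close>.\<close>

lemma swap_quad_form:
  assumes n: "even n" "0 < n"
  shows "quad_form p (sample_cov n (swap_halves n d)) u
    = 2 / real n * (\<Sum>i=n div 2 + 1..n. (dotp p (snd (d i)) u)\<^sup>2)
      - (dotp p (\<lambda>j. 2 / real n * (\<Sum>i=n div 2 + 1..n. snd (d i) j)) u)\<^sup>2"
proof -
  have re: "(\<Sum>i=1..n div 2. g (swap_halves n d i)) = (\<Sum>i=n div 2 + 1..n. g (d i))" for g :: "_ \<Rightarrow> real"
    by (rule sum.reindex_bij_witness[of _ "\<lambda>i. i - n div 2" "\<lambda>i. i + n div 2"])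
      (use n in \<open>auto simp: swap_halves_def elim!: evenE\<close>)
  have "sample_mean n (swap_halves n d) = (\<lambda>j. 2 / real n * (\<Sum>i=n div 2 + 1..n. snd (d i) j))"
    unfolding sample_mean_def by (simp add: re[of "\<lambda>z. snd z _"])
  then show ?thesis
    unfolding sample_cov_quad_form_uncentred[OF n] re[of "\<lambda>z. (dotp p (snd z) u)\<^sup>2"] by simp
qed

text \<open>One sample size, with the asymptotic hypotheses replaced by the inequalities they yield
  for large n. The data are random again.\<close>

locale sample_model =
  fixes n p L U :: nat and Q :: "rvec measure" and theta lam :: rvec and w :: "nat \<Rightarrow> rvec"
    and S :: rmat and P :: "dataset measure"
    and lamhat :: "dataset \<Rightarrow> rvec" and vhat :: "dataset \<Rightarrow> nat \<Rightarrow> rvec" and f :: "nat \<Rightarrow> real"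
    and R :: ereal and sigma eta xi CI g0 eps rho ell delta K :: real
  defines "S \<equiv> second_moment Q" and "P \<equiv> data_law n p Q theta sigma"
    and "delta \<equiv> rho * op_norm p S"
  assumes n: "even n" "0 < n" and LU: "1 \<le> L" "L \<le> U" "U < p" "L \<le> n" and sigma: "0 < sigma"
    and Q: "prob_space Q" "sets Q = sets (vec_space p)"
    and Q2: "\<And>i j. i \<in> {1..p} \<Longrightarrow> j \<in> {1..p} \<Longrightarrow> integrable Q (\<lambda>x. x i * x j)"
    and Q1: "\<And>j. j \<in> {1..p} \<Longrightarrow> (\<integral>x. x j \<partial>Q) = 0"
    and esS: "eigensystem p S lam w"
    and hat: "\<And>d. d \<in> space (half_space n p) \<Longrightarrow> eigensystem p (sample_cov n d) (lamhat d) (vhat d)"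
    and hat_meas: "\<And>i j. i \<in> {1..p} \<Longrightarrow> j \<in> {1..p} \<Longrightarrow> (\<lambda>d. vhat d i j) \<in> borel_measurable (half_space n p)"
    and hat_pos: "AE d in P. 0 < lamhat (first_half n d) U"
    and opS: "0 < op_norm p S" "op_norm p S \<le> K" and K: "1 \<le> K"
    and rho: "0 \<le> rho" "8 * (rho * op_norm p S) \<le> lam (L + 1)"
    and cov: "1 - ell \<le> measure P {d \<in> space P. op_norm p (\<lambda>a b. sample_cov n d a b - S a b) /
        op_norm p S \<le> rho}"
      "ell < 1"
    and lam_sq: "real n * (lam (L + 1))\<^sup>2 \<le> 1"
    and theta_tail: "4 * dotp p theta theta * lam (L + 1) \<le> eps\<^sup>2"
    and U_eps: "real U \<le> real n * eps\<^sup>2"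
    and eps: "0 < eps" "eps \<le> sigma\<^sup>2 / 4" "eps \<le> 1 / 12" "1 \<le> real n * eps\<^sup>2" "exp (- (real n *
        eps\<^sup>2)) \<le> eps"
    and kprior: "exp (- (real n * eps\<^sup>2)) \<le> k_prior L U f L"
    and L_log: "real L * ln (real n) \<le> real n * eps\<^sup>2"
    and theta_lam: "dotp p theta theta * (\<Sum>i=1..L. 1 / lam i) \<le> real n * eps\<^sup>2"
    and trunc: "ereal (sqrt (2 * (quad_form p S theta + rho * op_norm p S * dotp p theta theta) + 4
        * K\<^sup>2 * eps\<^sup>2)) \<le> R"
    and eta: "0 < eta" and xi: "0 < xi"
    and CI: "(\<integral>\<^sup>+s. ennreal (inv_gauss_density eta xi s) * indicator {0<..} s \<partial>lborel) \<le> ennreal CI"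
        "0 < CI"
    and g0: "\<And>s. s \<in> {sigma\<^sup>2..sigma\<^sup>2 + 1} \<Longrightarrow> g0 \<le> inv_gauss_density eta xi s" "exp (- (real n *
        eps\<^sup>2)) \<le> g0"
begin

lemma quad_S_nonneg: "0 \<le> quad_form p S u"
  unfolding S_def by (rule second_moment_nonneg[OF Q Q2 Q1])

lemma lam_nonneg: "i \<in> {1..p} \<Longrightarrow> 0 \<le> lam i"
  using eigensystem_eigenvalue[OF esS] quad_S_nonneg by simp

lemma lam_K: assumes "i \<in> {1..p}" shows "lam i \<le> K"
proof -
  have "lam i = quad_form p S (w i)" by (rule eigensystem_eigenvalue[OF esS assms])
  also have "\<dots> \<le> op_norm p S * dotp p (w i) (w i)" using abs_quad_form_le_op_norm[of p S "w i"] by simp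
  also have "dotp p (w i) (w i) = 1" using eigensystem_orthonormal[OF esS assms assms] by simp
  finally show ?thesis using opS by simp
qed

lemma close_of_op_norm:
  assumes "op_norm p (\<lambda>a b. sample_cov n d a b - S a b) / op_norm p S \<le> rho"
  shows "\<bar>quad_form p (sample_cov n d) u - quad_form p S u\<bar> \<le> delta * dotp p u u"
proof -
  have "op_norm p (\<lambda>a b. sample_cov n d a b - S a b) \<le> delta"
    using assms opS by (simp add: delta_def divide_le_eq)
  then have "op_norm p (\<lambda>a b. sample_cov n d a b - S a b) * dotp p u u \<le> delta * dotp p u u"
    by (intro mult_right_mono dotp_self_nonneg)
  with abs_quad_form_le_op_norm[of p "\<lambda>a b. sample_cov n d a b - S a b" u] show ?thesis
    by (simp add: quad_form_diff_matrix)
qed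

definition "post Z d = posterior n p R L U f eta xi (lamhat (first_half n d)) (vhat (first_half n
    d)) d Z"

definition "mean_bound = (2 + 4 * K\<^sup>2) / real n + 4 * eps\<^sup>2"

definition "noise_bound = exp (- (real n * eps\<^sup>2)) + 2 * exp (- (real n * eps\<^sup>2 / (32 * sigma ^ 4)))"

text \<open>Turns a bound valid in every instance of \<open>split_posterior\<close> into a
  probability bound. The data may fail to form an instance through either covariance (2 ell),
  through the mean of the covariates, or through the noise.\<close>

lemma deviation_bound:
  assumes Zm: "post Z \<in> borel_measurable P"
    and Z: "\<And>S1 la v X d e. split_posterior n p L U S S1 lam la w v theta eps delta K X d e sigma
        eta xi CI g0 R f
      \<Longrightarrow> posterior n p R L U f eta xi la v d Z \<le> 2 * CI * exp (- (real n * eps\<^sup>2))"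
    and t: "2 * CI * exp (- (real n * eps\<^sup>2)) \<le> t"
  shows "measure P {d \<in> space P. t < post Z d} \<le> 2 * ell + mean_bound + noise_bound"
proof -
  let ?D1 = "{1..n div 2}" and ?D2 = "{n div 2 + 1..n}" and ?O = "obs_law p Q theta sigma"
  let ?N = "Pi\<^sub>M ?D2 (\<lambda>_. normal_law sigma)" and ?X = "Pi\<^sub>M ?D2 (\<lambda>_. Q)" and ?Y = "Pi\<^sub>M ?D1 (\<lambda>_. ?O)"
  interpret P: prob_space P unfolding P_def by (rule prob_space_data_law[OF Q sigma])
  interpret N: prob_space ?N by (intro prob_space_PiM prob_space_normal_law sigma)
  interpret X: prob_space ?X by (intro prob_space_PiM Q)
  interpret Y: prob_space ?Y by (intro prob_space_PiM prob_space_obs_law[OF Q sigma])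
  define E1 where "E1 = {d \<in> space P. op_norm p (\<lambda>a b. sample_cov n d a b - S a b) / op_norm p S \<le> rho}"
  define E2 where "E2 = swap_halves n -` E1 \<inter> space P"
  define A where "A = {d \<in> space P. t < post Z d}"
  have mE1: "1 - ell \<le> measure P E1" using cov by (simp add: E1_def)
  \<comment> \<open>A non-measurable set would have \<open>measure\<close> zero, which is excluded
    by 1 - ell > 0; measurability thus follows from the probability bound.\<close>
  have E1: "E1 \<in> sets P" using mE1 cov(2) measure_notin_sets[of E1 P] by fastforce
  have sw: "distr P P (swap_halves n) = P" "swap_halves n \<in> P \<rightarrow>\<^sub>M P"
    unfolding P_def by (rule distr_swap_halves[OF Q sigma n(1)])+
  have E2: "E2 \<in> sets P" unfolding E2_def by (rule measurable_sets[OF sw(2) E1])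
  have mE2: "1 - ell \<le> measure P E2"
    using mE1 measure_distr[OF sw(2) E1] by (simp add: E2_def sw(1))
  have A: "A \<in> sets P" unfolding A_def using Zm by measurable
  obtain N0 where N0: "{d \<in> space P. \<not> 0 < lamhat (first_half n d) U} \<subseteq> N0" "N0 \<in> sets P" "emeasure
      P N0 = 0"
    using AE_E[OF hat_pos] by auto
  define A' where "A' = (A \<inter> E1 \<inter> E2) - N0"
  have A': "A' \<in> sets P" unfolding A'_def using A E1 E2 N0 by auto
  have mean0: "0 \<le> mean_bound" and noise0: "0 \<le> noise_bound"
    by (auto simp: mean_bound_def noise_bound_def)
  define ass where "ass = (\<lambda>d1 x e. merge ?D1 ?D2 (d1, \<lambda>i\<in>?D2. (dotp p (x i) theta + e i, x i)))"
  have inner: "(\<integral>\<^sup>+x. \<integral>\<^sup>+e. indicator A' (ass d1 x e) \<partial>?N \<partial>?X) \<le> ennreal (mean_bound + noise_bound)"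
    if d1: "d1 \<in> space ?Y" for d1
  proof -
    have d1h: "d1 \<in> space (half_space n p)"
      using d1 by (simp add: half_space_def space_PiM space_obs_law)
    have d1e: "d1 \<in> extensional ?D1" using d1 by (auto simp: space_PiM PiE_def)
    have fh: "first_half n (ass d1 x e) = d1" for x e
      using d1e by (auto simp: first_half_def ass_def merge_def fun_eq_iff extensional_def restrict_def)
    have sc: "sample_cov n (ass d1 x e) = sample_cov n d1" for x e
      by (rule sample_cov_cong) (simp add: ass_def merge_def)
    have d2: "ass d1 x e i = (dotp p (x i) theta + e i, x i)" if "i \<in> ?D2" for x e i
      using that by (auto simp: ass_def merge_def)
    define la where "la = lamhat d1"
    define v where "v = vhat d1"
    \<comment> \<open>The facts about the first half depend on \<open>d1\<close> alone, so a single
      completion in A' provides them for all; without any completion the integral is zero.\<close>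
    show ?thesis
    proof (cases "\<exists>x e. ass d1 x e \<in> A'")
      case False
      then have "indicator A' (ass d1 x e) = (0 :: ennreal)" for x e by (simp add: indicator_def)
      then show ?thesis by simp
    next
      case True
      then obtain x0 e0 where a0: "ass d1 x0 e0 \<in> A'" by blast
      then have "op_norm p (\<lambda>a b. sample_cov n (ass d1 x0 e0) a b - S a b) / op_norm p S \<le> rho"
        by (simp add: A'_def E1_def)
      then have cl1: "\<bar>quad_form p (sample_cov n d1) u - quad_form p S u\<bar> \<le> delta * dotp p u u" for u
        unfolding sc by (rule close_of_op_norm)
      have laU: "0 < la U"
        using a0 N0(1) fh[of x0 e0] by (auto simp: A'_def E1_def la_def)
      have dl: "0 \<le> delta" "8 * delta \<le> lam (L + 1)"
        using rho opS by (simp_all add: delta_def)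
      have es1: "eigensystem p (sample_cov n d1) la v" unfolding la_def v_def by (rule hat[OF d1h])
      have hg: "half_geometry n p L U S (sample_cov n d1) lam la w v theta eps delta K"
        by (unfold_locales)
          (use n LU esS lam_nonneg lam_K K es1 laU cl1 dl lam_sq theta_tail U_eps
              sample_cov_quad_form_nonneg in auto)
      interpret H: half_geometry n p L U S "sample_cov n d1" lam la w v theta
          "\<lambda>l. theta l - (\<Sum>i=1..L. dotp p theta (v i) * v i l)" eps delta K
        by (rule hg)
      define mn where "mn = (\<lambda>(x :: nat \<Rightarrow> rvec) j. 2 / real n * (\<Sum>i=n div 2 + 1..n. x i j))"
      define bs where "bs = (\<lambda>l. theta l - (\<Sum>i=1..L. dotp p theta (v i) * v i l))"
      define G where "G = (\<lambda>x. (dotp p (mn x) bs)\<^sup>2 / eps\<^sup>2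
        + (\<Sum>i=1..L. la i * (dotp p (mn x) (v i))\<^sup>2) / real n
        + real n * (\<Sum>i=L+1..U. la i * (dotp p (mn x) (v i))\<^sup>2))"
      have Gint: "(\<integral>\<^sup>+x. ennreal (G x) \<partial>?X) \<le> ennreal mean_bound"
        unfolding G_def mn_def mean_bound_def bs_def
        by (rule half_geometry.mean_terms_bound[OF hg n(1) eps(1) LU(4) Q Q2 Q1]) (auto simp: S_def)
      have Gm: "(\<lambda>x. ennreal (G x)) \<in> borel_measurable ?X"
      proof -
        have [measurable]: "(\<lambda>x. dotp p (mn x) u) \<in> borel_measurable ?X" for u
          unfolding mn_def by (rule sample_mean_dotp_measurable[OF Q Q2 Q1])
        show ?thesis unfolding G_def by measurable
      qed
      \<comment> \<open>Markov's inequality done pointwise: where G x \<ge> 1 the inner probability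
        is at most 1 \<le> G x; elsewhere the mean conditions hold and only the noise can
        fail.\<close>
      have pt: "(\<integral>\<^sup>+e. indicator A' (ass d1 x e) \<partial>?N) \<le> ennreal (G x) + ennreal noise_bound" for x
      proof (cases "1 \<le> G x")
        case True
        have "(\<integral>\<^sup>+e. indicator A' (ass d1 x e) \<partial>?N) \<le> (\<integral>\<^sup>+e. 1 \<partial>?N)"
          by (intro nn_integral_mono) (auto simp: indicator_def)
        also have "\<dots> = ennreal 1" by (simp add: N.emeasure_space_1)
        also have "\<dots> \<le> ennreal (G x)" using True by (rule ennreal_leI)
        finally show ?thesis by (simp add: add_increasing2)
      next
        case False
        have t1: "0 \<le> (dotp p (mn x) bs)\<^sup>2 / eps\<^sup>2" by simp
        have t2: "0 \<le> (\<Sum>i=1..L. la i * (dotp p (mn x) (v i))\<^sup>2) / real n"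
          using H.la_pos LU by (intro divide_nonneg_nonneg sum_nonneg) (auto simp: less_imp_le)
        have t3: "0 \<le> real n * (\<Sum>i=L+1..U. la i * (dotp p (mn x) (v i))\<^sup>2)"
          using H.la_pos LU by (intro mult_nonneg_nonneg sum_nonneg) (auto simp: less_imp_le)
        have "(dotp p (mn x) bs)\<^sup>2 / eps\<^sup>2 \<le> 1" using False t2 t3 unfolding G_def by argo
        then have m1: "(dotp p (mn x) bs)\<^sup>2 \<le> eps\<^sup>2" using eps(1) by simp
        have "(\<Sum>i=1..L. la i * (dotp p (mn x) (v i))\<^sup>2) / real n \<le> 1" using False t1 t3 unfolding
            G_def by argo
        then have m2: "(\<Sum>i=1..L. la i * (dotp p (mn x) (v i))\<^sup>2) \<le> real n" using n by simp
        have "real n * (\<Sum>i=L+1..U. la i * (dotp p (mn x) (v i))\<^sup>2) \<le> 1" using False t1 t2 unfolding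
            G_def by argo
        then have m3: "(\<Sum>i=L+1..U. la i * (dotp p (mn x) (v i))\<^sup>2) \<le> 1 / real n"
          using n by (simp add: field_simps)
        obtain B where B: "B \<in> sets ?N"
          "\<And>e. e \<in> space ?N - B \<Longrightarrow> typical_noise n p L U v x theta sigma eps e"
          "emeasure ?N B \<le> ennreal noise_bound"
        proof -
          have "eps \<le> sigma\<^sup>2" using eps by simp
          from typical_noise_prob[OF n(1) sigma eps(1) this U_eps eps(4), of p L v x theta]
          show ?thesis using that unfolding noise_bound_def by blast
        qed
        \<comment> \<open>Outside \<open>B\<close> the data form an instance of
          \<open>split_posterior\<close>, whose posterior bound is at most t and contradicts
          membership in A.\<close>
        have "ass d1 x e \<notin> A'" if e: "e \<in> space ?N - B" for e
        proof
          assume a: "ass d1 x e \<in> A'"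
          let ?d = "ass d1 x e"
          have "op_norm p (\<lambda>a b. sample_cov n (swap_halves n ?d) a b - S a b) / op_norm p S \<le> rho"
            using a by (simp add: A'_def E2_def E1_def)
          from close_of_op_norm[OF this]
          have cl2': "\<bar>(2 / real n * (\<Sum>i\<in>?D2. (dotp p (snd (?d i)) u)\<^sup>2)
            - (dotp p (\<lambda>j. 2 / real n * (\<Sum>i\<in>?D2. snd (?d i) j)) u)\<^sup>2) - quad_form p S u\<bar> \<le> delta *
                dotp p u u" for u
            unfolding swap_quad_form[OF n] .
          have cl2: "\<bar>2 / real n * (\<Sum>i\<in>?D2. (dotp p (x i) u)\<^sup>2) - (dotp p (mn x) u)\<^sup>2 - quad_form p S
              u\<bar> \<le> delta * dotp p u u" for u
          proof -
            have "(\<Sum>i\<in>?D2. (dotp p (snd (?d i)) u)\<^sup>2) = (\<Sum>i\<in>?D2. (dotp p (x i) u)\<^sup>2)"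
              by (intro sum.cong refl) (simp only: d2 snd_conv)
            moreover have "(\<lambda>j. 2 / real n * (\<Sum>i\<in>?D2. snd (?d i) j)) = mn x"
              unfolding mn_def
            proof (rule ext)
              fix j
              have "(\<Sum>i\<in>?D2. snd (?d i) j) = (\<Sum>i\<in>?D2. x i j)"
                by (intro sum.cong refl) (simp only: d2 snd_conv)
              then show "2 / real n * (\<Sum>i\<in>?D2. snd (?d i) j) = 2 / real n * (\<Sum>i\<in>?D2. x i j)" by simp
            qed
            ultimately show ?thesis using cl2'[of u] by simp
          qed
          have sg: "split_geometry n p L U S (sample_cov n d1) lam la w v theta eps delta K x"
            by (intro split_geometry.intro hg split_geometry_axioms.intro)
              (use cl2 m1 m2 m3 in \<open>simp_all add: mn_def bs_def\<close>)
          have "split_posterior n p L U S (sample_cov n d1) lam la w v theta eps delta K x ?d e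
              sigma eta xi CI g0 R f"
            by (intro split_posterior.intro sg split_posterior_axioms.intro)
              (use n eps sigma B(2)[OF e] kprior L_log theta_lam trunc eta xi CI g0 d2 in \<open>auto
                simp: delta_def\<close>)
          from Z[OF this] have "post Z ?d \<le> 2 * CI * exp (- (real n * eps\<^sup>2))"
            unfolding post_def fh la_def v_def .
          with t a show False by (simp add: A'_def A_def)
        qed
        then have "(\<integral>\<^sup>+e. indicator A' (ass d1 x e) \<partial>?N) \<le> (\<integral>\<^sup>+e. indicator B e \<partial>?N)"
          by (intro nn_integral_mono) (auto simp: indicator_def)
        also have "\<dots> = emeasure ?N B" using B(1) by simp
        also have "\<dots> \<le> ennreal noise_bound" by (rule B(3))
        finally show ?thesis by (simp add: add_increasing)
      qed
      have "(\<integral>\<^sup>+x. \<integral>\<^sup>+e. indicator A' (ass d1 x e) \<partial>?N \<partial>?X) \<le> (\<integral>\<^sup>+x. ennreal (G x) + ennreal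
          noise_bound \<partial>?X)"
        by (intro nn_integral_mono pt)
      also have "\<dots> = (\<integral>\<^sup>+x. ennreal (G x) \<partial>?X) + ennreal noise_bound"
        by (subst nn_integral_add) (use Gm in \<open>auto simp: X.emeasure_space_1\<close>)
      also have "\<dots> \<le> ennreal mean_bound + ennreal noise_bound" by (intro add_right_mono Gint)
      finally show ?thesis using mean0 noise0 by (simp add: ennreal_plus)
    qed
  qed
  have "emeasure P A' = (\<integral>\<^sup>+d. indicator A' d \<partial>P)" using A' by simp
  also have "\<dots> = (\<integral>\<^sup>+d1. \<integral>\<^sup>+x. \<integral>\<^sup>+e. indicator A' (ass d1 x e) \<partial>?N \<partial>?X \<partial>?Y)"
    unfolding P_def ass_def
    by (rule nn_integral_data_law[OF Q sigma]) (use A' in \<open>simp add: P_def\<close>)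
  also have "\<dots> \<le> (\<integral>\<^sup>+d1. ennreal (mean_bound + noise_bound) \<partial>?Y)" by (intro nn_integral_mono inner)
  also have "\<dots> = ennreal (mean_bound + noise_bound)" by (simp add: Y.emeasure_space_1)
  finally have mA': "measure P A' \<le> mean_bound + noise_bound"
    using mean0 noise0 by (simp add: P.emeasure_eq_measure del: ennreal_plus)
  have "A \<subseteq> A' \<union> (space P - E1) \<union> (space P - E2) \<union> N0" by (auto simp: A'_def A_def)
  then have "measure P A \<le> measure P (A' \<union> (space P - E1) \<union> (space P - E2) \<union> N0)"
    using A' E1 E2 N0 by (intro P.finite_measure_mono) auto
  also have "\<dots> \<le> measure P A' + measure P (space P - E1) + measure P (space P - E2) + measure P N0"
    using A' E1 E2 N0(2)
    by (intro order_trans[OF measure_Un_le] add_right_mono order_refl) auto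
  also have "\<dots> \<le> (mean_bound + noise_bound) + ell + ell + 0"
    using mA' mE1 mE2 N0(3) P.prob_compl[OF E1] P.prob_compl[OF E2]
    by (intro add_mono) (auto simp: measure_def)
  finally show ?thesis by (simp add: A_def)
qed

lemma post_norm_measurable:
  "post ({\<theta>. C < mat_norm p S (\<lambda>j. \<theta> j - theta j)} \<times> UNIV) \<in> borel_measurable P"
proof -
  define B' where "B' = (\<lambda>(\<theta> :: rvec) (s :: real). C < mat_norm p S (\<lambda>j. \<theta> j - theta j))"
  define B where "B = (\<lambda>z :: rvec \<times> real. B' (restrict (fst z) {1..p}) (snd z))"
  have eq: "Collect B = {\<theta>. C < mat_norm p S (\<lambda>j. \<theta> j - theta j)} \<times> UNIV"
  proof -
    have "mat_norm p S (\<lambda>j. restrict \<theta> {1..p} j - theta j) = mat_norm p S (\<lambda>j. \<theta> j - theta j)" for \<theta>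
        :: rvec
      unfolding mat_norm_def by (intro arg_cong[where f=sqrt] quad_form_cong) auto
    then show ?thesis by (auto simp: B_def B'_def)
  qed
  have B'm: "(\<lambda>z. B' (fst z) (snd z)) \<in> measurable (vec_space p \<Otimes>\<^sub>M borel) (count_space UNIV)"
    unfolding B'_def mat_norm_def quad_form_def dotp_def matvec_def vec_space_def by measurable
  have "(\<lambda>d. posterior n p R L U f eta xi (lamhat (first_half n d)) (vhat (first_half n d)) d
      (Collect B)) \<in> borel_measurable P"
  proof (rule posterior_measurable[OF _ LU(3) _ _ _ B'm])
    show "sets P = sets (Pi\<^sub>M {1..n} (\<lambda>_. obs_space p))" unfolding P_def by (rule sets_data_law)
    show "B z = B' (restrict (fst z) {1..p}) (snd z)" for z by (simp only: B_def)
  qed (use hat_meas hat in auto)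
  then show ?thesis unfolding eq post_def[abs_def] .
qed

lemma post_variance_measurable:
  "post (UNIV \<times> {s2. C < \<bar>s2 - sigma\<^sup>2\<bar>}) \<in> borel_measurable P"
proof -
  define B' where "B' = (\<lambda>(\<theta> :: rvec) (s :: real). C < \<bar>s - sigma\<^sup>2\<bar>)"
  define B where "B = (\<lambda>z :: rvec \<times> real. B' (restrict (fst z) {1..p}) (snd z))"
  have eq: "Collect B = UNIV \<times> {s2. C < \<bar>s2 - sigma\<^sup>2\<bar>}" by (auto simp: B_def B'_def)
  have B'm: "(\<lambda>z. B' (fst z) (snd z)) \<in> measurable (vec_space p \<Otimes>\<^sub>M borel) (count_space UNIV)"
    unfolding B'_def by measurable
  have "(\<lambda>d. posterior n p R L U f eta xi (lamhat (first_half n d)) (vhat (first_half n d)) d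
      (Collect B)) \<in> borel_measurable P"
  proof (rule posterior_measurable[OF _ LU(3) _ _ _ B'm])
    show "sets P = sets (Pi\<^sub>M {1..n} (\<lambda>_. obs_space p))" unfolding P_def by (rule sets_data_law)
    show "B z = B' (restrict (fst z) {1..p}) (snd z)" for z by (simp only: B_def)
  qed (use hat_meas hat in auto)
  then show ?thesis unfolding eq post_def[abs_def] .
qed

end

section \<open>Consequences of the rate conditions\<close>

text \<open>All summands of the variance and bias bounds are nonnegative, so each one is separately
  at most eps^2. The bound on lam (L + 1) combines two conditions: with lam (L + 1) \<le> lam L the
  effective-rank condition reads T1^3 / T2 < n, while the variance bound gives n T2 / T1^2 \<le>
  eps^2. Together they make the whole tail sum T1 less than eps^2.\<close>

lemma rate_conditions:
  assumes n: "4 \<le> n" and LU: "1 \<le> L" "L \<le> U" "L + 1 \<le> p" and eps: "0 < eps" "eps < 1"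
    and nonneg: "\<And>i. i \<in> {1..p} \<Longrightarrow> 0 \<le> lam i"
    and anti: "lam (L + 1) \<le> lam L"
    and c1: "eff_rank_r p lam L * eff_rank_R p lam L < real n / lam L"
    and c2: "eff_variance n p L U lam eps \<le> eps\<^sup>2"
    and c3: "eff_bias n p L U f lam theta \<le> eps\<^sup>2"
  shows "real U \<le> real n * eps\<^sup>2" "real n * (lam (L + 1))\<^sup>2 \<le> 1" "exp (- (real n * eps\<^sup>2)) \<le> eps"
    "exp (- (real n * eps\<^sup>2)) \<le> k_prior L U f L" "real L * ln (real n) \<le> real n * eps\<^sup>2"
    "dotp p theta theta * (\<Sum>i=1..L. 1 / lam i) \<le> real n * eps\<^sup>2"
proof -
  have n0: "0 < real n" and n4: "4 \<le> real n" using n by auto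
  define T1 where "T1 = tail1 p lam L"
  define T2 where "T2 = tail2 p lam L"
  define l where "l = ln (real n / (2 * eps))"
  define vs where "vs = (\<Sum>i\<in>eff_index n p L U lam. 1 / real n * ln (real n * sqrt (lam i) * sqrt T2
      / T1 powr (3/2)))"
  have T1: "lam (L + 1) \<le> T1" unfolding T1_def tail1_def
    using LU nonneg by (intro member_le_sum) auto
  have T2: "(lam (L + 1))\<^sup>2 \<le> T2" unfolding T2_def tail2_def
    using LU by (intro member_le_sum[of _ _ "\<lambda>i. (lam i)\<^sup>2"]) auto
  have lam0: "0 \<le> lam (L + 1)" using nonneg LU by auto
  have T10: "0 \<le> T1" and T20: "0 \<le> T2" using T1 T2 lam0 by (auto intro: order_trans[OF zero_le_power2])
  have vs0: "0 \<le> vs" unfolding vs_def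
  proof (intro sum_nonneg mult_nonneg_nonneg)
    fix i assume "i \<in> eff_index n p L U lam"
    then have gt: "T1 powr (3/2) < real n * sqrt (lam i) * sqrt T2"
      by (simp add: eff_index_def T1_def T2_def real_sqrt_mult mult.assoc)
    show "0 \<le> ln (real n * sqrt (lam i) * sqrt T2 / T1 powr (3/2))"
    \<comment> \<open>For T1 = 0 the quotient is zero, and so is its \<open>ln\<close>, both by
      convention.\<close>
    proof (cases "T1 = 0")
      case False
      then have "0 < T1 powr (3/2)" using T10 by simp
      then have "1 \<le> real n * sqrt (lam i) * sqrt T2 / T1 powr (3/2)" using gt by simp
      then show ?thesis by simp
    qed simp
  qed simp
  \<comment> \<open>The term ln (n / (2 eps)) of the variance bound is what keeps the variance
    window of length eps from costing more than exp (- n eps^2).\<close>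
  have l0: "1 / eps \<le> real n / (2 * eps)" using n4 eps by (simp add: field_simps)
  have "1 \<le> 1 / eps" using eps by simp
  with l0 have "1 \<le> real n / (2 * eps)" by linarith
  then have l: "0 \<le> l" unfolding l_def by simp
  have tt0: "0 \<le> real n * T2 / T1\<^sup>2" using T20 by simp
  have var: "vs + (real U + l) / real n + real n * T2 / T1\<^sup>2 \<le> eps\<^sup>2"
    using c2 by (simp add: eff_variance_def vs_def T1_def T2_def l_def)
  then have "(real U + l) / real n \<le> eps\<^sup>2" using vs0 tt0 by linarith
  then have Ul: "real U + l \<le> real n * eps\<^sup>2" using n0 by (simp add: divide_le_eq mult.commute)
  then show "real U \<le> real n * eps\<^sup>2" using l by linarith
  have "l \<le> real n * eps\<^sup>2" using Ul by simp
  then have "exp l \<le> exp (real n * eps\<^sup>2)" by simp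
  moreover have "exp l = real n / (2 * eps)" unfolding l_def using n0 eps by simp
  ultimately have "1 / eps \<le> exp (real n * eps\<^sup>2)" using l0 by linarith
  then have "1 / exp (real n * eps\<^sup>2) \<le> eps" using eps by (simp add: field_simps)
  then show "exp (- (real n * eps\<^sup>2)) \<le> eps" by (simp add: exp_minus inverse_eq_divide)
  show "real n * (lam (L + 1))\<^sup>2 \<le> 1"
  proof (cases "lam (L + 1) = 0")
    case False
    define x where "x = lam (L + 1)"
    have x: "0 < x" using False lam0 by (simp add: x_def)
    have T1p: "0 < T1" using T1 x by (simp add: x_def)
    have T2p: "0 < T2" using T2 x by (smt (verit) x_def zero_less_power2)
    have lamL: "x \<le> lam L" "0 < lam L" using anti x by (auto simp: x_def)
    have "(T1 / x) * (T1\<^sup>2 / T2) < real n / lam L"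
      using c1 by (simp add: eff_rank_r_def eff_rank_R_def T1_def T2_def x_def)
    also have "\<dots> \<le> real n / x" using lamL x n0 by (intro divide_left_mono) auto
    finally have lt: "(T1 / x) * (T1\<^sup>2 / T2) < real n / x" .
    define y where "y = T1 * (T1\<^sup>2 / T2)"
    have "(T1 / x) * (T1\<^sup>2 / T2) = y / x" by (simp add: y_def)
    with lt have "y < real n" using x by (simp add: divide_less_cancel)
    then have "T1 * (T1\<^sup>2 / T2) < real n" by (simp add: y_def)
    then have "T1 < real n * T2 / T1\<^sup>2" using T1p T2p by (simp add: field_simps)
    also have tle: "real n * T2 / T1\<^sup>2 \<le> eps\<^sup>2"
    proof -
      have "0 \<le> (real U + l) / real n" using l by simp
      then show ?thesis using var vs0 by linarith
    qed
    finally have T1e: "T1 < eps\<^sup>2" .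
    have e1: "eps\<^sup>2 \<le> 1" using eps by (intro power_le_one) auto
    \<comment> \<open>The chain is n x^2 \<le> n T2 \<le> eps^2 T1^2 \<le> 1, the last step since T1
      < eps^2 \<le> 1.\<close>
    have "real n * x\<^sup>2 \<le> real n * T2" using T2 n0 by (simp add: x_def)
    also have "\<dots> \<le> eps\<^sup>2 * T1\<^sup>2" using tle T1p by (simp add: divide_le_eq)
    also have "\<dots> \<le> 1 * 1"
      using T1e e1 T1p eps by (intro mult_mono power_le_one) auto
    finally show ?thesis by (simp add: x_def)
  qed simp
  define kp where "kp = k_prior L U f L"
  have sp: "0 < (\<Sum>k'=L..U. exp (f k'))" using LU by (intro sum_pos) auto
  have kp0: "0 < kp" unfolding kp_def k_prior_def using sp by simp
  have kp1: "kp \<le> 1"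
  proof -
    have "exp (f L) \<le> (\<Sum>k'=L..U. exp (f k'))" using LU by (intro member_le_sum) auto
    then show ?thesis unfolding kp_def k_prior_def using sp by simp
  qed
  have b1: "0 \<le> ln (1 / kp)" using kp0 kp1 by simp
  have b2: "0 \<le> (L2_set theta {1..p})\<^sup>2 * (\<Sum>i=1..L. 1 / lam i)"
    using nonneg LU by (intro mult_nonneg_nonneg sum_nonneg) auto
  have b3: "0 \<le> real L * ln (real n)" using n4 by (intro mult_nonneg_nonneg) auto
  have "(ln (1 / kp) + (L2_set theta {1..p})\<^sup>2 * (\<Sum>i=1..L. 1 / lam i) + real L * ln (real n)) / real
      n \<le> eps\<^sup>2"
    using c3 by (simp add: eff_bias_def kp_def add_divide_distrib)
  then have sum: "ln (1 / kp) + (L2_set theta {1..p})\<^sup>2 * (\<Sum>i=1..L. 1 / lam i) + real L * ln (real n)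
      \<le> real n * eps\<^sup>2"
    using n0 by (simp add: divide_le_eq mult.commute)
  then show "real L * ln (real n) \<le> real n * eps\<^sup>2" using b1 b2 by linarith
  show "dotp p theta theta * (\<Sum>i=1..L. 1 / lam i) \<le> real n * eps\<^sup>2"
    using sum b1 b3 unfolding L2_set_square_dotp by linarith
  have "- ln kp \<le> real n * eps\<^sup>2" using sum b2 b3 kp0 by (simp add: ln_div)
  then have "- (real n * eps\<^sup>2) \<le> ln kp" by linarith
  then have "exp (- (real n * eps\<^sup>2)) \<le> exp (ln kp)" by simp
  then show "exp (- (real n * eps\<^sup>2)) \<le> k_prior L U f L" by (simp only: exp_ln[OF kp0] kp_def[symmetric])
qed

text \<open>Diagonal entries are quadratic forms at coordinate vectors. A positive trace therefore
  forces a positive operator norm, so the quotient in the covariance hypothesis is a genuine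
  one.\<close>

lemma trace_le_op_norm: "trace_mat p A \<le> real p * op_norm p A"
proof -
  have "A i i \<le> op_norm p A" if i: "i \<in> {1..p}" for i
  proof -
    define u where "u = (\<lambda>j. if j = i then 1 else (0::real))"
    have mv: "matvec p A u a = A a i" for a
    proof -
      have "matvec p A u a = (\<Sum>j=1..p. if j = i then A a j else 0)"
        unfolding matvec_def u_def by (intro sum.cong) auto
      then show ?thesis using i by simp
    qed
    have "quad_form p A u = (\<Sum>j=1..p. if j = i then A j i else 0)"
      unfolding quad_form_def dotp_def mv by (intro sum.cong) (auto simp: u_def)
    then have "quad_form p A u = A i i" using i by simp
    moreover have "dotp p u u = 1"
    proof -
      have "dotp p u u = (\<Sum>j=1..p. if j = i then 1 else 0)"
        unfolding dotp_def u_def by (intro sum.cong) auto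
      then show ?thesis using i by simp
    qed
    ultimately show ?thesis using abs_quad_form_le_op_norm[of p A u] by simp
  qed
  then have "trace_mat p A \<le> (\<Sum>i=1..p. op_norm p A)" unfolding trace_mat_def by (intro sum_mono) auto
  then show ?thesis by simp
qed

lemma eventually_large_n:
  "(\<forall>\<^sub>F n in large_n. Pr n) \<longleftrightarrow> (\<exists>N. \<forall>n\<in>sample_sizes. N \<le> n \<longrightarrow> Pr n)"
  unfolding large_n_def eventually_inf_principal eventually_sequentially by auto


text \<open>A norm below R / 2 leaves twice its square at most R^2 / 2. The other terms fit into the
  rest once e is small; r0 is chosen through 4 K^2 + 1 \<le> (2 K + 1)^2. It depends on R and K
  only, hence serves all sample sizes.\<close>

lemma truncation_radius:
  assumes R: "0 < (R :: ereal)" and K: "1 \<le> K"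
  shows "\<exists>r0>0. \<forall>p S theta e x. ereal (mat_norm p S theta) < R / 2 \<longrightarrow> 0 \<le> quad_form p S theta \<longrightarrow>
    0 \<le> x \<longrightarrow> x \<le> e\<^sup>2 / 32 \<longrightarrow> 0 < e \<longrightarrow> e \<le> r0 \<longrightarrow>
    ereal (sqrt (2 * (quad_form p S theta + x) + 4 * K\<^sup>2 * e\<^sup>2)) \<le> R"
proof (cases R)
  case (real r)
  have r: "0 < r" using R real by simp
  define r0 where "r0 = r / (2 * (2 * K + 1))"
  have r0: "0 < r0" using r K by (simp add: r0_def)
  have "ereal (sqrt (2 * (quad_form p S theta + x) + 4 * K\<^sup>2 * e\<^sup>2)) \<le> R"
    if "ereal (mat_norm p S theta) < R / 2" and q: "0 \<le> quad_form p S theta" and x: "0 \<le> x" "x \<le> e\<^sup>2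
        / 32"
      and e: "0 < e" "e \<le> r0" for p S theta e x
  proof -
    have "mat_norm p S theta < r / 2" using that(1) unfolding real by simp
    then have "(mat_norm p S theta)\<^sup>2 \<le> (r / 2)\<^sup>2"
      using q by (intro power_mono) (auto simp: mat_norm_def)
    then have q1: "quad_form p S theta \<le> r\<^sup>2 / 4" using q by (simp add: mat_norm_def power_divide)
    have "((2 * K + 1) * e)\<^sup>2 \<le> (r / 2)\<^sup>2"
    proof (rule power_mono)
      have "(2 * K + 1) * e \<le> (2 * K + 1) * r0" using e K by (intro mult_left_mono) auto
      also have "\<dots> = r / 2" using K by (simp add: r0_def field_simps)
      finally show "(2 * K + 1) * e \<le> r / 2" .
    qed (use e K in auto)
    then have e1: "(2 * K + 1)\<^sup>2 * e\<^sup>2 \<le> r\<^sup>2 / 4" by (simp add: power_mult_distrib power_divide)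
    have "(4 * K\<^sup>2 + 1) * e\<^sup>2 \<le> (2 * K + 1)\<^sup>2 * e\<^sup>2"
      using K by (intro mult_right_mono) (auto simp: power2_eq_square algebra_simps)
    with e1 have e2: "4 * K\<^sup>2 * e\<^sup>2 + e\<^sup>2 \<le> r\<^sup>2 / 4" by (simp add: algebra_simps)
    have "2 * (quad_form p S theta + x) + 4 * K\<^sup>2 * e\<^sup>2 \<le> r\<^sup>2"
      using q1 e2 x zero_le_power2[of e] zero_le_power2[of r] by argo
    then have "sqrt (2 * (quad_form p S theta + x) + 4 * K\<^sup>2 * e\<^sup>2) \<le> sqrt (r\<^sup>2)" by (rule
        real_sqrt_le_mono)
    then show ?thesis using r real by simp
  qed
  with r0 show ?thesis by blast
next
  case PInf
  then show ?thesis by (intro exI[of _ 1]) auto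
next
  case MInf
  with R show ?thesis by simp
qed

section \<open>Posterior contraction\<close>

theorem theorem2:
  fixes p L U :: "nat \<Rightarrow> nat"
    and Q :: "nat \<Rightarrow> rvec measure"
    and theta lam :: "nat \<Rightarrow> rvec"
    and w :: "nat \<Rightarrow> nat \<Rightarrow> rvec"
    and Sig :: "nat \<Rightarrow> rmat"
    and P :: "nat \<Rightarrow> dataset measure"
    and lamhat :: "nat \<Rightarrow> dataset \<Rightarrow> rvec"
    and vhat :: "nat \<Rightarrow> dataset \<Rightarrow> nat \<Rightarrow> rvec"
    and f :: "nat \<Rightarrow> nat \<Rightarrow> real"
    and R :: ereal
    and sigma eta xi :: real
    and rho ell eps :: "nat \<Rightarrow> real"
  defines "Sig \<equiv> \<lambda>n. second_moment (Q n)"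
    and "P \<equiv> \<lambda>n. data_law n (p n) (Q n) (theta n) sigma"
  \<comment> \<open>data-generating model\<close>
  assumes sigma: "sigma > 0"
    and p_gt: "\<forall>n\<in>sample_sizes. real (p n) > real n / 2"
    and p_incr: "mono_on sample_sizes p"
    and Q_prob: "\<forall>n\<in>sample_sizes. prob_space (Q n) \<and> sets (Q n) = sets (vec_space (p n))"
    and Q_moments: "\<forall>n\<in>sample_sizes. \<forall>i\<in>{1..p n}. \<forall>j\<in>{1..p n}. integrable (Q n) (\<lambda>x. x i * x j)"
    and Q_mean: "\<forall>n\<in>sample_sizes. \<forall>j\<in>{1..p n}. (\<integral>x. x j \<partial>(Q n)) = 0"
    and Q_nonatomic: "\<forall>n\<in>sample_sizes. nonatomic (Q n)"
    and lam: "\<forall>n\<in>sample_sizes. eigensystem (p n) (Sig n) (lam n) (w n)"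
    and trace: "filterlim (\<lambda>n. trace_mat (p n) (Sig n)) at_top large_n"
  \<comment> \<open>eigenvalues and eigenvectors of the sample covariance of the first half of the data\<close>
    and hat: "\<forall>n\<in>sample_sizes. \<forall>d\<in>space (half_space n (p n)).
                eigensystem (p n) (sample_cov n d) (lamhat n d) (vhat n d)"
    and hat_meas: "\<forall>n\<in>sample_sizes. \<forall>i\<in>{1..p n}. \<forall>j\<in>{1..p n}.
                (\<lambda>d. vhat n d i j) \<in> borel_measurable (half_space n (p n))"
    and hat_pos: "\<forall>n\<in>sample_sizes. AE d in P n. lamhat n (first_half n d) (U n) > 0"
  \<comment> \<open>prior\<close>
    and R_pos: "0 < R"
    and LU: "\<forall>n\<in>sample_sizes. 1 \<le> L n \<and> L n \<le> U n \<and> real (U n) < real n / 2"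
    and L_lim: "filterlim L at_top large_n"
    and eta: "eta > 0" and xi: "xi > 0"
  \<comment> \<open>condition (i)\<close>
    and op_bdd: "\<exists>K. \<forall>n\<in>sample_sizes. op_norm (p n) (Sig n) \<le> K"
    and rho: "\<forall>n. rho n \<ge> 0" "(rho \<longlongrightarrow> 0) large_n"
    and ell: "\<forall>n. ell n \<ge> 0" "(ell \<longlongrightarrow> 0) large_n"
    and cov_conc: "\<forall>\<^sub>F n in large_n.
        measure (P n) {d \<in> space (P n).
          op_norm (p n) (\<lambda>a b. sample_cov n d a b - Sig n a b) / op_norm (p n) (Sig n) \<le> rho n}
        \<ge> 1 - ell n"
    and rho_lam: "rho \<in> o[large_n](\<lambda>n. lam n (L n + 1))"
  \<comment> \<open>condition (ii)\<close>
    and R_theta: "\<forall>n\<in>sample_sizes. ereal (mat_norm (p n) (Sig n) (theta n)) < R / 2"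
    and theta_bdd: "\<exists>K. \<forall>n\<in>sample_sizes. L2_set (theta n) {1..p n} \<le> K"
  \<comment> \<open>rate\<close>
    and eps_pos: "\<forall>n. eps n > 0"
    and eps: "\<forall>\<delta>>0. \<forall>K>0. \<exists>N. \<forall>n\<in>sample_sizes. n \<ge> N \<longrightarrow>
        eps n < \<delta> \<and>
        real n * (eps n)\<^sup>2 > K \<and>
        real n / lam n (L n) > eff_rank_r (p n) (lam n) (L n) * eff_rank_R (p n) (lam n) (L n) \<and>
        (eps n)\<^sup>2 > 4 * (L2_set (theta n) {1..p n})\<^sup>2 * (\<Sum>i=L n + 1..p n. lam n i) \<and>
        max (eff_variance n (p n) (L n) (U n) (lam n) (eps n))
            (eff_bias n (p n) (L n) (U n) (f n) (lam n) (theta n)) \<le> (eps n)\<^sup>2"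
  shows "(\<exists>C>0. tendsto_in_prob P
            (\<lambda>n d. posterior n (p n) R (L n) (U n) (f n) eta xi
                     (lamhat n (first_half n d)) (vhat n (first_half n d)) d
                     ({\<theta>. mat_norm (p n) (Sig n) (\<lambda>j. \<theta> j - theta n j) > C * eps n} \<times> UNIV))
            0 large_n) \<and>
         (\<exists>C>0. tendsto_in_prob P
            (\<lambda>n d. posterior n (p n) R (L n) (U n) (f n) eta xi
                     (lamhat n (first_half n d)) (vhat n (first_half n d)) d
                     (UNIV \<times> {s2. \<bar>s2 - sigma\<^sup>2\<bar> > C * eps n}))
            0 large_n)"
proof -
  obtain K0 where K0: "\<And>n. n \<in> sample_sizes \<Longrightarrow> op_norm (p n) (Sig n) \<le> K0" using op_bdd by blast
  define K where "K = max 1 K0"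
  have K: "1 \<le> K" and KS: "\<And>n. n \<in> sample_sizes \<Longrightarrow> op_norm (p n) (Sig n) \<le> K"
    using K0 by (auto simp: K_def le_max_iff_disj)
  obtain CI where CI: "0 < CI" "(\<integral>\<^sup>+s. ennreal (inv_gauss_density eta xi s) * indicator {0<..} s
      \<partial>lborel) \<le> ennreal CI"
    using inv_gauss_density_mass_finite[OF eta xi] by blast
  have sig2: "0 < sigma\<^sup>2" using sigma by simp
  obtain g0 where g0: "0 < g0" "\<And>s. s \<in> {sigma\<^sup>2..sigma\<^sup>2 + 1} \<Longrightarrow> g0 \<le> inv_gauss_density eta xi s"
    using inv_gauss_density_lower[OF xi sig2, of eta] by blast
  obtain r0 where r0: "0 < r0" "\<And>p S theta e x. ereal (mat_norm p S theta) < R / 2 \<Longrightarrow> 0 \<le> quad_form p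
      S theta \<Longrightarrow>
    0 \<le> x \<Longrightarrow> x \<le> e\<^sup>2 / 32 \<Longrightarrow> 0 < e \<Longrightarrow> e \<le> r0 \<Longrightarrow>
    ereal (sqrt (2 * (quad_form p S theta + x) + 4 * K\<^sup>2 * e\<^sup>2)) \<le> R"
    using truncation_radius[OF R_pos K] by blast
  \<comment> \<open>D depends on sigma and K only, so it and all constants derived from it are free
    of n.\<close>
  define D where "D = denom_rate sigma K"
  have D: "0 \<le> D" unfolding D_def denom_rate_def using sigma by (intro add_nonneg_nonneg
      divide_nonneg_nonneg) auto
  define C1 where "C1 = 1 + sqrt (512 * sigma ^ 4 * (D + 17))"
  have C1: "1 \<le> C1" "512 * sigma ^ 4 * (D + 17) \<le> (C1 - 1)\<^sup>2"
    using D sigma by (simp_all add: C1_def)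
  define B where "B = 8 * sigma\<^sup>2 * (D + 1) + 48 * sigma\<^sup>2"
  define C3 where "C3 = 2 * (D + 18)"
  define C where "C = sqrt (36 * B + 60 * C3 + 39)"
  have BC: "0 < 36 * B + 60 * C3 + 39"
    using D sig2 by (intro add_nonneg_pos add_nonneg_nonneg) (auto simp: B_def C3_def)
  have C: "0 < C" "36 * B + 60 * C3 + 39 \<le> C\<^sup>2" using BC by (auto simp: C_def)

  define cond where "cond = (\<lambda>n. real n / lam n (L n) > eff_rank_r (p n) (lam n) (L n) * eff_rank_R
      (p n) (lam n) (L n) \<and>
        (eps n)\<^sup>2 > 4 * (L2_set (theta n) {1..p n})\<^sup>2 * (\<Sum>i=L n + 1..p n. lam n i) \<and>
        eff_variance n (p n) (L n) (U n) (lam n) (eps n) \<le> (eps n)\<^sup>2 \<and>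
        eff_bias n (p n) (L n) (U n) (f n) (lam n) (theta n) \<le> (eps n)\<^sup>2)"
  have ev_eps: "\<forall>\<^sub>F n in large_n. eps n < \<delta> \<and> real n * (eps n)\<^sup>2 > M \<and> cond n" if "0 < \<delta>" "0 < M" for \<delta> M
    using eps[THEN spec, THEN mp, OF that(1), THEN spec, THEN mp, OF that(2)]
    unfolding eventually_large_n cond_def max.bounded_iff .
  have ev_S: "\<forall>\<^sub>F n in large_n. n \<in> sample_sizes" unfolding eventually_large_n by auto
  have ev_tr: "\<forall>\<^sub>F n in large_n. 0 < trace_mat (p n) (Sig n)"
    using trace by (simp add: filterlim_at_top_dense)
  \<comment> \<open>The factor 1 / (8 K) turns the relative accuracy rho into an absolute one of at
    most lam (L + 1) / 8.\<close>
  have ev_rho: "\<forall>\<^sub>F n in large_n. norm (rho n) \<le> 1 / (8 * K) * norm (lam n (L n + 1))"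
    using landau_o.smallD[OF rho_lam, of "1 / (8 * K)"] K by simp
  have ev_ell: "\<forall>\<^sub>F n in large_n. ell n < 1"
    using order_tendstoD(2)[OF ell(2), of 1] by simp
  \<comment> \<open>The first two bounds are demanded by \<open>split_posterior\<close>, the third
    keeps variances within C1 * eps of the truth below 2 sigma^2, and r0 keeps the box inside the
    truncation.\<close>
  define \<delta> where "\<delta> = min (min (sigma\<^sup>2 / 4) (1 / 12)) (min (sigma\<^sup>2 / C1) r0)"
  have \<delta>: "0 < \<delta>" using sig2 C1 r0 by (auto simp: \<delta>_def)
  \<comment> \<open>n eps^2 has to exceed 1 and also - ln g0, so that the fixed density bound g0 is
    at least exp (- n eps^2).\<close>
  define M where "M = max 1 (- ln g0)"
  have M: "0 < M" by (simp add: M_def less_max_iff_disj)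
  have model: "\<forall>\<^sub>F n in large_n. sample_model n (p n) (L n) (U n) (Q n) (theta n) (lam n) (w n)
      (lamhat n) (vhat n) (f n)
      R sigma eta xi CI g0 (eps n) (rho n) (ell n) K \<and> C1 * eps n \<le> sigma\<^sup>2"
    using ev_eps[OF \<delta> M] ev_S ev_tr ev_rho ev_ell cov_conc
  proof eventually_elim
    case (elim n)
    have nS: "n \<in> sample_sizes" using elim by blast
    then have n: "even n" "4 \<le> n" by (auto simp: sample_sizes_def)
    have LU': "1 \<le> L n" "L n \<le> U n" "real (U n) < real n / 2" using LU nS by auto
    have pn: "real n / 2 < real (p n)" using p_gt nS by auto
    have Up: "U n < p n" using LU'(3) pn by linarith
    have Ln: "L n \<le> n" using LU' by linarith
    have es: "eigensystem (p n) (Sig n) (lam n) (w n)" using lam nS by blast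
    have Qn: "prob_space (Q n)" "sets (Q n) = sets (vec_space (p n))" using Q_prob nS by auto
    have Q2: "\<And>i j. i \<in> {1..p n} \<Longrightarrow> j \<in> {1..p n} \<Longrightarrow> integrable (Q n) (\<lambda>x. x i * x j)" using Q_moments
        nS by blast
    have Q1: "\<And>j. j \<in> {1..p n} \<Longrightarrow> (\<integral>x. x j \<partial>(Q n)) = 0" using Q_mean nS by blast
    have qS: "0 \<le> quad_form (p n) (Sig n) u" for u
      unfolding Sig_def by (rule second_moment_nonneg[OF Qn Q2 Q1])
    have lam0: "0 \<le> lam n i" if "i \<in> {1..p n}" for i
      using eigensystem_eigenvalue[OF es that] qS by simp
    have ep: "0 < eps n" using eps_pos by blast
    have ed: "eps n \<le> sigma\<^sup>2 / 4" "eps n \<le> 1 / 12" "eps n \<le> sigma\<^sup>2 / C1" "eps n \<le> r0"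
      using elim by (auto simp: \<delta>_def)
    have nu: "1 \<le> real n * (eps n)\<^sup>2" "- ln g0 \<le> real n * (eps n)\<^sup>2" using elim by (auto simp: M_def)
    have e1: "eps n < 1" using ed(2) by simp
    have L1p: "L n + 1 \<le> p n" using LU'(2) Up by linarith
    have anti: "lam n (L n + 1) \<le> lam n (L n)"
      by (rule eigensystem_mono[OF es]) (use LU' L1p in auto)
    have cn: "cond n" using elim by blast
    note rc = rate_conditions[of n "L n" "U n" "p n" "eps n" "lam n" "f n" "theta n",
        OF n(2) LU'(1,2) L1p ep e1 lam0 anti]
    have rates: "real (U n) \<le> real n * (eps n)\<^sup>2" "real n * (lam n (L n + 1))\<^sup>2 \<le> 1" "exp (- (real n *
        (eps n)\<^sup>2)) \<le> eps n"
      "exp (- (real n * (eps n)\<^sup>2)) \<le> k_prior (L n) (U n) (f n) (L n)" "real (L n) * ln (real n) \<le>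
          real n * (eps n)\<^sup>2"
      "dotp (p n) (theta n) (theta n) * (\<Sum>i=1..L n. 1 / lam n i) \<le> real n * (eps n)\<^sup>2"
      using rc cn by (auto simp: cond_def)
    have lamL0: "0 \<le> lam n (L n + 1)" using lam0 L1p by auto
    have tt: "4 * dotp (p n) (theta n) (theta n) * lam n (L n + 1) \<le> (eps n)\<^sup>2"
    proof -
      have "lam n (L n + 1) \<le> (\<Sum>i=L n + 1..p n. lam n i)" using L1p lam0 by (intro member_le_sum) auto
      then have "4 * (L2_set (theta n) {1..p n})\<^sup>2 * lam n (L n + 1) \<le> 4 * (L2_set (theta n) {1..p
          n})\<^sup>2 * (\<Sum>i=L n + 1..p n. lam n i)"
        by (intro mult_left_mono) auto
      then show ?thesis using cn unfolding cond_def L2_set_square_dotp by linarith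
    qed
    have op0: "0 < op_norm (p n) (Sig n)"
    proof -
      have "0 < real (p n) * op_norm (p n) (Sig n)"
        using elim trace_le_op_norm[of "p n" "Sig n"] by linarith
      then show ?thesis by (simp add: zero_less_mult_iff)
    qed
    have rho0: "0 \<le> rho n" using rho by blast
    have rl: "8 * (rho n * op_norm (p n) (Sig n)) \<le> lam n (L n + 1)"
    proof -
      have "rho n \<le> 1 / (8 * K) * lam n (L n + 1)" using elim rho0 lamL0 by auto
      then have "8 * K * rho n \<le> lam n (L n + 1)" using K by (simp add: field_simps)
      moreover have "8 * (rho n * op_norm (p n) (Sig n)) \<le> 8 * (rho n * K)"
        using KS[OF nS] rho0 by (intro mult_left_mono) auto
      ultimately show ?thesis by (simp add: mult.commute mult.left_commute)
    qed
    have tr: "ereal (sqrt (2 * (quad_form (p n) (Sig n) (theta n) + rho n * op_norm (p n) (Sig n) *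
        dotp (p n) (theta n) (theta n))
        + 4 * K\<^sup>2 * (eps n)\<^sup>2)) \<le> R"
    proof (rule r0(2))
      show "ereal (mat_norm (p n) (Sig n) (theta n)) < R / 2" using R_theta nS by blast
      show "0 \<le> quad_form (p n) (Sig n) (theta n)" by (rule qS)
      show "0 \<le> rho n * op_norm (p n) (Sig n) * dotp (p n) (theta n) (theta n)"
        using rho0 op0 by (intro mult_nonneg_nonneg dotp_self_nonneg) auto
      \<comment> \<open>The 1/32 is 1/8 * 1/4: the covariance error is at most lam (L + 1) / 8, and
        the rate condition bounds lam (L + 1) times the squared norm of theta by eps^2 / 4.\<close>
      have "8 * (rho n * op_norm (p n) (Sig n)) * dotp (p n) (theta n) (theta n) \<le> lam n (L n + 1) *
          dotp (p n) (theta n) (theta n)"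
        by (intro mult_right_mono rl dotp_self_nonneg)
      then show "rho n * op_norm (p n) (Sig n) * dotp (p n) (theta n) (theta n) \<le> (eps n)\<^sup>2 / 32"
        using tt by (simp add: mult.commute mult.left_commute mult.assoc)
    qed (use ep ed in auto)
    have gb: "exp (- (real n * (eps n)\<^sup>2)) \<le> g0"
    proof -
      have "- (real n * (eps n)\<^sup>2) \<le> ln g0" using nu(2) by linarith
      then have "exp (- (real n * (eps n)\<^sup>2)) \<le> exp (ln g0)" by simp
      then show ?thesis unfolding exp_ln[OF g0(1)] .
    qed
    have CIe: "C1 * eps n \<le> sigma\<^sup>2" using ed(3) C1(1) by (simp add: field_simps)
    have cv: "1 - ell n \<le> measure (P n) {d \<in> space (P n).
          op_norm (p n) (\<lambda>a b. sample_cov n d a b - Sig n a b) / op_norm (p n) (Sig n) \<le> rho n}"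
      using elim by blast
    have "sample_model n (p n) (L n) (U n) (Q n) (theta n) (lam n) (w n) (lamhat n) (vhat n) (f n)
      R sigma eta xi CI g0 (eps n) (rho n) (ell n) K"
    proof (rule sample_model.intro)
      show "AE d in data_law n (p n) (Q n) (theta n) sigma. 0 < lamhat n (first_half n d) (U n)"
        using hat_pos nS unfolding P_def by blast
      show "1 - ell n \<le> measure (data_law n (p n) (Q n) (theta n) sigma) {d \<in> space (data_law n (p
          n) (Q n) (theta n) sigma).
          op_norm (p n) (\<lambda>a b. sample_cov n d a b - second_moment (Q n) a b) / op_norm (p n)
              (second_moment (Q n)) \<le> rho n}"
        using cv unfolding P_def Sig_def .
      show "eigensystem (p n) (second_moment (Q n)) (lam n) (w n)" using es unfolding Sig_def .
      show "eigensystem (p n) (sample_cov n d) (lamhat n d) (vhat n d)" if "d \<in> space (half_space n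
          (p n))" for d
        using hat nS that by blast
      show "(\<lambda>d. vhat n d i j) \<in> borel_measurable (half_space n (p n))" if "i \<in> {1..p n}" "j \<in> {1..p
          n}" for i j
        using hat_meas nS that by blast
      show "integrable (Q n) (\<lambda>x. x i * x j)" if "i \<in> {1..p n}" "j \<in> {1..p n}" for i j by (rule
          Q2[OF that])
      show "(\<integral>x. x j \<partial>(Q n)) = 0" if "j \<in> {1..p n}" for j by (rule Q1[OF that])
      show "ell n < 1" using elim by blast
      show "g0 \<le> inv_gauss_density eta xi s" if "s \<in> {sigma\<^sup>2..sigma\<^sup>2 + 1}" for s by (rule g0(2)[OF
          that])
      show "(\<integral>\<^sup>+s. ennreal (inv_gauss_density eta xi s) * indicator {0<..} s \<partial>lborel) \<le> ennreal CI"
          by (rule CI(2))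
    qed (use n LU' Up Ln sigma Qn op0 KS[OF nS] K rho0 rl rates tt ep ed nu tr eta xi CI(1) gb in
        \<open>auto simp: Sig_def\<close>)
    with CIe show ?case by blast
  qed

  have lim_eps: "(eps \<longlongrightarrow> 0) large_n"
  proof (rule tendstoI)
    fix e :: real assume "0 < e"
    from ev_eps[OF this zero_less_one] show "\<forall>\<^sub>F n in large_n. dist (eps n) 0 < e"
      by eventually_elim (use eps_pos in \<open>auto simp: dist_real_def less_imp_le\<close>)
  qed
  have lim_nu: "filterlim (\<lambda>n. real n * (eps n)\<^sup>2) at_top large_n"
    unfolding filterlim_at_top_gt[where c = 0]
  proof (intro allI impI)
    fix Z :: real assume "0 < Z"
    from ev_eps[OF zero_less_one this] show "\<forall>\<^sub>F n in large_n. Z \<le> real n * (eps n)\<^sup>2"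
      by eventually_elim auto
  qed
  have lim_n: "filterlim real at_top large_n"
    unfolding large_n_def by (rule filterlim_mono[OF filterlim_real_sequentially order_refl]) simp
  have lim_exp: "((\<lambda>n. exp (- (c * (real n * (eps n)\<^sup>2)))) \<longlongrightarrow> 0) large_n" if "0 < c" for c
  proof -
    have "filterlim (\<lambda>n. c * (real n * (eps n)\<^sup>2)) at_top large_n"
      by (rule filterlim_tendsto_pos_mult_at_top[OF tendsto_const that lim_nu])
    from filterlim_compose[OF exp_at_bot filterlim_compose[OF filterlim_uminus_at_bot_at_top this]]
    show ?thesis by simp
  qed
  define bd where "bd = (\<lambda>n. 2 * ell n + ((2 + 4 * K\<^sup>2) / real n + 4 * (eps n)\<^sup>2)
    + (exp (- (real n * (eps n)\<^sup>2)) + 2 * exp (- (real n * (eps n)\<^sup>2 / (32 * sigma ^ 4)))))"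
  have lim_bd: "(bd \<longlongrightarrow> 0) large_n"
  proof -
    have 1: "((\<lambda>n. (2 + 4 * K\<^sup>2) / real n) \<longlongrightarrow> 0) large_n"
      by (rule tendsto_divide_0[OF tendsto_const filterlim_at_top_imp_at_infinity[OF lim_n]])
    have 2: "((\<lambda>n. exp (- (real n * (eps n)\<^sup>2))) \<longlongrightarrow> 0) large_n" using lim_exp[of 1] by simp
    have 3: "((\<lambda>n. exp (- (real n * (eps n)\<^sup>2 / (32 * sigma ^ 4)))) \<longlongrightarrow> 0) large_n"
      using lim_exp[of "1 / (32 * sigma ^ 4)"] sigma by simp
    have "(bd \<longlongrightarrow> 2 * 0 + (0 + 4 * 0\<^sup>2) + (0 + 2 * 0)) large_n"
      unfolding bd_def by (intro tendsto_intros ell(2) 1 2 3 lim_eps)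
    then show ?thesis by simp
  qed
  \<comment> \<open>Both claims follow the same way: only the set Z, its measurability and its
    deterministic bound differ.\<close>
  have conclude: "tendsto_in_prob P (\<lambda>n d. posterior n (p n) R (L n) (U n) (f n) eta xi
        (lamhat n (first_half n d)) (vhat n (first_half n d)) d (Z n)) 0 large_n"
    if meas: "\<And>n. sample_model n (p n) (L n) (U n) (Q n) (theta n) (lam n) (w n) (lamhat n) (vhat n)
        (f n)
          R sigma eta xi CI g0 (eps n) (rho n) (ell n) K \<Longrightarrow>
        sample_model.post n (p n) (L n) (U n) (lamhat n) (vhat n) (f n) R eta xi (Z n) \<in>
            borel_measurable (P n)"
      and bound: "\<And>n S1 la v X d e. C1 * eps n \<le> sigma\<^sup>2 \<Longrightarrow>
        split_posterior n (p n) (L n) (U n) (Sig n) S1 (lam n) la (w n) v (theta n) (eps n)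
          (rho n * op_norm (p n) (Sig n)) K X d e sigma eta xi CI g0 R (f n) \<Longrightarrow>
        posterior n (p n) R (L n) (U n) (f n) eta xi la v d (Z n) \<le> 2 * CI * exp (- (real n * (eps
            n)\<^sup>2))" for Z
    unfolding tendsto_in_prob_def
  proof (intro conjI allI impI)
    show "\<forall>\<^sub>F n in large_n. (\<lambda>d. posterior n (p n) R (L n) (U n) (f n) eta xi
        (lamhat n (first_half n d)) (vhat n (first_half n d)) d (Z n)) \<in> borel_measurable (P n)"
      using model
    proof eventually_elim
      case (elim n)
      then have sm: "sample_model n (p n) (L n) (U n) (Q n) (theta n) (lam n) (w n) (lamhat n) (vhat
          n) (f n)
          R sigma eta xi CI g0 (eps n) (rho n) (ell n) K" by blast
      from meas[OF this] show ?case unfolding sample_model.post_def[OF sm, abs_def] .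
    qed
    fix e :: real assume e: "0 < e"
    \<comment> \<open>For large n the deterministic bound is below any fixed e, so
      \<open>deviation_bound\<close> applies with threshold e.\<close>
    have "((\<lambda>n. 2 * CI * exp (- (1 * (real n * (eps n)\<^sup>2)))) \<longlongrightarrow> 2 * CI * 0) large_n"
      by (intro tendsto_intros lim_exp) simp
    then have ev_small: "\<forall>\<^sub>F n in large_n. 2 * CI * exp (- (real n * (eps n)\<^sup>2)) < e"
      using order_tendstoD(2)[of _ 0 large_n e] e by simp
    show "((\<lambda>n. measure (P n) {w \<in> space (P n). e < \<bar>posterior n (p n) R (L n) (U n) (f n) eta xi
        (lamhat n (first_half n w)) (vhat n (first_half n w)) w (Z n) - 0\<bar>}) \<longlongrightarrow> 0) large_n"
    proof (rule tendsto_sandwich[OF _ _ tendsto_const lim_bd])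
      show "\<forall>\<^sub>F n in large_n. measure (P n) {w \<in> space (P n). e < \<bar>posterior n (p n) R (L n) (U n) (f
          n) eta xi
        (lamhat n (first_half n w)) (vhat n (first_half n w)) w (Z n) - 0\<bar>} \<le> bd n"
        using model ev_small
      proof eventually_elim
        case (elim n)
        then have sm: "sample_model n (p n) (L n) (U n) (Q n) (theta n) (lam n) (w n) (lamhat n)
            (vhat n) (f n)
          R sigma eta xi CI g0 (eps n) (rho n) (ell n) K" and ce: "C1 * eps n \<le> sigma\<^sup>2" by blast+
        have "measure (P n) {d \<in> space (P n). e < sample_model.post n (p n) (L n) (U n) (lamhat n)
            (vhat n) (f n) R eta xi (Z n) d}
            \<le> 2 * ell n + sample_model.mean_bound n (eps n) K + sample_model.noise_bound n sigma
                (eps n)"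
          unfolding P_def
          by (rule sample_model.deviation_bound[OF sm])
            (use meas[OF sm] bound[OF ce] elim(2) in \<open>auto simp: P_def Sig_def\<close>)
        moreover have "\<bar>posterior n (p n) R (L n) (U n) (f n) eta xi
            (lamhat n (first_half n d)) (vhat n (first_half n d)) d (Z n) - 0\<bar>
            = sample_model.post n (p n) (L n) (U n) (lamhat n) (vhat n) (f n) R eta xi (Z n) d" for d
          unfolding sample_model.post_def[OF sm] by (simp add: posterior_def)
        ultimately show ?case
          unfolding bd_def sample_model.mean_bound_def[OF sm] sample_model.noise_bound_def[OF sm] by
              simp
      qed
    qed simp
  qed
  have norm: "tendsto_in_prob P (\<lambda>n d. posterior n (p n) R (L n) (U n) (f n) eta xi
        (lamhat n (first_half n d)) (vhat n (first_half n d)) d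
        ({\<theta>. mat_norm (p n) (Sig n) (\<lambda>j. \<theta> j - theta n j) > C * eps n} \<times> UNIV)) 0 large_n"
  proof (rule conclude)
    fix n
    assume sm: "sample_model n (p n) (L n) (U n) (Q n) (theta n) (lam n) (w n) (lamhat n) (vhat n) (f n)
          R sigma eta xi CI g0 (eps n) (rho n) (ell n) K"
    show "sample_model.post n (p n) (L n) (U n) (lamhat n) (vhat n) (f n) R eta xi
        ({\<theta>. mat_norm (p n) (Sig n) (\<lambda>j. \<theta> j - theta n j) > C * eps n} \<times> UNIV) \<in> borel_measurable (P n)"
      unfolding P_def Sig_def by (rule sample_model.post_norm_measurable[OF sm])
  next
    fix n S1 la v X d e
    assume ce: "C1 * eps n \<le> sigma\<^sup>2" and sp: "split_posterior n (p n) (L n) (U n) (Sig n) S1 (lam n)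
        la (w n) v (theta n) (eps n)
          (rho n * op_norm (p n) (Sig n)) K X d e sigma eta xi CI g0 R (f n)"
    show "posterior n (p n) R (L n) (U n) (f n) eta xi la v d
        ({\<theta>. mat_norm (p n) (Sig n) (\<lambda>j. \<theta> j - theta n j) > C * eps n} \<times> UNIV) \<le> 2 * CI * exp (-
            (real n * (eps n)\<^sup>2))"
      by (rule split_posterior.posterior_norm[OF sp C1(1) ce, of B C3]) (use C1 C in \<open>auto simp:
          D_def B_def C3_def\<close>)
  qed
  have variance: "tendsto_in_prob P (\<lambda>n d. posterior n (p n) R (L n) (U n) (f n) eta xi
        (lamhat n (first_half n d)) (vhat n (first_half n d)) d
        (UNIV \<times> {s2. \<bar>s2 - sigma\<^sup>2\<bar> > C1 * eps n})) 0 large_n"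
  proof (rule conclude)
    fix n
    assume sm: "sample_model n (p n) (L n) (U n) (Q n) (theta n) (lam n) (w n) (lamhat n) (vhat n) (f n)
          R sigma eta xi CI g0 (eps n) (rho n) (ell n) K"
    show "sample_model.post n (p n) (L n) (U n) (lamhat n) (vhat n) (f n) R eta xi
        (UNIV \<times> {s2. \<bar>s2 - sigma\<^sup>2\<bar> > C1 * eps n}) \<in> borel_measurable (P n)"
      unfolding P_def by (rule sample_model.post_variance_measurable[OF sm])
  next
    fix n S1 la v X d e
    assume ce: "C1 * eps n \<le> sigma\<^sup>2" and sp: "split_posterior n (p n) (L n) (U n) (Sig n) S1 (lam n)
        la (w n) v (theta n) (eps n)
          (rho n * op_norm (p n) (Sig n)) K X d e sigma eta xi CI g0 R (f n)"
    show "posterior n (p n) R (L n) (U n) (f n) eta xi la v d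
        (UNIV \<times> {s2. \<bar>s2 - sigma\<^sup>2\<bar> > C1 * eps n}) \<le> 2 * CI * exp (- (real n * (eps n)\<^sup>2))"
      by (rule split_posterior.posterior_variance[OF sp C1(1) ce]) (use C1 in \<open>simp add: D_def\<close>)
  qed
  have "0 < C1" using C1 by simp
  with norm variance C(1) show ?thesis by blast
qed

end
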